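(* Let $\mathcal{X}$ and $\mathcal{Y}$ be complex Banach spaces, let $A\in L(\mathcal{X})$ be left polaroid and let $B\in L(\mathcal{Y})$ be right polaroid. If $A$ satisfies property $(\mathcal{P}_l)$ and $B$ satisfies property $(\mathcal{P}_r)$, then the generalized derivation $\delta_{A,B}\in L(L(\mathcal{Y},\mathcal{X}))$, $\delta_{A,B}(X)=AX-XB$, is left polaroid.
   Context: For Banach spaces, $L(\mathcal{Y},\mathcal{X})$ is the Banach space of bounded linear maps $\mathcal{Y}\to\mathcal{X}$ and $L(\mathcal{X})=L(\mathcal{X},\mathcal{X})$. For a bounded operator $T$ on a complex Banach space $\mathcal{Z}$: $N(T)$ and $R(T)$ are its null space and range; $T$ is bounded below if $N(T)=\{0\}$ and $R(T)$ is closed; $\sigma_a(T)=\{\lambda\in\mathbb{C}: T-\lambda I \text{ is not bounded below}\}$; $\sigma_s(T)=\{\lambda\in\mathbb{C}: T-\lambda I\text{ is not surjective}\}$. The ascent is $asc(T)=\inf\{n\in\mathbb{N}: N(T^n)=N(T^{n+1})\}$ and the descent is $dsc(T)=\inf\{n\in\mathbb{N}: R(T^n)=R(T^{n+1})\}$, with $\inf\emptyset=\infty$. For $K\subseteq\mathbb{C}$, $iso\,K$ is the set of isolated points of $K$. A point $\lambda\in\sigma_a(T)$ is a left pole of $T$ of order $d$ if $asc(T-\lambda I)=d<\infty$ and $R((T-\lambda I)^{d+1})$ is closed. A point $\lambda\in\sigma_s(T)$ is a right pole of $T$ of order $d$ if $dsc(T-\lambda I)=d<\infty$ and $R((T-\lambda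 I)^{d})$ is closed. $T$ is left polaroid if every $\lambda\in iso\,\sigma_a(T)$ is a left pole of $T$, and right polaroid if every $\lambda\in iso\,\sigma_s(T)$ is a right pole of $T$. A left polaroid operator $T\in L(\mathcal{Z})$ satisfies property $(\mathcal{P}_l)$ if for every $\lambda\in iso\,\sigma_a(T)$, with $d(\lambda)$ the order of the left pole $\lambda$, the closed subspace $N((T-\lambda I)^{d(\lambda)})+R(T-\lambda I)$ is complemented in $\mathcal{Z}$. A right polaroid operator $T\in L(\mathcal{Z})$ satisfies property $(\mathcal{P}_r)$ if for every $\lambda\in iso\,\sigma_s(T)$, with $d(\lambda)$ the order of the right pole $\lambda$, the closed subspace $N(T-\lambda I)\cap R((T-\lambda I)^{d(\lambda)})$ is complemented in $\mathcal{Z}$. *)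

theory Defs
  imports "HOL-Analysis.Analysis"
begin

section \<open>Complex Banach spaces\<close>

class complex_normed_vector = real_normed_vector +
  fixes scaleC :: "complex \<Rightarrow> 'a \<Rightarrow> 'a"  (infixr \<open>*\<^sub>C\<close> 75)
  assumes scaleC_add_right: "c *\<^sub>C (x + y) = c *\<^sub>C x + c *\<^sub>C y"
    and scaleC_add_left: "(c + d) *\<^sub>C x = c *\<^sub>C x + d *\<^sub>C x"
    and scaleC_scaleC: "c *\<^sub>C d *\<^sub>C x = (c * d) *\<^sub>C x"
    and scaleC_of_real: "complex_of_real r *\<^sub>C x = r *\<^sub>R x"
    and norm_scaleC: "norm (c *\<^sub>C x) = cmod c * norm x"

lemma scaleC_one [simp]: "1 *\<^sub>C (x::'a::complex_normed_vector) = x"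
  using scaleC_of_real[of 1 x] by simp

lemma scaleC_zero_left [simp]: "0 *\<^sub>C (x::'a::complex_normed_vector) = 0"
  using scaleC_of_real[of 0 x] by simp

lemma scaleC_zero_right [simp]: "c *\<^sub>C (0::'a::complex_normed_vector) = 0"
  using norm_scaleC[of c "0::'a"] by simp

lemma scaleC_minus_right: "c *\<^sub>C (- x::'a::complex_normed_vector) = - (c *\<^sub>C x)"
  using scaleC_add_right[of c x "- x"] by (simp add: eq_neg_iff_add_eq_0 add.commute)

lemma scaleC_diff_right: "c *\<^sub>C (x - y::'a::complex_normed_vector) = c *\<^sub>C x - c *\<^sub>C y"
  using scaleC_add_right[of c x "- y"] by (simp add: scaleC_minus_right)

lemma bounded_linear_scaleC_right:
  "bounded_linear (\<lambda>x::'a::complex_normed_vector. c *\<^sub>C x)"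
proof (rule bounded_linear_intro[where K = "cmod c"])
  fix r :: real and x :: 'a
  show "c *\<^sub>C r *\<^sub>R x = r *\<^sub>R c *\<^sub>C x"
    by (simp add: scaleC_of_real[symmetric] scaleC_scaleC mult.commute)
qed (simp_all add: scaleC_add_right norm_scaleC mult.commute)

class complex_banach = complex_normed_vector + banach

definition csubspace :: "'a::complex_normed_vector set \<Rightarrow> bool" where
  "csubspace S \<longleftrightarrow> 0 \<in> S \<and> (\<forall>x\<in>S. \<forall>y\<in>S. x + y \<in> S) \<and> (\<forall>c. \<forall>x\<in>S. c *\<^sub>C x \<in> S)"

definition complemented :: "'a::complex_normed_vector set \<Rightarrow> bool" where
  "complemented M \<longleftrightarrow> csubspace M \<and> closed M \<and>
     (\<exists>N. csubspace N \<and> closed N \<and> M \<inter> N = {0} \<and> {x + y | x y. x \<in> M \<and> y \<in> N} = UNIV)"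


section \<open>The space of bounded complex-linear maps\<close>

definition bounded_clinear ::
    "('a::complex_normed_vector \<Rightarrow> 'b::complex_normed_vector) \<Rightarrow> bool" where
  "bounded_clinear f \<longleftrightarrow> bounded_linear f \<and> (\<forall>c x. f (c *\<^sub>C x) = c *\<^sub>C f x)"

lemma bounded_clinear_imp_bounded_linear: "bounded_clinear f \<Longrightarrow> bounded_linear f"
  by (simp add: bounded_clinear_def)

lemma bounded_clinear_zero: "bounded_clinear (\<lambda>x. 0)"
  by (simp add: bounded_clinear_def)

lemma bounded_clinear_ident: "bounded_clinear (\<lambda>x. x)"
  by (simp add: bounded_clinear_def)

lemma bounded_clinear_add:
  "bounded_clinear f \<Longrightarrow> bounded_clinear g \<Longrightarrow> bounded_clinear (\<lambda>x. f x + g x)"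
  by (simp add: bounded_clinear_def bounded_linear_add scaleC_add_right)

lemma bounded_clinear_minus: "bounded_clinear f \<Longrightarrow> bounded_clinear (\<lambda>x. - f x)"
  by (simp add: bounded_clinear_def bounded_linear_minus scaleC_minus_right)

lemma bounded_clinear_sub:
  "bounded_clinear f \<Longrightarrow> bounded_clinear g \<Longrightarrow> bounded_clinear (\<lambda>x. f x - g x)"
  by (simp add: bounded_clinear_def bounded_linear_sub scaleC_diff_right)

lemma bounded_clinear_scaleC: "bounded_clinear f \<Longrightarrow> bounded_clinear (\<lambda>x. c *\<^sub>C f x)"
  by (simp add: bounded_clinear_def scaleC_scaleC mult.commute
      bounded_linear_compose[OF bounded_linear_scaleC_right])

lemma bounded_clinear_scaleR: "bounded_clinear f \<Longrightarrow> bounded_clinear (\<lambda>x. r *\<^sub>R f x)"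
  using bounded_clinear_scaleC[of f "complex_of_real r"] by (simp add: scaleC_of_real)

lemma bounded_clinear_compose:
  "bounded_clinear f \<Longrightarrow> bounded_clinear g \<Longrightarrow> bounded_clinear (\<lambda>x. f (g x))"
  by (simp add: bounded_clinear_def bounded_linear_compose)

lemma onorm_scaleC:
  fixes f :: "'a::complex_normed_vector \<Rightarrow> 'b::complex_normed_vector"
  assumes "bounded_clinear f"
  shows "onorm (\<lambda>x. c *\<^sub>C f x) = cmod c * onorm f"
proof -
  have le: "onorm (\<lambda>x. c *\<^sub>C g x) \<le> cmod c * onorm g"
    if g: "bounded_clinear g" for c and g :: "'a \<Rightarrow> 'b"
  proof (rule onorm_bound)
    have lin: "bounded_linear g" using g by (rule bounded_clinear_imp_bounded_linear)
    then show "0 \<le> cmod c * onorm g" by (simp add: onorm_pos_le)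
    show "norm (c *\<^sub>C g x) \<le> cmod c * onorm g * norm x" for x
      using onorm[OF lin, of x] by (simp add: norm_scaleC mult.assoc mult_left_mono)
  qed
  show ?thesis
  proof (cases "c = 0")
    case True
    then show ?thesis by (simp add: onorm_zero)
  next
    case False
    have "onorm f = onorm (\<lambda>x. inverse c *\<^sub>C c *\<^sub>C f x)"
      using False by (simp add: scaleC_scaleC)
    also have "\<dots> \<le> cmod (inverse c) * onorm (\<lambda>x. c *\<^sub>C f x)"
      by (rule le[OF bounded_clinear_scaleC[OF assms]])
    finally have "cmod c * onorm f \<le> cmod c * (cmod (inverse c) * onorm (\<lambda>x. c *\<^sub>C f x))"
      by (rule mult_left_mono) simp
    also have "\<dots> = onorm (\<lambda>x. c *\<^sub>C f x)"
      using False by (simp only: mult.assoc[symmetric] norm_mult[symmetric]) simp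
    finally have "cmod c * onorm f \<le> onorm (\<lambda>x. c *\<^sub>C f x)" .
    with le[OF assms, of c] show ?thesis by simp
  qed
qed

typedef (overloaded) ('a, 'b) cblinfun (\<open>(_ \<Rightarrow>\<^sub>C\<^sub>L /_)\<close> [22, 21] 21) =
  "{f :: 'a::complex_normed_vector \<Rightarrow> 'b::complex_normed_vector. bounded_clinear f}"
  morphisms cblinfun_apply CBlinfun
  using bounded_clinear_zero by blast

setup_lifting type_definition_cblinfun

lemma cblinfun_eqI: "(\<And>x. cblinfun_apply S x = cblinfun_apply T x) \<Longrightarrow> S = T"
  by transfer auto

lemma bounded_clinear_cblinfun_apply: "bounded_clinear (cblinfun_apply T)"
  using cblinfun_apply by auto

lemma cblinfun_apply_scaleC: "cblinfun_apply T (c *\<^sub>C x) = c *\<^sub>C cblinfun_apply T x"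
  using bounded_clinear_cblinfun_apply[of T] by (simp add: bounded_clinear_def)

lemmas bounded_linear_cblinfun_apply =
  bounded_clinear_cblinfun_apply[THEN bounded_clinear_imp_bounded_linear]

instantiation cblinfun :: (complex_normed_vector, complex_normed_vector) complex_normed_vector
begin

lift_definition norm_cblinfun :: "('a \<Rightarrow>\<^sub>C\<^sub>L 'b) \<Rightarrow> real" is onorm .

lift_definition zero_cblinfun :: "'a \<Rightarrow>\<^sub>C\<^sub>L 'b" is "\<lambda>x. 0"
  by (rule bounded_clinear_zero)

lift_definition plus_cblinfun :: "('a \<Rightarrow>\<^sub>C\<^sub>L 'b) \<Rightarrow> ('a \<Rightarrow>\<^sub>C\<^sub>L 'b) \<Rightarrow> ('a \<Rightarrow>\<^sub>C\<^sub>L 'b)"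
  is "\<lambda>f g x. f x + g x"
  by (rule bounded_clinear_add)

lift_definition minus_cblinfun :: "('a \<Rightarrow>\<^sub>C\<^sub>L 'b) \<Rightarrow> ('a \<Rightarrow>\<^sub>C\<^sub>L 'b) \<Rightarrow> ('a \<Rightarrow>\<^sub>C\<^sub>L 'b)"
  is "\<lambda>f g x. f x - g x"
  by (rule bounded_clinear_sub)

lift_definition uminus_cblinfun :: "('a \<Rightarrow>\<^sub>C\<^sub>L 'b) \<Rightarrow> ('a \<Rightarrow>\<^sub>C\<^sub>L 'b)" is "\<lambda>f x. - f x"
  by (rule bounded_clinear_minus)

lift_definition scaleR_cblinfun :: "real \<Rightarrow> ('a \<Rightarrow>\<^sub>C\<^sub>L 'b) \<Rightarrow> ('a \<Rightarrow>\<^sub>C\<^sub>L 'b)"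
  is "\<lambda>r f x. r *\<^sub>R f x"
  by (rule bounded_clinear_scaleR)

lift_definition scaleC_cblinfun :: "complex \<Rightarrow> ('a \<Rightarrow>\<^sub>C\<^sub>L 'b) \<Rightarrow> ('a \<Rightarrow>\<^sub>C\<^sub>L 'b)"
  is "\<lambda>c f x. c *\<^sub>C f x"
  by (rule bounded_clinear_scaleC)

definition dist_cblinfun :: "('a \<Rightarrow>\<^sub>C\<^sub>L 'b) \<Rightarrow> ('a \<Rightarrow>\<^sub>C\<^sub>L 'b) \<Rightarrow> real"
  where "dist_cblinfun S T = norm (S - T)"

definition uniformity_cblinfun :: "(('a \<Rightarrow>\<^sub>C\<^sub>L 'b) \<times> ('a \<Rightarrow>\<^sub>C\<^sub>L 'b)) filter"
  where "uniformity_cblinfun = (INF e\<in>{0 <..}. principal {(S, T). dist S T < e})"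

definition open_cblinfun :: "('a \<Rightarrow>\<^sub>C\<^sub>L 'b) set \<Rightarrow> bool"
  where "open_cblinfun U = (\<forall>S\<in>U. \<forall>\<^sub>F (S', T) in uniformity. S' = S \<longrightarrow> T \<in> U)"

definition sgn_cblinfun :: "('a \<Rightarrow>\<^sub>C\<^sub>L 'b) \<Rightarrow> ('a \<Rightarrow>\<^sub>C\<^sub>L 'b)"
  where "sgn_cblinfun T = inverse (norm T) *\<^sub>R T"

instance
  apply standard
  unfolding dist_cblinfun_def open_cblinfun_def sgn_cblinfun_def uniformity_cblinfun_def
  apply (rule refl | (transfer, force simp: onorm_triangle onorm_scaleR onorm_eq_0 onorm_scaleC
        algebra_simps scaleC_add_left scaleC_add_right scaleC_scaleC scaleC_of_real
        dest: bounded_clinear_imp_bounded_linear))+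
  done

end

lemma norm_cblinfun: "norm (cblinfun_apply T x) \<le> norm T * norm x"
  by transfer (rule onorm[OF bounded_clinear_imp_bounded_linear])

lemma norm_cblinfun_bound:
  "0 \<le> b \<Longrightarrow> (\<And>x. norm (cblinfun_apply T x) \<le> b * norm x) \<Longrightarrow> norm T \<le> b"
  by transfer (rule onorm_bound)

instance cblinfun :: (complex_normed_vector, complex_banach) complex_banach
proof
  fix X :: "nat \<Rightarrow> 'a \<Rightarrow>\<^sub>C\<^sub>L 'b"
  assume X: "Cauchy X"
  define Y where "Y n = Blinfun (cblinfun_apply (X n))" for n
  have Y: "blinfun_apply (Y n) = cblinfun_apply (X n)" for n
    unfolding Y_def by (rule bounded_linear_Blinfun_apply[OF bounded_linear_cblinfun_apply])
  have "dist (Y m) (Y n) = dist (X m) (X n)" for m n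
    unfolding dist_norm
    by (simp add: norm_blinfun.rep_eq norm_cblinfun.rep_eq minus_blinfun.rep_eq
        minus_cblinfun.rep_eq Y)
  with X have "Cauchy Y" by (simp add: Cauchy_def)
  then obtain L where L: "Y \<longlonglongrightarrow> L"
    by (auto simp: Cauchy_convergent_iff convergent_def)
  have lim: "(\<lambda>n. cblinfun_apply (X n) x) \<longlonglongrightarrow> blinfun_apply L x" for x
    using blinfun.tendsto[OF L tendsto_const[of x]] by (simp add: Y)
  have "blinfun_apply L (c *\<^sub>C x) = c *\<^sub>C blinfun_apply L x" for c x
  proof (rule LIMSEQ_unique[OF lim])
    show "(\<lambda>n. cblinfun_apply (X n) (c *\<^sub>C x)) \<longlonglongrightarrow> c *\<^sub>C blinfun_apply L x"
      using bounded_linear.tendsto[OF bounded_linear_scaleC_right lim, of c x]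
      by (simp only: cblinfun_apply_scaleC)
  qed
  then have "bounded_clinear (blinfun_apply L)"
    by (simp add: bounded_clinear_def blinfun.bounded_linear_right)
  then obtain M where M: "cblinfun_apply M = blinfun_apply L"
    using CBlinfun_inverse by blast
  have "dist (X n) M = dist (Y n) L" for n
    unfolding dist_norm
    by (simp add: norm_blinfun.rep_eq norm_cblinfun.rep_eq minus_blinfun.rep_eq
        minus_cblinfun.rep_eq Y M)
  with L have "X \<longlonglongrightarrow> M" by (simp add: tendsto_dist_iff[of X] tendsto_dist_iff[of Y])
  then show "convergent X" by (auto simp: convergent_def)
qed

lift_definition cblinfun_id :: "'a::complex_normed_vector \<Rightarrow>\<^sub>C\<^sub>L 'a" is "\<lambda>x. x"
  by (rule bounded_clinear_ident)

lift_definition cblinfun_compose ::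
  "('b::complex_normed_vector \<Rightarrow>\<^sub>C\<^sub>L 'c::complex_normed_vector) \<Rightarrow>
   ('a::complex_normed_vector \<Rightarrow>\<^sub>C\<^sub>L 'b) \<Rightarrow> ('a \<Rightarrow>\<^sub>C\<^sub>L 'c)"  (infixl \<open>o\<^sub>C\<^sub>L\<close> 67)
  is "\<lambda>f g x. f (g x)"
  by (rule bounded_clinear_compose)

primrec cblinfun_power :: "('a::complex_normed_vector \<Rightarrow>\<^sub>C\<^sub>L 'a) \<Rightarrow> nat \<Rightarrow> ('a \<Rightarrow>\<^sub>C\<^sub>L 'a)" where
  "cblinfun_power T 0 = cblinfun_id"
| "cblinfun_power T (Suc n) = T o\<^sub>C\<^sub>L cblinfun_power T n"

definition null_space ::
    "('a::complex_normed_vector \<Rightarrow>\<^sub>C\<^sub>L 'b::complex_normed_vector) \<Rightarrow> 'a set" where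
  "null_space T = {x. cblinfun_apply T x = 0}"

definition range_space ::
    "('a::complex_normed_vector \<Rightarrow>\<^sub>C\<^sub>L 'b::complex_normed_vector) \<Rightarrow> 'b set" where
  "range_space T = range (cblinfun_apply T)"


section \<open>Spectra, ascent, descent, poles\<close>

definition bounded_below ::
    "('a::complex_normed_vector \<Rightarrow>\<^sub>C\<^sub>L 'b::complex_normed_vector) \<Rightarrow> bool" where
  "bounded_below T \<longleftrightarrow> null_space T = {0} \<and> closed (range_space T)"

definition sigma_a :: "('a::complex_normed_vector \<Rightarrow>\<^sub>C\<^sub>L 'a) \<Rightarrow> complex set" where
  "sigma_a T = {\<mu>. \<not> bounded_below (T - \<mu> *\<^sub>C cblinfun_id)}"

definition sigma_s :: "('a::complex_normed_vector \<Rightarrow>\<^sub>C\<^sub>L 'a) \<Rightarrow> complex set" where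
  "sigma_s T = {\<mu>. \<not> surj (cblinfun_apply (T - \<mu> *\<^sub>C cblinfun_id))}"

definition iso :: "complex set \<Rightarrow> complex set" where
  "iso K = {\<mu>. \<mu> isolated_in K}"

(* On enat, Inf {} is infinity. *)
definition asc :: "('a::complex_normed_vector \<Rightarrow>\<^sub>C\<^sub>L 'a) \<Rightarrow> enat" where
  "asc T = Inf {enat n | n.
     null_space (cblinfun_power T n) = null_space (cblinfun_power T (n + 1))}"

definition dsc :: "('a::complex_normed_vector \<Rightarrow>\<^sub>C\<^sub>L 'a) \<Rightarrow> enat" where
  "dsc T = Inf {enat n | n.
     range_space (cblinfun_power T n) = range_space (cblinfun_power T (n + 1))}"

definition left_pole_of_order ::
    "('a::complex_normed_vector \<Rightarrow>\<^sub>C\<^sub>L 'a) \<Rightarrow> complex \<Rightarrow> nat \<Rightarrow> bool" where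
  "left_pole_of_order T \<mu> d \<longleftrightarrow> \<mu> \<in> sigma_a T \<and>
     asc (T - \<mu> *\<^sub>C cblinfun_id) = enat d \<and>
     closed (range_space (cblinfun_power (T - \<mu> *\<^sub>C cblinfun_id) (d + 1)))"

definition right_pole_of_order ::
    "('a::complex_normed_vector \<Rightarrow>\<^sub>C\<^sub>L 'a) \<Rightarrow> complex \<Rightarrow> nat \<Rightarrow> bool" where
  "right_pole_of_order T \<mu> d \<longleftrightarrow> \<mu> \<in> sigma_s T \<and>
     dsc (T - \<mu> *\<^sub>C cblinfun_id) = enat d \<and>
     closed (range_space (cblinfun_power (T - \<mu> *\<^sub>C cblinfun_id) d))"

definition left_polaroid :: "('a::complex_normed_vector \<Rightarrow>\<^sub>C\<^sub>L 'a) \<Rightarrow> bool" where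
  "left_polaroid T \<longleftrightarrow> (\<forall>\<mu>\<in>iso (sigma_a T). \<exists>d. left_pole_of_order T \<mu> d)"

definition right_polaroid :: "('a::complex_normed_vector \<Rightarrow>\<^sub>C\<^sub>L 'a) \<Rightarrow> bool" where
  "right_polaroid T \<longleftrightarrow> (\<forall>\<mu>\<in>iso (sigma_s T). \<exists>d. right_pole_of_order T \<mu> d)"

(* The order d is determined by T and the pole, so quantifying over all d below
   refers to the order of the pole, which exists when T is left (right) polaroid.
   The requirement in complemented that the subspace be closed is
   automatic here, see the two closedness lemmas. *)

definition property_Pl :: "('a::complex_normed_vector \<Rightarrow>\<^sub>C\<^sub>L 'a) \<Rightarrow> bool" where
  "property_Pl T \<longleftrightarrow> (\<forall>\<mu>\<in>iso (sigma_a T). \<forall>d. left_pole_of_order T \<mu> d \<longrightarrow>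
     complemented {x + y | x y.
       x \<in> null_space (cblinfun_power (T - \<mu> *\<^sub>C cblinfun_id) d) \<and>
       y \<in> range_space (T - \<mu> *\<^sub>C cblinfun_id)})"

definition property_Pr :: "('a::complex_normed_vector \<Rightarrow>\<^sub>C\<^sub>L 'a) \<Rightarrow> bool" where
  "property_Pr T \<longleftrightarrow> (\<forall>\<mu>\<in>iso (sigma_s T). \<forall>d. right_pole_of_order T \<mu> d \<longrightarrow>
     complemented (null_space (T - \<mu> *\<^sub>C cblinfun_id) \<inter>
       range_space (cblinfun_power (T - \<mu> *\<^sub>C cblinfun_id) d)))"

lemma cblinfun_power_apply:
  "cblinfun_apply (cblinfun_power T n) = (cblinfun_apply T ^^ n)"
  by (induction n) (auto simp: cblinfun_id.rep_eq cblinfun_compose.rep_eq fun_eq_iff)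

lemma closed_left_pole_subspace:
  assumes "left_pole_of_order T \<mu> d"
  defines "S \<equiv> T - \<mu> *\<^sub>C cblinfun_id"
  shows "closed {x + y | x y. x \<in> null_space (cblinfun_power S d) \<and> y \<in> range_space S}"
proof -
  interpret P: bounded_linear "cblinfun_apply (cblinfun_power S d)"
    by (rule bounded_linear_cblinfun_apply)
  have shift: "cblinfun_apply (cblinfun_power S (d + 1)) z =
      cblinfun_apply (cblinfun_power S d) (cblinfun_apply S z)" for z
    unfolding cblinfun_power_apply by (simp add: funpow_swap1)
  have "{x + y | x y. x \<in> null_space (cblinfun_power S d) \<and> y \<in> range_space S} =
      cblinfun_apply (cblinfun_power S d) -` range_space (cblinfun_power S (d + 1))"
    (is "?L = ?R")
  proof (intro equalityI subsetI)
    fix v assume "v \<in> ?L"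
    then show "v \<in> ?R"
      by (auto simp: null_space_def range_space_def P.add shift[symmetric] simp del: Suc_eq_plus1)
  next
    fix v assume "v \<in> ?R"
    then obtain z where z: "cblinfun_apply (cblinfun_power S d) v =
        cblinfun_apply (cblinfun_power S d) (cblinfun_apply S z)"
      unfolding range_space_def vimage_def image_def mem_Collect_eq shift by blast
    have "v = (v - cblinfun_apply S z) + cblinfun_apply S z" by simp
    moreover have "v - cblinfun_apply S z \<in> null_space (cblinfun_power S d)"
      using z by (simp add: null_space_def P.diff)
    ultimately show "v \<in> ?L" unfolding range_space_def by blast
  qed
  moreover have "closed ?R"
    using assms(1) unfolding left_pole_of_order_def S_def[symmetric]
    by (intro closed_vimage) (auto simp: P.isCont intro!: continuous_at_imp_continuous_on)
  ultimately show ?thesis by simp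
qed

lemma closed_right_pole_subspace:
  assumes "right_pole_of_order T \<mu> d"
  defines "S \<equiv> T - \<mu> *\<^sub>C cblinfun_id"
  shows "closed (null_space S \<inter> range_space (cblinfun_power S d))"
proof (rule closed_Int)
  interpret P: bounded_linear "cblinfun_apply S"
    by (rule bounded_linear_cblinfun_apply)
  have "null_space S = cblinfun_apply S -` {0}" by (auto simp: null_space_def)
  moreover have "closed \<dots>"
    by (intro closed_vimage) (auto simp: P.isCont intro!: continuous_at_imp_continuous_on)
  ultimately show "closed (null_space S)" by simp
  show "closed (range_space (cblinfun_power S d))"
    using assms(1) unfolding right_pole_of_order_def S_def by simp
qed


section \<open>Generalized derivations\<close>

lemma bounded_clinear_generalized_derivation:
  fixes A :: "'x::complex_normed_vector \<Rightarrow>\<^sub>C\<^sub>L 'x" and B :: "'y::complex_normed_vector \<Rightarrow>\<^sub>C\<^sub>L 'y"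
  shows "bounded_clinear (\<lambda>X :: 'y \<Rightarrow>\<^sub>C\<^sub>L 'x. A o\<^sub>C\<^sub>L X - X o\<^sub>C\<^sub>L B)"
proof -
  have linA: "cblinfun_apply A (u + v) = cblinfun_apply A u + cblinfun_apply A v"
    "cblinfun_apply A (c *\<^sub>C u) = c *\<^sub>C cblinfun_apply A u"
    "cblinfun_apply A (r *\<^sub>R u) = r *\<^sub>R cblinfun_apply A u" for u v c r
    using bounded_clinear_cblinfun_apply[of A]
    by (simp_all add: bounded_clinear_def linear_simps)
  note rep = minus_cblinfun.rep_eq plus_cblinfun.rep_eq scaleR_cblinfun.rep_eq
    scaleC_cblinfun.rep_eq cblinfun_compose.rep_eq
  have "bounded_linear (\<lambda>X :: 'y \<Rightarrow>\<^sub>C\<^sub>L 'x. A o\<^sub>C\<^sub>L X - X o\<^sub>C\<^sub>L B)"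
  proof (rule bounded_linear_intro[where K = "norm A + norm B"])
    fix X :: "'y \<Rightarrow>\<^sub>C\<^sub>L 'x"
    show "norm (A o\<^sub>C\<^sub>L X - X o\<^sub>C\<^sub>L B) \<le> norm X * (norm A + norm B)"
    proof (rule norm_cblinfun_bound)
      fix y
      have "norm (cblinfun_apply A (cblinfun_apply X y)) \<le> norm A * (norm X * norm y)"
        by (rule order_trans[OF norm_cblinfun mult_left_mono[OF norm_cblinfun]]) simp
      moreover have "norm (cblinfun_apply X (cblinfun_apply B y)) \<le> norm X * (norm B * norm y)"
        by (rule order_trans[OF norm_cblinfun mult_left_mono[OF norm_cblinfun]]) simp
      ultimately show "norm (cblinfun_apply (A o\<^sub>C\<^sub>L X - X o\<^sub>C\<^sub>L B) y)
          \<le> norm X * (norm A + norm B) * norm y"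
        unfolding rep
        by (intro order_trans[OF norm_triangle_ineq4]) (simp add: algebra_simps)
    qed simp
  qed (auto intro!: cblinfun_eqI simp: rep linA algebra_simps)
  moreover have "A o\<^sub>C\<^sub>L (c *\<^sub>C X) - (c *\<^sub>C X) o\<^sub>C\<^sub>L B = c *\<^sub>C (A o\<^sub>C\<^sub>L X - X o\<^sub>C\<^sub>L B)"
    for c and X :: "'y \<Rightarrow>\<^sub>C\<^sub>L 'x"
    by (auto intro!: cblinfun_eqI simp: rep linA scaleC_diff_right)
  ultimately show ?thesis by (simp add: bounded_clinear_def)
qed

lift_definition generalized_derivation ::
  "('x::complex_normed_vector \<Rightarrow>\<^sub>C\<^sub>L 'x) \<Rightarrow> ('y::complex_normed_vector \<Rightarrow>\<^sub>C\<^sub>L 'y) \<Rightarrow>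
   (('y \<Rightarrow>\<^sub>C\<^sub>L 'x) \<Rightarrow>\<^sub>C\<^sub>L ('y \<Rightarrow>\<^sub>C\<^sub>L 'x))"
  is "\<lambda>A B X. A o\<^sub>C\<^sub>L X - X o\<^sub>C\<^sub>L B"
  by (rule bounded_clinear_generalized_derivation)

lemma generalized_derivation_apply:
  "cblinfun_apply (generalized_derivation A B) X = A o\<^sub>C\<^sub>L X - X o\<^sub>C\<^sub>L B"
  by (simp add: generalized_derivation.rep_eq)

end

theory Submission
  imports Defs
begin

text \<open>
  Let \<open>\<kappa>\<close> be an isolated point of \<open>sigma_a\<close> of the derivation and \<open>D X = A X - X B - \<kappa> X\<close>. The
  inclusion of \<open>sigma_a A - sigma_s B\<close> in \<open>sigma_a\<close> of the derivation
  (\<open>sigma_a_minus_sigma_s_subset\<close>, which rests on the Hahn-Banach theorem) leaves only finitely many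
  \<open>\<mu> \<in> sigma_a A\<close> with \<open>\<mu> - \<kappa> \<in> sigma_s B\<close>, and makes each of these \<open>\<mu>\<close> and \<open>\<mu> - \<kappa>\<close>
  isolated. By assumption they are left poles of \<open>A\<close> and right poles of \<open>B\<close>.

  At each of these poles the complementation hypothesis yields a Kato decomposition
  (\<open>kato_projection_of_finite_ascent\<close>, \<open>kato_projection_of_finite_descent\<close>): a bounded projection
  \<open>P \<mu>\<close> commuting with \<open>A\<close> such that \<open>A - \<mu>\<close> is nilpotent on its range and bounded below on its
  kernel, and a bounded projection \<open>Q \<mu>\<close> commuting with \<open>B\<close> such that \<open>B - (\<mu> - \<kappa>)\<close> is nilpotent
  on its range and maps its kernel onto itself. Then \<open>E X = \<Sum>\<mu>. P \<mu> X Q \<mu>\<close> is a projection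
  commuting with \<open>D\<close>, and \<open>D\<close> is nilpotent on its range. If \<open>D\<close> is bounded below on the kernel of
  \<open>E\<close>, then \<open>D\<close> is the direct sum of a nilpotent operator and one that is bounded below, so that
  \<open>\<kappa>\<close> is a left pole (\<open>finite_ascent_closed_range_if_nilpotent_part\<close>).

  The core is therefore the estimate \<open>norm X \<le> L * (norm (D X) + norm (E X))\<close>. In the simplest case,
  without any \<open>\<mu>\<close> as above, it says that \<open>\<kappa>\<close> lies outside \<open>sigma_a\<close> of the derivation if \<open>\<kappa>\<close>
  is outside \<open>sigma_a A - sigma_s B\<close>. This is usually proved with the joint spectrum: on the
  approximate kernel of \<open>D\<close>, left multiplication by \<open>A\<close> agrees with right multiplication by
  \<open>B + \<kappa>\<close>, and its approximate point spectrum is nonempty. To avoid ultraproducts and quotient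
  spaces, \<open>dominated_by_seminorm\<close> states the nonemptiness for vectors modulo a seminorm \<open>g\<close>; here
  \<open>g X = norm (D X) + norm (E X)\<close>. Its proof replaces Liouville's theorem for the resolvent by averages
  over roots of unity, which are polynomial identities valid on single vectors.
\<close>

section \<open>Open mappings between closed subspaces\<close>

text \<open>
  Newton-type iteration: the residual is halved by each approximate solution, so the
  corrections form a geometric series, which converges in \<open>V\<close> to an exact solution.
\<close>

lemma exact_preimage_if_approximate_preimage:
  fixes f :: "'a::banach \<Rightarrow> 'b::real_normed_vector"
  assumes f: "bounded_linear f" and V: "subspace V" "closed V"
    and W: "subspace W" "f ` V \<subseteq> W"
    and approx: "\<And>w. w \<in> W \<Longrightarrow> \<exists>x\<in>V. norm x \<le> K * norm w \<and> norm (w - f x) \<le> norm w / 2"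
    and w: "w \<in> W"
  shows "\<exists>x\<in>V. f x = w \<and> norm x \<le> 2 * K * norm w"
proof -
  interpret f: bounded_linear f by (rule f)
  obtain h where hV: "h v \<in> V" and hn: "norm (h v) \<le> K * norm v"
    and hh: "norm (v - f (h v)) \<le> norm v / 2" if "v \<in> W" for v
    using approx by metis
  define r where "r n = ((\<lambda>v. v - f (h v)) ^^ n) w" for n
  have r0: "r 0 = w" and rS: "r (Suc n) = r n - f (h (r n))" for n
    by (simp_all add: r_def)
  have rW: "r n \<in> W" for n
  proof (induction n)
    case (Suc n)
    then show ?case using W hV[OF Suc] by (auto simp: rS intro!: subspace_diff)
  qed (simp add: r0 w)
  have rn: "norm (r n) \<le> norm w * (1/2) ^ n" for n
  proof (induction n)
    case (Suc n)
    then show ?case using hh[OF rW[of n]] by (simp add: rS)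
  qed (simp add: r0)
  have bound: "norm (h (r n)) \<le> K * norm w * (1/2) ^ n" for n
  proof (cases "r n = 0")
    case True
    have "norm (h (r n)) \<le> 0" using hn[OF rW[of n]] True by simp
    have "0 \<le> K * norm w"
      using hn[OF w] norm_ge_zero order_trans by blast
    then have "0 \<le> K * norm w * (1/2) ^ n" by simp
    with \<open>norm (h (r n)) \<le> 0\<close> show ?thesis by linarith
  next
    case False
    have "0 \<le> K * norm (r n)" using hn[OF rW[of n]] norm_ge_zero order_trans by blast
    then have "0 \<le> K" using False by (simp add: zero_le_mult_iff)
    then show ?thesis
      using order_trans[OF hn[OF rW[of n]] mult_left_mono[OF rn[of n]]] by (simp add: mult.assoc)
  qed
  have geo: "(\<lambda>n. K * norm w * (1/2) ^ n) sums (K * norm w * 2)"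
    using sums_mult[OF geometric_sums[of "1/2::real"]] by simp
  have sN: "summable (\<lambda>n. norm (h (r n)))"
    by (rule summable_comparison_test'[OF sums_summable[OF geo], of 0]) (simp add: bound)
  then have sm: "summable (\<lambda>n. h (r n))" by (rule summable_norm_cancel)
  define x where "x = (\<Sum>n. h (r n))"
  have xs: "(\<lambda>n. \<Sum>i<n. h (r i)) \<longlonglongrightarrow> x"
    using summable_LIMSEQ[OF sm] by (simp add: x_def)
  have "x \<in> V"
    by (rule closed_sequentially[OF V(2) _ xs]) (auto intro!: subspace_sum V hV rW)
  moreover have "f x = w"
  proof -
    have "f (\<Sum>i<n. h (r i)) = w - r n" for n
      by (induction n) (simp_all add: r0 rS f.add)
    moreover have "(\<lambda>n. f (\<Sum>i<n. h (r i))) \<longlonglongrightarrow> f x" by (rule f.tendsto[OF xs])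
    moreover have "r \<longlonglongrightarrow> 0"
    proof (rule Lim_null_comparison)
      show "\<forall>\<^sub>F n in sequentially. norm (r n) \<le> norm w * (1/2) ^ n" by (simp add: rn)
      show "(\<lambda>n. norm w * (1/2::real) ^ n) \<longlonglongrightarrow> 0"
        using tendsto_mult_right_zero[OF LIMSEQ_realpow_zero[of "1/2"]] by simp
    qed
    then have "(\<lambda>n. w - r n) \<longlonglongrightarrow> w - 0" by (intro tendsto_intros)
    ultimately show ?thesis using LIMSEQ_unique by force
  qed
  moreover have "norm x \<le> 2 * K * norm w"
  proof -
    have "norm x \<le> (\<Sum>n. norm (h (r n)))" unfolding x_def by (rule summable_norm[OF sN])
    also have "\<dots> \<le> (\<Sum>n. K * norm w * (1/2) ^ n)"
      by (rule suminf_le[OF bound sN sums_summable[OF geo]])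
    also have "\<dots> = 2 * K * norm w" using sums_unique[OF geo] by simp
    finally show ?thesis .
  qed
  ultimately show ?thesis by blast
qed

text \<open>
  The open mapping theorem, for a map restricted to a closed subspace. The image \<open>W\<close> is itself
  complete, so by Baire's theorem the closure of the image of some ball of \<open>V\<close> has interior in
  \<open>W\<close>. Differences of points in this interior give approximate preimages of all small vectors.
  Subspaces rather than types are needed because the theorem will be applied to ranges of powers
  and to products of complementary subspaces.
\<close>

theorem bounded_preimages_if_closed_image:
  fixes f :: "'a::banach \<Rightarrow> 'b::banach"
  assumes f: "bounded_linear f" and V: "subspace V" "closed V" and cl: "closed (f ` V)"
  obtains C where "C > 0" "\<And>x. x \<in> V \<Longrightarrow> \<exists>u\<in>V. f u = f x \<and> norm u \<le> C * norm (f x)"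
proof -
  interpret f: bounded_linear f by (rule f)
  define W where "W = f ` V"
  define X where "X = top_of_set W"
  have W: "subspace W" "closed W" "f ` V \<subseteq> W"
    unfolding W_def using cl linear_subspace_image[OF f.linear_axioms V(1)] by blast+
  \<comment> \<open>\<open>W\<close> is exhausted by the countably many closed sets \<open>F n\<close>.\<close>
  define F where "F n = closure (f ` (V \<inter> cball 0 (real n)))" for n :: nat
  have FW: "F n \<subseteq> W" for n
    unfolding F_def W_def using cl by (intro closure_minimal) auto
  have cover: "\<Union>(range F) = W"
  proof
    show "\<Union>(range F) \<subseteq> W" using FW by blast
    show "W \<subseteq> \<Union>(range F)"
    proof
      fix y assume "y \<in> W"
      then obtain x where x: "x \<in> V" "y = f x" by (auto simp: W_def)
      obtain n where "norm x \<le> real n" using real_arch_simple by blast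
      then have "y \<in> F n" using x closure_subset[of "f ` (V \<inter> cball 0 (real n))"]
        by (auto simp: F_def)
      then show "y \<in> \<Union>(range F)" by blast
    qed
  qed
  have "X interior_of \<Union>(range F) \<noteq> {}"
  proof -
    have "X interior_of \<Union>(range F) = W"
      unfolding cover by (metis X_def interior_of_topspace topspace_euclidean_subtopology)
    moreover have "0 \<in> W" using W(1) by (rule subspace_0)
    ultimately show ?thesis by blast
  qed
  moreover have "completely_metrizable_space X"
    unfolding X_def using W(2)
    by (simp add: completely_metrizable_space_closedin completely_metrizable_space_euclidean
        closed_closedin[symmetric])
  ultimately obtain n where n: "X interior_of F n \<noteq> {}"
  proof (rule_tac ccontr)
    assume cm: "completely_metrizable_space X" and ne: "X interior_of \<Union>(range F) \<noteq> {}"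
      and "\<not> thesis"
    then have "X interior_of F n = {}" for n using that by blast
    moreover have "closedin X (F n)" for n
      unfolding X_def using closed_subset[OF FW[of n]] by (simp add: F_def)
    ultimately have "closedin X T \<and> X interior_of T = {}" if "T \<in> range F" for T
      using that by blast
    with cm have "X interior_of \<Union>(range F) = {}"
      by (intro Baire_category_alt) simp_all
    with ne show False by blast
  qed
  then obtain y0 where y0: "y0 \<in> X interior_of F n" by blast
  then obtain T where T: "openin X T" "y0 \<in> T" "T \<subseteq> F n"
    by (auto simp: interior_of_def)
  obtain e where e: "e > 0" "ball y0 e \<inter> W \<subseteq> T"
    using T(1,2) unfolding X_def openin_contains_ball by blast
  have y0W: "y0 \<in> W" using T FW by blast
  have small: "\<exists>x\<in>V. norm x \<le> 2 * real n \<and> norm (w - f x) < d"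
    if "w \<in> W" "norm w < e" "d > 0" for w d
  proof -
    have near: "\<exists>a. a \<in> V \<and> norm a \<le> n \<and> dist (f a) z < d/2" if "z \<in> F n" for z
    proof -
      from that have "\<exists>q\<in>f ` (V \<inter> cball 0 (real n)). dist q z < d/2"
        using half_gt_zero[OF \<open>d > 0\<close>] unfolding F_def closure_approachable by blast
      then show ?thesis by auto
    qed
    have "y0 + w \<in> ball y0 e \<inter> W"
      using that(1,2) subspace_add[OF W(1) y0W that(1)] by (simp add: dist_norm)
    then have "y0 + w \<in> F n" "y0 \<in> F n" using e(2) T by blast+
    then obtain a b where a: "a \<in> V" "norm a \<le> n" "dist (f a) (y0 + w) < d/2"
      and b: "b \<in> V" "norm b \<le> n" "dist (f b) y0 < d/2"
      using near by meson
    have "w - f (a - b) = (f b - y0) - (f a - (y0 + w))" by (simp add: f.diff)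
    then have "norm (w - f (a - b)) = norm ((f b - y0) - (f a - (y0 + w)))" by (rule arg_cong)
    then have "norm (w - f (a - b)) < d"
      using norm_triangle_ineq4[of "f b - y0" "f a - (y0 + w)"] a(3) b(3)
      unfolding dist_norm by linarith
    moreover have "norm (a - b) \<le> 2 * real n"
      using norm_triangle_ineq4[of a b] a b by simp
    ultimately show ?thesis using subspace_diff[OF V(1) a(1) b(1)] by blast
  qed
  define K where "K = 4 * real n / e + 1"
  have "\<exists>x\<in>V. norm x \<le> K * norm w \<and> norm (w - f x) \<le> norm w / 2" if w: "w \<in> W" for w
  proof (cases "w = 0")
    case True
    then show ?thesis using V(1) by (intro bexI[of _ 0]) (auto simp: subspace_0)
  next
    case False
    define c where "c = e / (2 * norm w)"
    have c: "c > 0" using False e by (simp add: c_def)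
    have "norm (c *\<^sub>R w) < e" using False e by (simp add: c_def)
    moreover have "c *\<^sub>R w \<in> W" using W(1) w by (rule subspace_scale)
    moreover have "c * norm w / 2 > 0" using c False by simp
    ultimately obtain x where x: "x \<in> V" "norm x \<le> 2 * real n"
      "norm (c *\<^sub>R w - f x) < c * norm w / 2" using small by blast
    have "w - f (x /\<^sub>R c) = (c *\<^sub>R w - f x) /\<^sub>R c"
      using c by (simp add: f.scaleR scaleR_diff_right)
    then have "norm (w - f (x /\<^sub>R c)) = norm (c *\<^sub>R w - f x) / c"
      using c by (simp add: divide_inverse mult.commute)
    also have "\<dots> \<le> norm w / 2" using c x(3) by (simp add: field_simps)
    finally have 1: "norm (w - f (x /\<^sub>R c)) \<le> norm w / 2" .
    have "norm (x /\<^sub>R c) \<le> 2 * real n / c"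
      using c x(2) by (simp add: divide_inverse mult.commute)
    also have "\<dots> = 4 * real n / e * norm w" by (simp add: c_def)
    also have "\<dots> \<le> K * norm w" by (intro mult_right_mono) (auto simp: K_def)
    finally show ?thesis using 1 subspace_scale[OF V(1) x(1)] by blast
  qed
  note * = exact_preimage_if_approximate_preimage[OF f V W(1,3) this]
  show thesis
  proof (rule that)
    show "2 * K > 0" using e by (simp add: K_def add_nonneg_pos)
    show "\<exists>u\<in>V. f u = f x \<and> norm u \<le> 2 * K * norm (f x)" if "x \<in> V" for x
      using *[of "f x"] that by (auto simp: W_def)
  qed
qed

corollary bounded_preimages_if_closed_range:
  fixes f :: "'a::banach \<Rightarrow> 'b::banach"
  assumes "bounded_linear f" "closed (range f)"
  obtains C where "C > 0" "\<And>x. \<exists>u. f u = f x \<and> norm u \<le> C * norm (f x)"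
  using bounded_preimages_if_closed_image[OF assms(1) subspace_UNIV closed_UNIV assms(2)]
  by (metis UNIV_I)

lemma closed_image_if_bounded_below:
  fixes f :: "'a::banach \<Rightarrow> 'b::real_normed_vector"
  assumes f: "bounded_linear f" and V: "subspace V" "closed V"
    and le: "\<And>x. x \<in> V \<Longrightarrow> norm x \<le> C * norm (f x)"
  shows "closed (f ` V)"
proof (unfold closed_sequential_limits, intro allI impI)
  interpret f: bounded_linear f by (rule f)
  fix y l assume "(\<forall>n. y n \<in> f ` V) \<and> y \<longlonglongrightarrow> l"
  then have yl: "y \<longlonglongrightarrow> l" and "\<forall>n. \<exists>a. a \<in> V \<and> y n = f a" by blast+
  then obtain x where x: "\<And>n. x n \<in> V" "\<And>n. y n = f (x n)" by metis
  have "Cauchy y" using yl LIMSEQ_imp_Cauchy by blast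
  have "Cauchy x"
  proof (rule CauchyI)
    fix e :: real assume "e > 0"
    define D where "D = \<bar>C\<bar> + 1"
    have D: "D > 0" by (simp add: D_def)
    then obtain N where N: "\<And>m n. m \<ge> N \<Longrightarrow> n \<ge> N \<Longrightarrow> norm (y m - y n) < e / D"
      using CauchyD[OF \<open>Cauchy y\<close>, of "e / D"] \<open>e > 0\<close> by auto
    have "norm (x m - x n) < e" if "m \<ge> N" "n \<ge> N" for m n
    proof -
      have "norm (x m - x n) \<le> C * norm (y m - y n)"
        using le[of "x m - x n"] x V(1) by (simp add: f.diff subspace_diff)
      also have "\<dots> \<le> D * norm (y m - y n)" by (intro mult_right_mono) (auto simp: D_def)
      also have "\<dots> < e" using N[OF that] D by (simp add: field_simps)
      finally show ?thesis .
    qed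
    then show "\<exists>M. \<forall>m\<ge>M. \<forall>n\<ge>M. norm (x m - x n) < e" by blast
  qed
  then obtain a where a: "x \<longlonglongrightarrow> a" using Cauchy_convergent convergent_def by blast
  have "a \<in> V" using closed_sequentially[OF V(2) _ a] x by blast
  moreover have "f a = l"
    using LIMSEQ_unique[OF _ yl] f.tendsto[OF a] x(2) by presburger
  ultimately show "l \<in> f ` V" by blast
qed

section \<open>The Hahn-Banach theorem and surjectivity\<close>

text \<open>
  Homogeneity is only required as an inequality for positive scalars; equality follows by scaling
  with the inverse. This form keeps the verification for infima short.
\<close>

definition sublinear :: "('a::real_vector \<Rightarrow> real) \<Rightarrow> bool" where
  "sublinear p \<longleftrightarrow> (\<forall>x y. p (x + y) \<le> p x + p y) \<and> (\<forall>c x. c > 0 \<longrightarrow> p (c *\<^sub>R x) \<le> c * p x)"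

lemma sublinear_add: "sublinear p \<Longrightarrow> p (x + y) \<le> p x + p y"
  by (simp add: sublinear_def)

lemma sublinear_scale:
  assumes p: "sublinear p" and "c \<ge> 0"
  shows "p (c *\<^sub>R x) = c * p x"
proof (cases "c = 0")
  case True
  have "p (2 *\<^sub>R 0) \<le> 2 * p 0" "p ((1/2) *\<^sub>R 0) \<le> (1/2) * p 0"
    using p unfolding sublinear_def by (blast intro: zero_less_numeral) (meson p sublinear_def half_gt_zero zero_less_one)
  with True show ?thesis by simp
next
  case False
  then have c: "c > 0" using assms by simp
  have "p (inverse c *\<^sub>R c *\<^sub>R x) \<le> inverse c * p (c *\<^sub>R x)"
    using p c unfolding sublinear_def by (meson positive_imp_inverse_positive)
  then have "c * p x \<le> p (c *\<^sub>R x)" using c by (simp add: field_simps)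
  moreover have "p (c *\<^sub>R x) \<le> c * p x" using p c by (simp add: sublinear_def)
  ultimately show ?thesis by simp
qed

lemma sublinear_0: "sublinear p \<Longrightarrow> p 0 = 0"
  using sublinear_scale[of p 0 0] by simp

lemma sublinear_minus: "sublinear p \<Longrightarrow> - p (- x) \<le> p x"
  using sublinear_add[of p x "- x"] by (simp add: sublinear_0)

text \<open>
  The largest sublinear functional below \<open>q\<close> whose value at \<open>- y\<close> is \<open>- q y\<close>.
  A minimal sublinear functional cannot be lowered by tilting, and this makes it linear.
\<close>

definition tilt :: "('a::real_vector \<Rightarrow> real) \<Rightarrow> 'a \<Rightarrow> 'a \<Rightarrow> real" where
  "tilt q y z = (INF t\<in>{0..}. q (z + t *\<^sub>R y) - t * q y)"

lemma
  assumes q: "sublinear q"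
  shows tilt_le_shift: "t \<ge> 0 \<Longrightarrow> tilt q y z \<le> q (z + t *\<^sub>R y) - t * q y"
    and tilt_greatest: "(\<And>t. t \<ge> 0 \<Longrightarrow> a \<le> q (z + t *\<^sub>R y) - t * q y) \<Longrightarrow> a \<le> tilt q y z"
proof -
  have "- q (- z) \<le> q (z + t *\<^sub>R y) - t * q y" if "t \<ge> 0" for t
    using sublinear_add[OF q, of "z + t *\<^sub>R y" "- z"] sublinear_scale[OF q that, of y] by simp
  then have "bdd_below ((\<lambda>t. q (z + t *\<^sub>R y) - t * q y) ` {0..})" by (auto intro!: bdd_belowI2)
  then show "t \<ge> 0 \<Longrightarrow> tilt q y z \<le> q (z + t *\<^sub>R y) - t * q y"
    unfolding tilt_def by (intro cINF_lower) auto
  show "(\<And>t. t \<ge> 0 \<Longrightarrow> a \<le> q (z + t *\<^sub>R y) - t * q y) \<Longrightarrow> a \<le> tilt q y z"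
    unfolding tilt_def by (intro cINF_greatest) auto
qed

lemma tilt_le: "sublinear q \<Longrightarrow> tilt q y z \<le> q z"
  using tilt_le_shift[of q 0 y z] by simp

lemma tilt_uminus_le: "sublinear q \<Longrightarrow> tilt q y (- y) \<le> - q y"
  using tilt_le_shift[of q 1 y "- y"] by (simp add: sublinear_0)

lemma sublinear_tilt:
  assumes q: "sublinear q"
  shows "sublinear (tilt q y)"
  unfolding sublinear_def
proof (intro conjI allI impI)
  fix u v
  have "tilt q y (u + v) \<le> (q (u + s *\<^sub>R y) - s * q y) + (q (v + t *\<^sub>R y) - t * q y)"
    if "s \<ge> 0" "t \<ge> 0" for s t
    using tilt_le_shift[OF q, of "s + t" y "u + v"] that
      sublinear_add[OF q, of "u + s *\<^sub>R y" "v + t *\<^sub>R y"]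
    by (simp add: algebra_simps)
  then have "tilt q y (u + v) - (q (v + t *\<^sub>R y) - t * q y) \<le> tilt q y u" if "t \<ge> 0" for t
    using that by (intro tilt_greatest[OF q]) (simp add: algebra_simps)
  then have "tilt q y (u + v) - tilt q y u \<le> tilt q y v"
    by (intro tilt_greatest[OF q]) (simp add: algebra_simps)
  then show "tilt q y (u + v) \<le> tilt q y u + tilt q y v" by simp
next
  fix c :: real and u assume c: "c > 0"
  have "tilt q y (c *\<^sub>R u) / c \<le> q (u + t *\<^sub>R y) - t * q y" if "t \<ge> 0" for t
  proof -
    have "tilt q y (c *\<^sub>R u) \<le> q (c *\<^sub>R (u + t *\<^sub>R y)) - c * t * q y"
      using tilt_le_shift[OF q, of "c * t" y "c *\<^sub>R u"] that c by (simp add: scaleR_add_right)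
    also have "\<dots> = c * (q (u + t *\<^sub>R y) - t * q y)"
      using sublinear_scale[OF q, of c "u + t *\<^sub>R y"] c
      by (simp only: right_diff_distrib mult.assoc)
    finally show ?thesis using c by (simp add: field_simps)
  qed
  then have "tilt q y (c *\<^sub>R u) / c \<le> tilt q y u" by (rule tilt_greatest[OF q])
  then show "tilt q y (c *\<^sub>R u) \<le> c * tilt q y u" using c by (simp add: field_simps)
qed

lemma sublinear_INF_chain:
  assumes ne: "C \<noteq> {}" and sub: "\<And>q. q \<in> C \<Longrightarrow> sublinear q"
    and chain: "\<And>q r. q \<in> C \<Longrightarrow> r \<in> C \<Longrightarrow> q \<le> r \<or> r \<le> q"
    and bdd: "\<And>x. bdd_below ((\<lambda>q. q x) ` C)"
  shows "sublinear (\<lambda>x. INF q\<in>C. q x)"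
proof -
  have le: "(INF q\<in>C. q x) \<le> r x" if "r \<in> C" for r x
    using cINF_lower[OF bdd that] .
  have ge: "a \<le> (INF q\<in>C. q x)" if "\<And>r. r \<in> C \<Longrightarrow> a \<le> r x" for a x
    by (rule cINF_greatest[OF ne that])
  show ?thesis unfolding sublinear_def
  proof (intro conjI allI impI)
    fix x y
    have *: "(INF q\<in>C. q (x + y)) \<le> q x + r y" if "q \<in> C" "r \<in> C" for q r
      using chain[OF that]
    proof
      assume "q \<le> r"
      then show ?thesis
        using le[OF that(1), of "x + y"] sublinear_add[OF sub[OF that(1)], of x y] le_funD[of q r y]
        by linarith
    next
      assume "r \<le> q"
      then show ?thesis
        using le[OF that(2), of "x + y"] sublinear_add[OF sub[OF that(2)], of x y] le_funD[of r q x]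
        by linarith
    qed
    have "(INF q\<in>C. q (x + y)) - r y \<le> (INF q\<in>C. q x)" if "r \<in> C" for r
      using *[OF _ that] by (intro ge) (simp add: algebra_simps)
    then have "(INF q\<in>C. q (x + y)) - (INF q\<in>C. q x) \<le> (INF q\<in>C. q y)"
      by (intro ge) (simp add: algebra_simps)
    then show "(INF q\<in>C. q (x + y)) \<le> (INF q\<in>C. q x) + (INF q\<in>C. q y)" by simp
  next
    fix c :: real and x assume c: "c > 0"
    have "(INF q\<in>C. q (c *\<^sub>R x)) / c \<le> (INF q\<in>C. q x)"
    proof (rule ge)
      fix r assume r: "r \<in> C"
      show "(INF q\<in>C. q (c *\<^sub>R x)) / c \<le> r x"
        using le[OF r, of "c *\<^sub>R x"] sublinear_scale[OF sub[OF r], of c x] c by (simp add: field_simps)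
    qed
    then show "(INF q\<in>C. q (c *\<^sub>R x)) \<le> c * (INF q\<in>C. q x)" using c by (simp add: field_simps)
  qed
qed

lemma ex_minimal_sublinear:
  assumes p: "sublinear p"
  obtains q where "sublinear q" "q \<le> p" "\<And>r. sublinear r \<Longrightarrow> r \<le> q \<Longrightarrow> r = q"
proof -
  define A where "A = {q. sublinear q \<and> q \<le> p}"
  have "\<exists>m\<in>A. \<forall>a\<in>A. a \<le> m \<longrightarrow> a = m"
  proof (rule predicate_Zorn[where P = "\<lambda>a b. b \<le> a"])
    show "partial_order_on A (relation_of (\<lambda>a b. b \<le> a) A)"
      by (intro partial_order_on_relation_ofI) auto
    fix C assume C: "C \<in> Chains (relation_of (\<lambda>a b. b \<le> a) A)"
    then have CA: "q \<in> A" if "q \<in> C" for q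
      using that unfolding Chains_def relation_of_def by blast
    have chain: "q \<le> r \<or> r \<le> q" if "q \<in> C" "r \<in> C" for q r
      using C that unfolding Chains_def relation_of_def by blast
    show "\<exists>u\<in>A. \<forall>a\<in>C. u \<le> a"
    proof (cases "C = {}")
      case True
      then show ?thesis using p by (auto simp: A_def)
    next
      case False
      have bdd: "bdd_below ((\<lambda>q. q x) ` C)" for x
      proof (rule bdd_belowI2)
        fix q assume "q \<in> C"
        then have "sublinear q" "q (- x) \<le> p (- x)" using CA by (auto simp: A_def le_fun_def)
        then show "- p (- x) \<le> q x" using sublinear_minus[of q x] by linarith
      qed
      define u where "u x = (INF q\<in>C. q x)" for x
      have u: "u \<le> q" if "q \<in> C" for q
        using cINF_lower[OF bdd that] by (simp add: le_fun_def u_def)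
      moreover have "sublinear u" unfolding u_def
        by (rule sublinear_INF_chain[OF False _ chain bdd]) (use CA in \<open>auto simp: A_def\<close>)
      moreover have "u \<le> p"
      proof -
        obtain q where "q \<in> C" using False by blast
        then show ?thesis using u[of q] CA[of q] by (auto simp: A_def)
      qed
      ultimately show ?thesis by (auto simp: A_def)
    qed
  qed
  then obtain q where q: "sublinear q" "q \<le> p" "\<And>a. sublinear a \<Longrightarrow> a \<le> p \<Longrightarrow> a \<le> q \<Longrightarrow> a = q"
    unfolding A_def by blast
  then show thesis using that by (meson order_trans)
qed

text \<open>
  A minimal sublinear functional below \<open>p\<close> is linear, since it equals all of its tilts. Starting
  the descent at the tilt of \<open>p\<close> in direction \<open>y\<close> forces the value at \<open>- y\<close> down to
  \<open>- p y\<close>, hence the value at \<open>y\<close> up to \<open>p y\<close>.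
\<close>

theorem real_hahn_banach_dominated:
  fixes p :: "'a::real_vector \<Rightarrow> real"
  assumes p: "sublinear p"
  obtains f where "linear f" "\<And>x. f x \<le> p x" "f y = p y"
proof -
  obtain q where q: "sublinear q" "q \<le> tilt p y" "\<And>r. sublinear r \<Longrightarrow> r \<le> q \<Longrightarrow> r = q"
    using ex_minimal_sublinear[OF sublinear_tilt[OF p]] by blast
  have "tilt q z = q" for z
    using q(3)[OF sublinear_tilt[OF q(1)]] tilt_le[OF q(1)] by (simp add: le_fun_def)
  then have neg: "q (- z) = - q z" for z
    using tilt_uminus_le[OF q(1), of z] sublinear_minus[OF q(1), of z] by simp
  have add: "q (u + v) = q u + q v" for u v
    using sublinear_add[OF q(1), of u v] sublinear_add[OF q(1), of "u + v" "- v"] by (simp add: neg)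
  have scale: "q (c *\<^sub>R u) = c * q u" for c u
    using sublinear_scale[OF q(1), of c u] sublinear_scale[OF q(1), of "- c" u] neg[of "c *\<^sub>R u"]
    by (cases "c \<ge> 0") auto
  have "linear q" by (intro linearI) (simp_all add: add scale)
  moreover have le: "q x \<le> p x" for x
    using le_funD[OF q(2), of x] tilt_le[OF p, of y x] by linarith
  moreover have "q y = p y"
    using le[of y] le_funD[OF q(2), of "- y"] tilt_uminus_le[OF p, of y] neg[of y] by linarith
  ultimately show thesis by (rule that)
qed

theorem complex_hahn_banach_seminorm:
  fixes p :: "'a::complex_normed_vector \<Rightarrow> real"
  assumes add: "\<And>x y. p (x + y) \<le> p x + p y" and scale: "\<And>c x. p (c *\<^sub>C x) = cmod c * p x"
  obtains f where "\<And>x y. f (x + y) = f x + f y" "\<And>c x. f (c *\<^sub>C x) = c * f x"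
    "\<And>x. cmod (f x) \<le> p x" "cmod (f y) = p y"
proof -
  have "sublinear p"
    unfolding sublinear_def using add scale[of "complex_of_real c" for c] by (simp add: scaleC_of_real)
  then obtain g where g: "linear g" "\<And>x. g x \<le> p x" "g y = p y"
    using real_hahn_banach_dominated[of p y] by blast
  note gl = linear_add[OF g(1)] linear_scale[OF g(1)] linear_neg[OF g(1)]
  \<comment> \<open>The complex linear functional with real part \<open>g\<close>.\<close>
  define f where "f z = Complex (g z) (- g (\<i> *\<^sub>C z))" for z
  have f_add: "f (u + v) = f u + f v" for u v
    by (simp add: f_def scaleC_add_right gl complex_eq_iff)
  have f_scale: "f (c *\<^sub>C z) = c * f z" for c z
  proof -
    have r: "f (complex_of_real a *\<^sub>C z) = complex_of_real a * f z" for a z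
    proof -
      have "\<i> *\<^sub>C a *\<^sub>R z = a *\<^sub>R \<i> *\<^sub>C z"
        by (simp add: scaleC_of_real[symmetric] scaleC_scaleC mult.commute)
      then show ?thesis by (simp add: f_def scaleC_of_real gl complex_eq_iff)
    qed
    have "\<i> *\<^sub>C \<i> *\<^sub>C z = - z"
      using scaleC_of_real[of "-1" z] by (simp add: scaleC_scaleC)
    then have i: "f (\<i> *\<^sub>C z) = \<i> * f z" by (simp add: f_def gl complex_eq_iff)
    have "c *\<^sub>C z = complex_of_real (Re c) *\<^sub>C z + complex_of_real (Im c) *\<^sub>C \<i> *\<^sub>C z"
      by (simp add: scaleC_scaleC scaleC_add_left[symmetric] complex_eq_iff mult.commute)
        (simp add: complex_eq[of c, symmetric] mult.commute)
    then have "f (c *\<^sub>C z) = complex_of_real (Re c) * f z + complex_of_real (Im c) * (\<i> * f z)"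
      by (simp add: f_add r i)
    also have "\<dots> = c * f z" by (simp add: complex_eq_iff)
    finally show ?thesis .
  qed
  have f_le: "cmod (f z) \<le> p z" for z
  proof (cases "f z = 0")
    case True
    have "0 \<le> p z" using add[of z "- z"] scale[of "-1" z] scale[of 0 z] scaleC_of_real[of "-1" z] by simp
    then show ?thesis using True by simp
  next
    case False
    \<comment> \<open>Rotate \<open>z\<close> so that the value of \<open>f\<close> becomes real and equal to that of \<open>g\<close>.\<close>
    define u where "u = cnj (f z) / cmod (f z)"
    have "f (u *\<^sub>C z) = complex_of_real (cmod (f z))"
      using False by (simp add: f_scale u_def complex_norm_square[symmetric] power2_eq_square mult.commute[of "cnj _"])
    then have "cmod (f z) = g (u *\<^sub>C z)" by (simp add: f_def complex_eq_iff)
    also have "\<dots> \<le> cmod u * p z" using g(2) by (metis scale)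
    also have "cmod u = 1" using False by (simp add: u_def norm_divide)
    finally show ?thesis by simp
  qed
  have "p y \<le> cmod (f y)" using complex_Re_le_cmod[of "f y"] g(3) by (simp add: f_def)
  then have "cmod (f y) = p y" using f_le[of y] by simp
  with f_add f_scale f_le that show thesis by blast
qed

text \<open>
  If \<open>T\<close> is not surjective, its adjoint is not bounded below; \<open>f\<close> is a large functional whose
  composition with \<open>T\<close> has norm at most one. It is obtained by dominating \<open>f\<close> by the seminorm
  \<open>p\<close> of the proof, which is at most \<open>M\<close> times the norm everywhere and, on the range,
  at most the norm of any preimage. If \<open>p y\<close> were always at most \<open>K\<close> times the norm of \<open>y\<close>,
  then for large \<open>M\<close> a near minimizer \<open>w\<close> would be a bounded approximate preimage of \<open>y\<close>,
  and \<open>T\<close> would be surjective.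
\<close>

lemma functional_small_on_range_if_not_surj:
  fixes T :: "'a::complex_banach \<Rightarrow> 'b::complex_banach"
  assumes T: "bounded_clinear T" and ns: "\<not> surj T"
  obtains f M y where "\<And>u v. f (u + v) = f u + f v" "\<And>c u. f (c *\<^sub>C u) = (c::complex) * f u"
    "M > 0" "\<And>z. cmod (f z) \<le> M * norm z" "\<And>w. cmod (f (T w)) \<le> norm w"
    "K * norm y < cmod (f y)"
proof -
  note T_lin = bounded_clinear_imp_bounded_linear[OF T]
  interpret T: bounded_linear T by (rule T_lin)
  have Tc: "T (c *\<^sub>C x) = c *\<^sub>C T x" for c x using T by (simp add: bounded_clinear_def)
  have "\<exists>f M y. (\<forall>u v. f (u + v) = f u + f v) \<and> (\<forall>c u. f (c *\<^sub>C u) = (c::complex) * f u) \<and>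
      M > 0 \<and> (\<forall>z. cmod (f z) \<le> M * norm z) \<and> (\<forall>w. cmod (f (T w)) \<le> norm w) \<and>
      K * norm y < cmod (f y)"
  proof (rule ccontr)
    assume contra: "\<not> ?thesis"
    define K' where "K' = \<bar>K\<bar> + 1"
    define M where "M = 2 * K'"
    have K': "K' > 0" "K < K'" by (simp_all add: K'_def)
    then have M: "M > 0" by (simp add: M_def)
    define p where "p z = (INF w. norm w + M * norm (z - T w))" for z
    have bdd: "bdd_below (range (\<lambda>w. norm w + M * norm (z - T w)))" for z
      using M by (intro bdd_belowI2[of _ 0]) simp
    have p_le: "p z \<le> norm w + M * norm (z - T w)" for z w
      unfolding p_def by (rule cINF_lower[OF bdd]) simp
    have p_ge: "a \<le> p z" if "\<And>w. a \<le> norm w + M * norm (z - T w)" for a z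
      unfolding p_def using that by (intro cINF_greatest) auto
    have p_add: "p (u + v) \<le> p u + p v" for u v
    proof -
      have "p (u + v) \<le> (norm a + M * norm (u - T a)) + (norm b + M * norm (v - T b))" for a b
      proof -
        have "norm (u + v - T (a + b)) \<le> norm (u - T a) + norm (v - T b)"
          using norm_triangle_ineq[of "u - T a" "v - T b"] by (simp add: T.add algebra_simps)
        then have "M * norm (u + v - T (a + b)) \<le> M * norm (u - T a) + M * norm (v - T b)"
          using M by (simp add: distrib_left[symmetric])
        then show ?thesis
          using p_le[of "u + v" "a + b"] norm_triangle_ineq[of a b] by linarith
      qed
      then have "p (u + v) - (norm b + M * norm (v - T b)) \<le> p u" for b
        by (intro p_ge) (simp add: algebra_simps)
      then have "p (u + v) - p u \<le> p v" by (intro p_ge) (simp add: algebra_simps)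
      then show ?thesis by simp
    qed
    have p_scale_le: "p (c *\<^sub>C u) \<le> cmod c * p u" if "c \<noteq> 0" for c u
    proof -
      have "p (c *\<^sub>C u) / cmod c \<le> p u"
      proof (rule p_ge)
        fix w
        have "p (c *\<^sub>C u) \<le> norm (c *\<^sub>C w) + M * norm (c *\<^sub>C (u - T w))"
          using p_le[of "c *\<^sub>C u" "c *\<^sub>C w"] by (simp add: Tc scaleC_diff_right)
        also have "\<dots> = cmod c * (norm w + M * norm (u - T w))"
          by (simp add: norm_scaleC algebra_simps)
        finally show "p (c *\<^sub>C u) / cmod c \<le> norm w + M * norm (u - T w)"
          using that by (simp add: field_simps)
      qed
      then show ?thesis using that by (simp add: field_simps)
    qed
    have p_scale: "p (c *\<^sub>C u) = cmod c * p u" for c u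
    proof (cases "c = 0")
      case True
      have "p 0 \<le> 0" using p_le[of 0 0] by simp
      moreover have "0 \<le> p 0" using M by (intro p_ge) simp
      ultimately show ?thesis using True by simp
    next
      case False
      have "p (inverse c *\<^sub>C c *\<^sub>C u) \<le> cmod (inverse c) * p (c *\<^sub>C u)"
        by (rule p_scale_le) (simp add: False)
      then have "cmod c * p u \<le> p (c *\<^sub>C u)"
        using False by (simp add: scaleC_scaleC norm_inverse norm_divide field_simps)
      then show ?thesis using p_scale_le[OF False, of u] by simp
    qed
    have "\<exists>x\<in>UNIV. norm x \<le> K' * norm y \<and> norm (y - T x) \<le> norm y / 2" for y
    proof (cases "y = 0")
      case True
      then show ?thesis by (intro bexI[of _ 0]) (auto simp: T.zero)
    next
      case False
      obtain f where f: "\<And>u v. f (u + v) = f u + f v" "\<And>c u. f (c *\<^sub>C u) = c * f u"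
        "\<And>z. cmod (f z) \<le> p z" "cmod (f y) = p y"
        using complex_hahn_banach_seminorm[of p y, OF p_add p_scale] by blast
      have "cmod (f z) \<le> M * norm z" for z
        using f(3)[of z] p_le[of z 0] by (simp add: T.zero)
      moreover have "cmod (f (T w)) \<le> norm w" for w
        using f(3)[of "T w"] p_le[of "T w" w] by simp
      ultimately have "cmod (f y) \<le> K * norm y" using contra f(1,2) M not_le by metis
      then have "p y < K' * norm y" using f(4) K'(2) False
        by (metis le_less_trans mult_strict_right_mono zero_less_norm_iff)
      then obtain w where w: "norm w + M * norm (y - T w) < K' * norm y"
        unfolding p_def using cINF_less_iff[OF _ bdd] by auto
      have "norm w \<le> K' * norm y"
        using w mult_nonneg_nonneg[of M "norm (y - T w)"] M norm_ge_zero[of "y - T w"] by linarith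
      moreover have "M * norm (y - T w) \<le> K' * norm y" using w norm_ge_zero[of w] by linarith
      then have "norm (y - T w) \<le> norm y / 2" using K' by (simp add: M_def)
      ultimately show ?thesis by blast
    qed
    then have "\<exists>x\<in>UNIV. T x = y \<and> norm x \<le> 2 * K' * norm y" for y
      by (intro exact_preimage_if_approximate_preimage[OF T_lin, where W = UNIV]) auto
    then show False using ns by (metis surjI surj_def)
  qed
  then show thesis using that by metis
qed

section \<open>Nonempty approximate point spectrum modulo a seminorm\<close>

global_interpretation complex_vector: vector_space "scaleC :: complex \<Rightarrow> 'a \<Rightarrow> 'a::complex_normed_vector"
  by standard (simp_all add: scaleC_add_right scaleC_add_left scaleC_scaleC)

lemma bounded_clinear_diff: "bounded_clinear f \<Longrightarrow> f (x - y) = f x - f y"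
  by (simp add: bounded_clinear_def linear_simps)
lemma bounded_clinear_plus: "bounded_clinear f \<Longrightarrow> f (x + y) = f x + f y"
  by (simp add: bounded_clinear_def linear_simps)
lemma bounded_clinear_scale: "bounded_clinear f \<Longrightarrow> f (c *\<^sub>C x) = c *\<^sub>C f x"
  by (simp add: bounded_clinear_def)
lemma bounded_clinear_zero_eq: "bounded_clinear f \<Longrightarrow> f 0 = 0"
  by (simp add: bounded_clinear_def linear_simps)
lemma bounded_clinear_uminus: "bounded_clinear f \<Longrightarrow> f (- x) = - f x"
  by (simp add: bounded_clinear_def linear_simps)

lemmas bounded_clinear_simps = bounded_clinear_diff bounded_clinear_plus bounded_clinear_scale
  bounded_clinear_zero_eq bounded_clinear_uminus

lemma bounded_clinear_funpow:
  fixes f :: "'a::complex_normed_vector \<Rightarrow> 'a"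
  shows "bounded_clinear f \<Longrightarrow> bounded_clinear (f ^^ n)"
proof (induction n)
  case 0
  have "f ^^ 0 = (\<lambda>x. x)" by (simp add: fun_eq_iff)
  then show ?case by (simp only: bounded_clinear_ident)
next
  case (Suc n)
  have "f ^^ Suc n = (\<lambda>x. f ((f ^^ n) x))" by (simp add: fun_eq_iff)
  then show ?case using bounded_clinear_compose[OF Suc.prems Suc.IH[OF Suc.prems]] by simp
qed

lemma primitive_root_of_unity:
  assumes "N > 0"
  obtains w :: complex where "w ^ N = 1" "cmod w = 1" "\<And>j. 0 < j \<Longrightarrow> j < N \<Longrightarrow> w ^ j \<noteq> 1"
proof
  let ?w = "exp (2 * of_real pi * \<i> / of_nat N)"
  have pow: "?w ^ j = exp (2 * of_real pi * \<i> * of_nat j / of_nat N)" for j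
    by (simp add: exp_of_nat_mult[symmetric] mult.commute mult.left_commute)
  show "?w ^ N = 1" using complex_root_unity_eq_1[of N N] assms by (simp add: pow)
  show "cmod ?w = 1" by (simp add: norm_exp_eq_Re)
  show "?w ^ j \<noteq> 1" if "0 < j" "j < N" for j
    using complex_root_unity_eq_1[of N j] that assms by (auto simp: pow dest: dvd_imp_le)
qed

text \<open>
  This is the quotient \<open>(S^N - z^N) / (S - z)\<close>, see \<open>geom_op_telescope\<close>.
\<close>

definition geom_op :: "('a::complex_normed_vector \<Rightarrow> 'a) \<Rightarrow> complex \<Rightarrow> nat \<Rightarrow> 'a \<Rightarrow> 'a" where
  "geom_op S z N x = (\<Sum>i<N. z ^ (N - Suc i) *\<^sub>C (S ^^ i) x)"

lemma geom_op_0: "geom_op S z 0 x = 0"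
  by (simp add: geom_op_def)

lemma geom_op_Suc: "geom_op S z (Suc N) x = z *\<^sub>C geom_op S z N x + (S ^^ N) x"
proof -
  have "(\<Sum>i<N. z ^ (N - i) *\<^sub>C (S ^^ i) x) = (\<Sum>i<N. z *\<^sub>C z ^ (N - Suc i) *\<^sub>C (S ^^ i) x)"
  proof (rule sum.cong)
    fix i assume "i \<in> {..<N}"
    then have "N - i = Suc (N - Suc i)" by auto
    then show "z ^ (N - i) *\<^sub>C (S ^^ i) x = z *\<^sub>C z ^ (N - Suc i) *\<^sub>C (S ^^ i) x"
      by (simp add: scaleC_scaleC)
  qed simp
  then show ?thesis by (simp add: geom_op_def complex_vector.scale_sum_right)
qed

context
  fixes S :: "'a::complex_normed_vector \<Rightarrow> 'a"
  assumes S: "bounded_clinear S"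
begin

lemma bounded_clinear_geom_op: "bounded_clinear (geom_op S z N)"
proof (induction N)
  case 0
  have "geom_op S z 0 = (\<lambda>x. 0)" by (simp add: fun_eq_iff geom_op_0)
  then show ?case by (simp add: bounded_clinear_zero)
next
  case (Suc N)
  have "geom_op S z (Suc N) = (\<lambda>x. z *\<^sub>C geom_op S z N x + (S ^^ N) x)"
    by (simp add: fun_eq_iff geom_op_Suc)
  then show ?case
    by (simp add: bounded_clinear_add bounded_clinear_scaleC bounded_clinear_funpow Suc S)
qed

lemma geom_op_commute:
  assumes T: "bounded_clinear T" and ST: "\<And>x. T (S x) = S (T x)"
  shows "T (geom_op S z N x) = geom_op S z N (T x)"
proof (induction N)
  case (Suc N)
  have "T ((S ^^ N) x) = (S ^^ N) (T x)" by (induction N) (simp_all add: ST)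
  with Suc show ?case by (simp add: geom_op_Suc bounded_clinear_simps[OF T])
qed (simp add: geom_op_0 bounded_clinear_simps[OF T])

lemma geom_op_telescope:
  "S (geom_op S z N x) - z *\<^sub>C geom_op S z N x = (S ^^ N) x - z ^ N *\<^sub>C x"
proof (induction N)
  case (Suc N)
  have "S (geom_op S z (Suc N) x) - z *\<^sub>C geom_op S z (Suc N) x =
      z *\<^sub>C (S (geom_op S z N x) - z *\<^sub>C geom_op S z N x) + S ((S ^^ N) x) - z *\<^sub>C (S ^^ N) x"
    by (simp add: geom_op_Suc bounded_clinear_simps[OF S] scaleC_add_right scaleC_diff_right)
  then show ?case unfolding Suc by (simp add: scaleC_diff_right scaleC_scaleC)
qed (simp add: geom_op_0 bounded_clinear_simps[OF S])

text \<open>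
  Formally, \<open>(1/N) \<Sum>k. z\<^sub>k / (S - z\<^sub>k) = r^N / (S^N - r^N)\<close> for the \<open>N\<close>-th roots
  \<open>z\<^sub>k = r w^k\<close> of \<open>r^N\<close>: a discrete form of the Cauchy integral of the resolvent over the
  circle of radius \<open>r\<close>. Both sides are multiplied by \<open>S^N - r^N\<close> to avoid inverses.
\<close>

lemma sum_geom_op_roots_of_unity:
  assumes N: "N > 0" and w: "w ^ N = 1" "\<And>j. 0 < j \<Longrightarrow> j < N \<Longrightarrow> w ^ j \<noteq> 1"
  shows "(\<Sum>k<N. (r * w ^ k) *\<^sub>C geom_op S (r * w ^ k) N x) = (of_nat N * r ^ N) *\<^sub>C x"
proof -
  have roots: "(\<Sum>k<N. (r * w ^ k) ^ (N - i)) = (if i = 0 then of_nat N * r ^ N else 0)"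
    if "i < N" for i
  proof -
    have eq: "(r * w ^ k) ^ (N - i) = r ^ (N - i) * (w ^ (N - i)) ^ k" for k
      by (simp add: power_mult_distrib power_mult[symmetric] mult.commute)
    show ?thesis
    proof (cases "i = 0")
      case True
      then show ?thesis unfolding eq by (simp add: w)
    next
      case False
      then have "w ^ (N - i) \<noteq> 1" using w(2)[of "N - i"] that by simp
      moreover have "(w ^ (N - i)) ^ N = 1"
        by (metis power_mult power_one mult.commute w(1))
      ultimately show ?thesis
        using False by (simp add: eq sum_distrib_left[symmetric] geometric_sum)
    qed
  qed
  have "(\<Sum>k<N. (r * w ^ k) *\<^sub>C geom_op S (r * w ^ k) N x) =
      (\<Sum>k<N. \<Sum>i<N. (r * w ^ k) ^ (N - i) *\<^sub>C (S ^^ i) x)"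
  proof (rule sum.cong[OF refl])
    fix k
    show "(r * w ^ k) *\<^sub>C geom_op S (r * w ^ k) N x = (\<Sum>i<N. (r * w ^ k) ^ (N - i) *\<^sub>C (S ^^ i) x)"
      unfolding geom_op_def complex_vector.scale_sum_right scaleC_scaleC
      by (rule sum.cong[OF refl]) (simp add: power_Suc[symmetric] Suc_diff_Suc del: power_Suc)
  qed
  also have "\<dots> = (\<Sum>i<N. (\<Sum>k<N. (r * w ^ k) ^ (N - i)) *\<^sub>C (S ^^ i) x)"
    unfolding complex_vector.scale_sum_left by (rule sum.swap)
  also have "\<dots> = (\<Sum>i<N. if i = 0 then (of_nat N * r ^ N) *\<^sub>C x else 0)"
    by (rule sum.cong[OF refl]) (simp add: roots)
  also have "\<dots> = (of_nat N * r ^ N) *\<^sub>C x" using N by simp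
  finally show ?thesis .
qed

text \<open>
  The discrete Cauchy integrals over two circles, compared by means of the resolvent identity.
  Up to the factor \<open>(S^N - r^N) (S^N - r'^N)\<close> the difference of the two averages is
  \<open>(r^N - r'^N) S^N\<close>, while corresponding summands differ by a multiple of \<open>r - r'\<close>. Only
  polynomials in \<open>S\<close> occur, and the identity can be read on a single vector.
\<close>

lemma two_radii_identity:
  assumes N: "N > 0" and w: "w ^ N = 1" "\<And>j. 0 < j \<Longrightarrow> j < N \<Longrightarrow> w ^ j \<noteq> 1"
  shows "(\<Sum>k<N. ((r - r') * w ^ k) *\<^sub>C S (geom_op S (r * w ^ k) N (geom_op S (r' * w ^ k) N x))) =
    (of_nat N * (r ^ N - r' ^ N)) *\<^sub>C (S ^^ N) x"
proof -
  have zN: "(q * w ^ k) ^ N = q ^ N" for q k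
    by (metis (no_types, lifting) mult.commute mult.right_neutral power_mult power_mult_distrib power_one w(1))
  have tel: "S (geom_op S (q * w ^ k) N y) - (q * w ^ k) *\<^sub>C geom_op S (q * w ^ k) N y
      = (S ^^ N) y - q ^ N *\<^sub>C y" for q k y
    using geom_op_telescope[of "q * w ^ k" N y] by (simp add: zN)
  note G = bounded_clinear_simps[OF bounded_clinear_geom_op]
  have GS: "geom_op S z N (S y) = S (geom_op S z N y)" for z y
    by (rule geom_op_commute[OF S refl, symmetric])
  have GSN: "geom_op S z N ((S ^^ n) y) = (S ^^ n) (geom_op S z N y)" for z y n
    by (induction n) (simp_all add: GS)
  have "((r - r') * w ^ k) *\<^sub>C S (geom_op S (r * w ^ k) N (geom_op S (r' * w ^ k) N x)) =
      (r * w ^ k) *\<^sub>C geom_op S (r * w ^ k) N ((S ^^ N) x - r' ^ N *\<^sub>C x) -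
      (r' * w ^ k) *\<^sub>C geom_op S (r' * w ^ k) N ((S ^^ N) x - r ^ N *\<^sub>C x)" for k
  proof -
    define z z' where "z = r * w ^ k" and "z' = r' * w ^ k"
    define v where "v = geom_op S z N (geom_op S z' N x)"
    have "geom_op S z N ((S ^^ N) x - r' ^ N *\<^sub>C x) = S v - z' *\<^sub>C v"
      unfolding v_def z'_def tel[of _ k, symmetric] by (simp add: G GS)
    moreover have "geom_op S z' N ((S ^^ N) x - r ^ N *\<^sub>C x) = S v - z *\<^sub>C v"
      unfolding v_def z_def tel by (simp add: G GSN)
    moreover have "((r - r') * w ^ k) *\<^sub>C S v = z *\<^sub>C (S v - z' *\<^sub>C v) - z' *\<^sub>C (S v - z *\<^sub>C v)"
      by (simp add: z_def z'_def scaleC_diff_right scaleC_scaleC left_diff_distrib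
          complex_vector.scale_left_diff_distrib mult.commute)
    ultimately show ?thesis by (simp add: v_def z_def z'_def)
  qed
  then have "(\<Sum>k<N. ((r - r') * w ^ k) *\<^sub>C S (geom_op S (r * w ^ k) N (geom_op S (r' * w ^ k) N x))) =
      (of_nat N * r ^ N) *\<^sub>C ((S ^^ N) x - r' ^ N *\<^sub>C x) - (of_nat N * r' ^ N) *\<^sub>C ((S ^^ N) x - r ^ N *\<^sub>C x)"
    by (simp add: sum_subtractf sum_geom_op_roots_of_unity[OF N w])
  also have "\<dots> = (of_nat N * (r ^ N - r' ^ N)) *\<^sub>C (S ^^ N) x"
    by (simp add: scaleC_diff_right scaleC_scaleC right_diff_distrib
        complex_vector.scale_left_diff_distrib mult_ac)
  finally show ?thesis .
qed

end

lemma norm_funpow_le: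
  fixes S :: "'a::real_normed_vector \<Rightarrow> 'a"
  assumes "\<And>x. norm (S x) \<le> s * norm x" and "s \<ge> 0"
  shows "norm ((S ^^ n) x) \<le> s ^ n * norm x"
proof (induction n)
  case (Suc n)
  have "norm ((S ^^ Suc n) x) \<le> s * norm ((S ^^ n) x)" using assms(1) by simp
  also have "\<dots> \<le> s * (s ^ n * norm x)" using Suc assms(2) by (rule mult_left_mono)
  finally show ?case by (simp add: mult.assoc)
qed simp

text \<open>
  An operator is studied modulo a seminorm \<open>g\<close> that it preserves up to a constant. Estimates of
  the form \<open>norm (f x) \<le> norm (h x) + L * g x\<close> replace estimates on the zero set of \<open>g\<close>, which
  may be too small: what matters are the vectors on which \<open>g\<close> is almost zero. The constant
  \<open>L\<close> may depend on everything but \<open>x\<close>.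
\<close>

locale operator_with_seminorm =
  fixes S :: "'a::complex_normed_vector \<Rightarrow> 'a" and g :: "'a \<Rightarrow> real" and m :: real
  assumes S: "bounded_clinear S"
    and g_add: "g (x + y) \<le> g x + g y"
    and g_scale: "g (c *\<^sub>C x) = cmod c * g x"
    and g_S: "g (S x) \<le> m * g x"
    and m: "m \<ge> 0"
begin

lemma g_nonneg: "0 \<le> g x"
  using g_add[of x "- x"] g_scale[of "-1" x] g_scale[of 0 x] scaleC_of_real[of "-1" x] by simp

lemma g_funpow: "g ((S ^^ n) x) \<le> m ^ n * g x"
proof (induction n)
  case (Suc n)
  have "g ((S ^^ Suc n) x) \<le> m * g ((S ^^ n) x)" using g_S by simp
  also have "\<dots> \<le> m * (m ^ n * g x)" using Suc m by (rule mult_left_mono)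
  finally show ?case by (simp add: mult.assoc)
qed simp

lemma g_geom_op: "\<exists>L\<ge>0. \<forall>x. g (geom_op S z N x) \<le> L * g x"
proof (induction N)
  case 0
  have "g 0 = 0" using g_scale[of 0 0] by simp
  then show ?case by (intro exI[of _ 0]) (simp add: geom_op_0)
next
  case (Suc N)
  then obtain L where L: "L \<ge> 0" "\<And>x. g (geom_op S z N x) \<le> L * g x" by blast
  show ?case
  proof (intro exI[of _ "cmod z * L + m ^ N"] conjI allI)
    fix x
    have "g (geom_op S z (Suc N) x) \<le> cmod z * g (geom_op S z N x) + g ((S ^^ N) x)"
      unfolding geom_op_Suc using g_add by (metis g_scale)
    also have "\<dots> \<le> cmod z * (L * g x) + m ^ N * g x"
      by (intro add_mono mult_left_mono L(2) g_funpow) simp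
    finally show "g (geom_op S z (Suc N) x) \<le> (cmod z * L + m ^ N) * g x"
      by (simp add: algebra_simps)
  qed (use L(1) m in simp)
qed

text \<open>
  A lower bound at \<open>\<mu>\<close> persists with half the constant near \<open>\<mu>\<close>, and it is automatic for large
  \<open>\<mu>\<close>, so compactness of a disc makes \<open>c\<close> uniform. The factor \<open>L\<close> still depends on \<open>\<mu>\<close>.
\<close>

lemma uniform_lower_bound:
  assumes "\<And>\<mu>. \<exists>c>0. \<exists>L. \<forall>x. c * norm x \<le> norm (S x - \<mu> *\<^sub>C x) + L * g x"
  obtains c where "c > 0" "\<And>\<mu>. \<exists>L. \<forall>x. c * norm x \<le> norm (S x - \<mu> *\<^sub>C x) + L * g x"
proof -
  obtain s where s: "s > 0" "\<And>x. norm (S x) \<le> norm x * s"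
    using bounded_linear.pos_bounded[OF bounded_clinear_imp_bounded_linear[OF S]] by blast
  obtain c where c: "\<And>\<mu>. c \<mu> > 0" "\<And>\<mu>. \<exists>L. \<forall>x. c \<mu> * norm x \<le> norm (S x - \<mu> *\<^sub>C x) + L * g x"
    using assms by metis
  have "compact (cball (0::complex) (s + 1))" by simp
  moreover have "cball 0 (s + 1) \<subseteq> (\<Union>\<mu>\<in>UNIV. ball \<mu> (c \<mu> / 2))"
  proof
    fix \<mu> :: complex
    show "\<mu> \<in> (\<Union>\<mu>\<in>UNIV. ball \<mu> (c \<mu> / 2))" using c(1) by (intro UN_I[of \<mu>]) simp_all
  qed
  ultimately obtain D where D: "finite D" "cball 0 (s + 1) \<subseteq> (\<Union>\<mu>\<in>D. ball \<mu> (c \<mu> / 2))"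
    using compactE_image[of "cball 0 (s + 1)" UNIV "\<lambda>\<mu>. ball \<mu> (c \<mu> / 2)"] by (metis open_ball)
  define c0 where "c0 = Min (insert 1 ((\<lambda>\<mu>. c \<mu> / 2) ` D))"
  show thesis
  proof (rule that)
    show "c0 > 0" unfolding c0_def using D(1) c(1) by (subst Min_gr_iff) auto
    fix \<mu> :: complex
    show "\<exists>L. \<forall>x. c0 * norm x \<le> norm (S x - \<mu> *\<^sub>C x) + L * g x"
    proof (cases "cmod \<mu> \<le> s + 1")
      case True
      then obtain \<nu> where \<nu>: "\<nu> \<in> D" "dist \<nu> \<mu> < c \<nu> / 2" using D(2) by fastforce
      obtain L where L: "\<And>x. c \<nu> * norm x \<le> norm (S x - \<nu> *\<^sub>C x) + L * g x" using c(2) by blast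
      have "c0 \<le> c \<nu> / 2" unfolding c0_def using D(1) \<nu>(1) by (intro Min_le) auto
      have "c0 * norm x \<le> norm (S x - \<mu> *\<^sub>C x) + L * g x" for x
      proof -
        have "S x - \<nu> *\<^sub>C x = (S x - \<mu> *\<^sub>C x) + (\<mu> - \<nu>) *\<^sub>C x"
          by (simp add: complex_vector.scale_left_diff_distrib)
        then have "norm (S x - \<nu> *\<^sub>C x) \<le> norm (S x - \<mu> *\<^sub>C x) + cmod (\<mu> - \<nu>) * norm x"
          by (metis norm_triangle_ineq norm_scaleC)
        moreover have "cmod (\<mu> - \<nu>) * norm x \<le> c \<nu> / 2 * norm x"
          using \<nu>(2) by (intro mult_right_mono) (auto simp: dist_norm norm_minus_commute)
        moreover have "c0 * norm x \<le> c \<nu> / 2 * norm x"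
          using \<open>c0 \<le> c \<nu> / 2\<close> by (intro mult_right_mono) auto
        ultimately show ?thesis using L[of x] by (simp add: field_simps)
      qed
      then show ?thesis by blast
    next
      case False
      have "c0 \<le> 1" unfolding c0_def using D(1) by (intro Min_le) auto
      have "c0 * norm x \<le> norm (S x - \<mu> *\<^sub>C x) + 0 * g x" for x
      proof -
        have "norm (\<mu> *\<^sub>C x) - norm (S x) \<le> norm (S x - \<mu> *\<^sub>C x)"
          by (metis norm_minus_commute norm_triangle_ineq2)
        moreover have "(s + 1) * norm x \<le> norm (\<mu> *\<^sub>C x)"
          using False by (simp add: norm_scaleC mult_right_mono)
        moreover have "c0 * norm x \<le> 1 * norm x"
          using \<open>c0 \<le> 1\<close> by (intro mult_right_mono) auto
        ultimately show ?thesis using s(2)[of x] by (simp add: algebra_simps)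
      qed
      then show ?thesis by blast
    qed
  qed
qed

text \<open>
  In the identity for two radii, two applications of the lower bound estimate each summand by the
  common vector \<open>Z x = (S^N - r^N) (S^N - r'^N) x\<close>. The factor \<open>r - r'\<close> is independent of \<open>N\<close>;
  this is the uniform continuity of the resolvent.
\<close>

lemma two_radii_estimate:
  assumes c: "c > 0" "\<And>\<mu>. \<exists>L. \<forall>x. c * norm x \<le> norm (S x - \<mu> *\<^sub>C x) + L * g x"
    and s: "s \<ge> 0" "\<And>x. norm (S x) \<le> s * norm x"
    and r: "0 < r'" "r' < r" and N: "N > 0"
  shows "\<exists>L. \<forall>x. (r ^ N - r' ^ N) * norm ((S ^^ N) x) \<le>
    (r - r') * (s / c\<^sup>2) * (norm ((S ^^ (2 * N)) x) + (r ^ N + r' ^ N) * norm ((S ^^ N) x) + r ^ N * r' ^ N * norm x)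
      + L * g x"
proof -
  obtain w where w: "w ^ N = 1" "cmod w = 1" "\<And>j. 0 < j \<Longrightarrow> j < N \<Longrightarrow> w ^ j \<noteq> 1"
    using primitive_root_of_unity[OF N] by metis
  define z z' where "z k = of_real r * w ^ k" and "z' k = of_real r' * w ^ k" for k
  have zN: "(q * w ^ k) ^ N = q ^ N" for q k
    by (metis (no_types, lifting) mult.commute mult.right_neutral power_mult power_mult_distrib power_one w(1))
  define v where "v k x = geom_op S (z k) N (geom_op S (z' k) N x)" for k x
  define Z where "Z x = (S ^^ (2 * N)) x - of_real (r ^ N + r' ^ N) *\<^sub>C (S ^^ N) x + of_real (r ^ N * r' ^ N) *\<^sub>C x" for x
  note SN = bounded_clinear_simps[OF bounded_clinear_funpow[OF S]]
  note G = bounded_clinear_simps[OF bounded_clinear_geom_op[OF S]]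
  have GS: "geom_op S \<zeta> N (S y) = S (geom_op S \<zeta> N y)" for \<zeta> y
    by (rule geom_op_commute[OF S S refl, symmetric])
  have vv: "S (v k x) - z' k *\<^sub>C v k x = geom_op S (z k) N ((S ^^ N) x - of_real (r' ^ N) *\<^sub>C x)" for k x
    using geom_op_telescope[OF S, of "z' k" N x, symmetric] zN[of "of_real r'" k]
    by (simp add: v_def z'_def G GS)
  have two: "(S ^^ N) ((S ^^ N) x) = (S ^^ (2 * N)) x" for x
    by (simp add: mult_2 funpow_add)
  have Zv: "S u - z k *\<^sub>C u = Z x" if "u = S (v k x) - z' k *\<^sub>C v k x" for k x u
    using geom_op_telescope[OF S, of "z k" N "(S ^^ N) x - of_real (r' ^ N) *\<^sub>C x"] zN[of "of_real r" k]
    unfolding that vv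
    by (simp add: z_def Z_def SN two scaleC_diff_right scaleC_scaleC scaleC_add_left)
  have "\<exists>L. \<forall>x. c\<^sup>2 * norm (v k x) \<le> norm (Z x) + L * g x" for k
  proof -
    obtain L1 where L1: "\<And>x. c * norm x \<le> norm (S x - z' k *\<^sub>C x) + L1 * g x" using c(2) by blast
    obtain L2 where L2: "\<And>x. c * norm x \<le> norm (S x - z k *\<^sub>C x) + L2 * g x" using c(2) by blast
    obtain L3 where L3: "L3 \<ge> 0" "\<And>x. g (geom_op S (z k) N x) \<le> L3 * g x" using g_geom_op by blast
    obtain L4 where L4: "L4 \<ge> 0" "\<And>x. g (geom_op S (z' k) N x) \<le> L4 * g x" using g_geom_op by blast
    have gv: "g (v k x) \<le> L3 * L4 * g x" for x
      unfolding v_def mult.assoc by (rule order_trans[OF L3(2) mult_left_mono[OF L4(2) L3(1)]])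
    show ?thesis
    proof (intro exI allI)
      fix x
      define u where "u = S (v k x) - z' k *\<^sub>C v k x"
      define J where "J = L3 * L4 * g x"
      have "g u \<le> g (S (v k x)) + cmod (z' k) * g (v k x)"
        using g_add[of "S (v k x)" "(- z' k) *\<^sub>C v k x"] g_scale[of "- z' k" "v k x"]
        by (simp add: u_def)
      also have "\<dots> \<le> (m + cmod (z' k)) * g (v k x)"
        using g_S[of "v k x"] by (simp add: algebra_simps)
      also have "\<dots> \<le> (m + cmod (z' k)) * J"
        unfolding J_def using m by (intro mult_left_mono gv) simp
      finally have gu: "g u \<le> (m + cmod (z' k)) * J" .
      have "c * (c * norm (v k x)) \<le> c * (norm u + L1 * g (v k x))"
        unfolding u_def using c(1) by (intro mult_left_mono L1) simp
      also have "\<dots> \<le> norm (Z x) + L2 * g u + c * (L1 * g (v k x))"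
        using L2[of u] unfolding Zv[OF u_def] by (simp add: distrib_left)
      also have "\<dots> \<le> norm (Z x) + \<bar>L2\<bar> * ((m + cmod (z' k)) * J) + c * (\<bar>L1\<bar> * J)"
      proof (intro add_mono order_refl mult_left_mono)
        show "L2 * g u \<le> \<bar>L2\<bar> * ((m + cmod (z' k)) * J)"
          using gu g_nonneg by (intro mult_mono) auto
        show "L1 * g (v k x) \<le> \<bar>L1\<bar> * J"
          using gv[of x] g_nonneg by (intro mult_mono) (auto simp: J_def)
      qed (use c(1) in simp)
      also have "\<dots> = norm (Z x) + ((\<bar>L2\<bar> * (m + cmod (z' k)) + c * \<bar>L1\<bar>) * (L3 * L4)) * g x"
        by (simp add: J_def algebra_simps)
      finally show "c\<^sup>2 * norm (v k x) \<le> norm (Z x) +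
          ((\<bar>L2\<bar> * (m + cmod (z' k)) + c * \<bar>L1\<bar>) * (L3 * L4)) * g x"
        by (simp add: power2_eq_square mult.assoc)
    qed
  qed
  then obtain L where L: "\<And>k x. c\<^sup>2 * norm (v k x) \<le> norm (Z x) + L k * g x" by metis
  have Z_le: "norm (Z x) \<le> norm ((S ^^ (2 * N)) x) + (r ^ N + r' ^ N) * norm ((S ^^ N) x) + r ^ N * r' ^ N * norm x" for x
  proof -
    have "norm (Z x) \<le> norm ((S ^^ (2 * N)) x) + norm (complex_of_real (r ^ N + r' ^ N) *\<^sub>C (S ^^ N) x)
       + norm (complex_of_real (r ^ N * r' ^ N) *\<^sub>C x)"
      unfolding Z_def by (intro order_trans[OF norm_triangle_ineq] add_right_mono norm_triangle_ineq4)
    moreover have "cmod (complex_of_real (r ^ N + r' ^ N)) = r ^ N + r' ^ N"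
      "cmod (complex_of_real (r ^ N * r' ^ N)) = r ^ N * r' ^ N"
      using r by (simp_all only: norm_of_real) simp_all
    ultimately show ?thesis by (simp only: norm_scaleC)
  qed
  have main: "(r ^ N - r' ^ N) * norm ((S ^^ N) x) \<le>
      (r - r') * (s / c\<^sup>2) * norm (Z x) + ((r - r') * (s / c\<^sup>2) * (\<Sum>k<N. L k) / N) * g x" for x
  proof -
    have "N * (r ^ N - r' ^ N) * norm ((S ^^ N) x) = norm ((of_nat N * (of_real r ^ N - of_real r' ^ N)) *\<^sub>C (S ^^ N) x)"
    proof -
      have "of_nat N * (of_real r ^ N - of_real r' ^ N) = complex_of_real (N * (r ^ N - r' ^ N))" by simp
      moreover have "r' ^ N \<le> r ^ N" using r by (intro power_mono) auto
      ultimately show ?thesis unfolding norm_scaleC by (simp only: norm_of_real) simp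
    qed
    also have "\<dots> = norm (\<Sum>k<N. ((of_real r - of_real r') * w ^ k) *\<^sub>C S (v k x))"
      unfolding v_def z_def z'_def
      by (rule arg_cong[where f = norm], rule two_radii_identity[OF S N w(1) w(3), symmetric])
    also have "\<dots> \<le> (\<Sum>k<N. (r - r') * (s / c\<^sup>2) * (norm (Z x) + L k * g x))"
    proof (rule sum_norm_le)
      fix k
      have "cmod ((of_real r - of_real r') * w ^ k) = r - r'"
        unfolding norm_mult norm_power w(2) of_real_diff[symmetric] norm_of_real using r by simp
      then have "norm (((of_real r - of_real r') * w ^ k) *\<^sub>C S (v k x)) = (r - r') * norm (S (v k x))"
        by (simp add: norm_scaleC)
      also have "\<dots> \<le> (r - r') * (s * ((norm (Z x) + L k * g x) / c\<^sup>2))"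
      proof (intro mult_left_mono order_trans[OF s(2)])
        show "norm (v k x) \<le> (norm (Z x) + L k * g x) / c\<^sup>2"
          using L[of k x] c(1) by (simp add: field_simps)
      qed (use r s in auto)
      finally show "norm (((of_real r - of_real r') * w ^ k) *\<^sub>C S (v k x)) \<le> (r - r') * (s / c\<^sup>2) * (norm (Z x) + L k * g x)"
        by simp
    qed
    also have "\<dots> = N * ((r - r') * (s / c\<^sup>2) * norm (Z x)) + (r - r') * (s / c\<^sup>2) * (\<Sum>k<N. L k) * g x"
      unfolding sum_distrib_left[symmetric] sum.distrib sum_distrib_right[symmetric]
      by (simp add: distrib_left mult_ac)
    finally have "N * ((r ^ N - r' ^ N) * norm ((S ^^ N) x)) \<le>
       N * ((r - r') * (s / c\<^sup>2) * norm (Z x) + ((r - r') * (s / c\<^sup>2) * (\<Sum>k<N. L k) / N) * g x)"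
      using N by (simp add: distrib_left mult.assoc)
    then show ?thesis using N by (simp only: mult_le_cancel_left_pos of_nat_0_less_iff)
  qed
  have "(r - r') * (s / c\<^sup>2) \<ge> 0" using r s(1) by simp
  then show ?thesis
    using main order_trans[OF main add_right_mono[OF mult_left_mono[OF Z_le]]] by blast
qed

text \<open>
  The spectral radius of \<open>S\<close> modulo \<open>g\<close> is the infimum of all such \<open>t > 0\<close>.
\<close>

definition growth :: "real \<Rightarrow> bool" where
  "growth t \<longleftrightarrow> (\<exists>M\<ge>0. \<exists>N0. \<forall>N\<ge>N0. \<exists>L. \<forall>x. norm ((S ^^ N) x) \<le> M * t ^ N * norm x + L * g x)"

lemma growth_mono:
  assumes "growth t" "0 \<le> t" "t \<le> t'"
  shows "growth t'"
proof -
  obtain M N0 where M: "M \<ge> 0" "\<And>N. N \<ge> N0 \<Longrightarrow> \<exists>L. \<forall>x. norm ((S ^^ N) x) \<le> M * t ^ N * norm x + L * g x"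
    using assms(1) unfolding growth_def by blast
  have "M * t ^ N * norm x \<le> M * t' ^ N * norm x" for N x
    using assms(2,3) M(1) by (intro mult_right_mono mult_left_mono power_mono) auto
  then have "\<exists>L. \<forall>x. norm ((S ^^ N) x) \<le> M * t' ^ N * norm x + L * g x" if "N \<ge> N0" for N
    using M(2)[OF that] by (meson add_right_mono order_trans)
  with M(1) show ?thesis unfolding growth_def by blast
qed

text \<open>
  If the two circles are close, the term with \<open>S^N x\<close> on the right of the estimate for two radii
  can be absorbed on the left; there remains \<open>S^(2 N) x\<close>, which grows like \<open>q^(2 N)\<close>, and
  \<open>r^N r'^N x\<close>. Division by \<open>r^N\<close> gives the growth rates \<open>q\<^sup>2 / r\<close> and \<open>r'\<close>.
  With \<open>r' < \<rho> < q < r\<close> around the spectral radius \<open>\<rho>\<close>, both can be made smaller than \<open>\<rho>\<close>.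
\<close>

lemma growth_improve:
  assumes c: "c > 0" "\<And>\<mu>. \<exists>L. \<forall>x. c * norm x \<le> norm (S x - \<mu> *\<^sub>C x) + L * g x"
    and s: "s \<ge> 0" "\<And>x. norm (S x) \<le> s * norm x"
    and r: "0 < r'" "r' < r" and close: "(r - r') * (s / c\<^sup>2) \<le> 1 / 4"
    and q: "growth q" "q > 0" and t: "r' \<le> t" "q\<^sup>2 / r \<le> t"
  shows "growth t"
proof -
  obtain M N0 where M: "M \<ge> 0" "\<And>N. N \<ge> N0 \<Longrightarrow> \<exists>L. \<forall>x. norm ((S ^^ N) x) \<le> M * q ^ N * norm x + L * g x"
    using q(1) unfolding growth_def by blast
  have "(\<lambda>n. (r' / r) ^ n) \<longlonglongrightarrow> 0" using r by (intro LIMSEQ_realpow_zero) auto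
  then have "\<forall>\<^sub>F n in sequentially. (r' / r) ^ n < 2 / 5" by (rule order_tendstoD) simp
  then obtain N1 where N1: "\<And>n. n \<ge> N1 \<Longrightarrow> (r' / r) ^ n < 2 / 5" by (auto simp: eventually_sequentially)
  have "\<exists>L. \<forall>x. norm ((S ^^ N) x) \<le> (M + 1) * t ^ N * norm x + L * g x" if N: "N \<ge> N0 + N1 + 1" for N
  proof -
    have "N > 0" using N by simp
    from two_radii_estimate[OF c s r this] obtain L where
      L: "\<And>x. (r ^ N - r' ^ N) * norm ((S ^^ N) x) \<le>
        (r - r') * (s / c\<^sup>2) * (norm ((S ^^ (2 * N)) x) + (r ^ N + r' ^ N) * norm ((S ^^ N) x) + r ^ N * r' ^ N * norm x)
        + L * g x" by blast
    have "2 * N \<ge> N0" using N by simp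
    from M(2)[OF this] obtain L' where
      L': "\<And>x. norm ((S ^^ (2 * N)) x) \<le> M * q ^ (2 * N) * norm x + L' * g x" by blast
    define R R' where "R = r ^ N" and "R' = r' ^ N"
    have R: "R > 0" "R' > 0" using r by (simp_all add: R_def R'_def)
    \<comment> \<open>The constant 2/5 leaves a quarter of \<open>R * a\<close> on the left after the absorption below.\<close>
    have "R' < 2 / 5 * R" using N1[of N] N R by (simp add: power_divide R_def R'_def field_simps)
    have "norm ((S ^^ N) x) \<le> (M + 1) * t ^ N * norm x + ((L' + 4 * L) / R) * g x" for x
    proof -
      define a b n where "a = norm ((S ^^ N) x)" and "b = norm ((S ^^ (2 * N)) x)" and "n = norm x"
      have abn: "a \<ge> 0" "b \<ge> 0" "n \<ge> 0" by (simp_all add: a_def b_def n_def)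
      have "(R - R') * a \<le> (r - r') * (s / c\<^sup>2) * (b + (R + R') * a + R * R' * n) + L * g x"
        using L[of x] by (simp add: a_def b_def n_def R_def R'_def)
      also have "\<dots> \<le> 1 / 4 * (b + (R + R') * a + R * R' * n) + L * g x"
        using close abn R by (intro add_right_mono mult_right_mono) auto
      finally have 1: "(R - R') * a \<le> 1 / 4 * (b + (R + R') * a + R * R' * n) + L * g x" .
      have "(5 / 4 * R') * a \<le> (1 / 2 * R) * a"
        using \<open>R' < 2 / 5 * R\<close> abn by (intro mult_right_mono) auto
      with 1 have "R * a \<le> b + R * R' * n + 4 * L * g x" by (simp add: algebra_simps)
      also have "\<dots> \<le> M * q ^ (2 * N) * n + R * R' * n + (L' + 4 * L) * g x"
        using L'[of x] by (simp add: b_def n_def algebra_simps)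
      finally have "a \<le> (M * q ^ (2 * N) * n + R * R' * n + (L' + 4 * L) * g x) / R"
        using R by (simp add: pos_le_divide_eq mult.commute)
      also have "\<dots> = M * (q\<^sup>2 / r) ^ N * n + R' * n + ((L' + 4 * L) / R) * g x"
      proof -
        have "M * q ^ (2 * N) * n / R = M * (q\<^sup>2 / r) ^ N * n"
          by (simp add: power_divide power_mult R_def)
        then show ?thesis using R by (simp add: add_divide_distrib distrib_right)
      qed
      also have "\<dots> \<le> M * t ^ N * n + t ^ N * n + ((L' + 4 * L) / R) * g x"
        unfolding R'_def using M(1) abn q r t
        by (intro add_right_mono add_mono mult_right_mono mult_left_mono power_mono) auto
      finally show ?thesis by (simp add: a_def n_def algebra_simps)
    qed
    then show ?thesis by blast
  qed
  moreover have "M + 1 \<ge> 0" using M(1) by simp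
  ultimately show ?thesis unfolding growth_def by blast
qed

lemma iterated_lower_bound:
  assumes c: "c > 0" "\<And>\<mu>. \<exists>L. \<forall>x. c * norm x \<le> norm (S x - \<mu> *\<^sub>C x) + L * g x"
  shows "\<exists>L. \<forall>x. c ^ N * norm x \<le> norm ((S ^^ N) x) + L * g x"
proof (induction N)
  case 0
  show ?case by (intro exI[of _ 0]) simp
next
  case (Suc N)
  then obtain L where L: "\<And>x. c ^ N * norm x \<le> norm ((S ^^ N) x) + L * g x" by blast
  obtain L0 where L0: "\<And>x. c * norm x \<le> norm (S x) + L0 * g x" using c(2)[of 0] by auto
  show ?case
  proof (intro exI allI)
    fix x
    have "c ^ Suc N * norm x \<le> c * norm ((S ^^ N) x) + c * (L * g x)"
      using mult_left_mono[OF L[of x], of c] c(1) by (simp add: algebra_simps)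
    also have "\<dots> \<le> norm ((S ^^ Suc N) x) + L0 * g ((S ^^ N) x) + c * (L * g x)"
      using L0[of "(S ^^ N) x"] by simp
    also have "\<dots> \<le> norm ((S ^^ Suc N) x) + \<bar>L0\<bar> * (m ^ N * g x) + c * (L * g x)"
      using g_funpow[of N x] g_nonneg by (intro add_mono order_refl mult_mono) auto
    finally show "c ^ Suc N * norm x \<le> norm ((S ^^ Suc N) x) + (\<bar>L0\<bar> * m ^ N + c * L) * g x"
      by (simp add: algebra_simps)
  qed
qed

text \<open>
  Unless \<open>g\<close> dominates the norm, \<open>S\<close> has an approximate eigenvalue modulo \<open>g\<close>: if there is
  none, then the lower bound holds with a uniform \<open>c\<close>. A positive spectral radius is then
  impossible, because \<open>growth_improve\<close> would give a growth rate below it. But the powers of \<open>S\<close>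
  grow at least like \<open>c^N\<close> modulo \<open>g\<close>, which is only compatible if \<open>g\<close> dominates the norm.
\<close>

theorem dominated_by_seminorm:
  assumes lb: "\<And>\<mu>. \<exists>c>0. \<exists>L. \<forall>x. c * norm x \<le> norm (S x - \<mu> *\<^sub>C x) + L * g x"
  shows "\<exists>L. \<forall>x. norm x \<le> L * g x"
proof -
  obtain c where c: "c > 0" "\<And>\<mu>. \<exists>L. \<forall>x. c * norm x \<le> norm (S x - \<mu> *\<^sub>C x) + L * g x"
    using uniform_lower_bound[OF lb] by metis
  obtain s where s: "s > 0" "\<And>x. norm (S x) \<le> s * norm x"
    using bounded_linear.pos_bounded[OF bounded_clinear_imp_bounded_linear[OF S]]
    by (metis mult.commute)
  define \<rho> where "\<rho> = Inf {t. t > 0 \<and> growth t}"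
  have "norm ((S ^^ N) x) \<le> 1 * s ^ N * norm x + 0 * g x" for N x
    using norm_funpow_le[OF s(2)] s(1) by simp
  then have "growth s" unfolding growth_def using zero_le_one by blast
  then have ne: "{t. t > 0 \<and> growth t} \<noteq> {}" using s(1) by blast
  have bdd: "bdd_below {t. t > 0 \<and> growth t}" by (intro bdd_belowI[of _ 0]) auto
  have above: "growth t" if "\<rho> < t" for t
  proof -
    from that obtain t' where "t' > 0" "growth t'" "t' < t"
      unfolding \<rho>_def cInf_less_iff[OF ne bdd] by blast
    then show ?thesis using growth_mono[of t' t] by simp
  qed
  have "\<rho> < c"
  proof (rule ccontr)
    assume "\<not> \<rho> < c"
    then have \<rho>: "\<rho> > 0" using c(1) by simp
    define K where "K = s / c\<^sup>2"
    have K: "K \<ge> 0" using s(1) by (simp add: K_def)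
    \<comment> \<open>The radii are \<open>\<rho> - d\<close> and \<open>\<rho> + d\<close>, close enough for \<open>growth_improve\<close>;
      \<open>q = \<rho> + d / 3\<close> is so close to \<open>\<rho>\<close> that \<open>q\<^sup>2 < \<rho> (\<rho> + d)\<close>.\<close>
    define d where "d = min (\<rho> / 2) (1 / (8 * (K + 1)))"
    have d: "d > 0" "d < \<rho>" using \<rho> K by (auto simp: d_def)
    have "d * K \<le> 1 / (8 * (K + 1)) * K" using K by (intro mult_right_mono) (auto simp: d_def)
    also have "\<dots> \<le> 1 / 8" using K by (simp add: field_simps)
    finally have dK: "((\<rho> + d) - (\<rho> - d)) * (s / c\<^sup>2) \<le> 1 / 4" by (simp add: K_def[symmetric])
    define q where "q = \<rho> + d / 3"
    have "growth q" using above[of q] d by (simp add: q_def)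
    define t where "t = max (\<rho> - d) (q\<^sup>2 / (\<rho> + d))"
    have "d * d < 3 * \<rho> * d" using d \<rho> by (intro mult_strict_right_mono) auto
    then have "q\<^sup>2 < \<rho> * (\<rho> + d)" by (simp add: q_def power2_eq_square algebra_simps)
    then have "q\<^sup>2 / (\<rho> + d) < \<rho>" using \<rho> d by (simp add: field_simps)
    then have "t < \<rho>" using d by (simp add: t_def)
    have "growth t"
      by (rule growth_improve[OF c less_imp_le[OF s(1)] s(2) _ _ dK \<open>growth q\<close>])
        (use d \<rho> in \<open>auto simp: t_def q_def\<close>)
    moreover have "t > 0" using d by (simp add: t_def)
    ultimately have "\<rho> \<le> t" unfolding \<rho>_def by (intro cInf_lower bdd) simp
    with \<open>t < \<rho>\<close> show False by simp
  qed
  then obtain t where t: "t > 0" "growth t" "t < c"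
    unfolding \<rho>_def cInf_less_iff[OF ne bdd] by blast
  obtain M N0 where M: "M \<ge> 0" "\<And>N. N \<ge> N0 \<Longrightarrow> \<exists>L. \<forall>x. norm ((S ^^ N) x) \<le> M * t ^ N * norm x + L * g x"
    using t(2) unfolding growth_def by blast
  have "(\<lambda>n. M * (t / c) ^ n) \<longlonglongrightarrow> M * 0"
    using t c(1) by (intro tendsto_intros LIMSEQ_realpow_zero) auto
  then have "\<forall>\<^sub>F n in sequentially. M * (t / c) ^ n < 1 / 2" by (rule order_tendstoD) simp
  then obtain N1 where N1: "\<And>n. n \<ge> N1 \<Longrightarrow> M * (t / c) ^ n < 1 / 2" by (auto simp: eventually_sequentially)
  define N where "N = N0 + N1"
  obtain L where L: "\<And>x. norm ((S ^^ N) x) \<le> M * t ^ N * norm x + L * g x"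
    using M(2)[of N] by (auto simp: N_def)
  obtain L' where L': "\<And>x. c ^ N * norm x \<le> norm ((S ^^ N) x) + L' * g x"
    using iterated_lower_bound[OF c] by blast
  have cN: "c ^ N > 0" using c(1) by simp
  have "M * t ^ N < c ^ N / 2"
    using N1[of N] cN by (simp add: N_def[symmetric] power_divide field_simps) (simp add: N_def)
  have "norm x \<le> (2 * (L + L') / c ^ N) * g x" for x
  proof -
    have "M * t ^ N * norm x \<le> c ^ N / 2 * norm x"
      using \<open>M * t ^ N < c ^ N / 2\<close> by (intro mult_right_mono) auto
    then have "c ^ N * norm x \<le> 2 * (L + L') * g x"
      using L[of x] L'[of x] by (simp add: algebra_simps)
    then show ?thesis using cN by (simp add: pos_le_divide_eq mult.commute)
  qed
  then show ?thesis by blast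
qed

end

section \<open>Kato decompositions\<close>

lemma csubspace_0: "csubspace M \<Longrightarrow> 0 \<in> M"
  and csubspace_add: "csubspace M \<Longrightarrow> x \<in> M \<Longrightarrow> y \<in> M \<Longrightarrow> x + y \<in> M"
  and csubspace_scale: "csubspace M \<Longrightarrow> x \<in> M \<Longrightarrow> c *\<^sub>C x \<in> M"
  by (simp_all add: csubspace_def)

lemma csubspace_neg: "csubspace M \<Longrightarrow> x \<in> M \<Longrightarrow> - x \<in> M"
  using csubspace_scale[of M x "-1"] scaleC_of_real[of "-1" x] by simp

lemma csubspace_diff: "csubspace M \<Longrightarrow> x \<in> M \<Longrightarrow> y \<in> M \<Longrightarrow> x - y \<in> M"
  using csubspace_add[of M x "- y"] csubspace_neg[of M y] by simp

lemma csubspace_imp_subspace: "csubspace M \<Longrightarrow> subspace M"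
  unfolding csubspace_def subspace_def by (metis scaleC_of_real)

lemma csubspace_null: "bounded_clinear f \<Longrightarrow> csubspace {x. f x = 0}"
  by (simp add: csubspace_def bounded_clinear_simps)

lemma csubspace_range: "bounded_clinear f \<Longrightarrow> csubspace (range f)"
  unfolding csubspace_def
proof (intro conjI ballI allI)
  assume f: "bounded_clinear f"
  show "0 \<in> range f" by (rule range_eqI[of _ _ 0]) (simp add: bounded_clinear_simps[OF f])
  show "x + y \<in> range f" if "x \<in> range f" "y \<in> range f" for x y
    using that bounded_clinear_plus[OF f, symmetric] by auto
  show "c *\<^sub>C x \<in> range f" if "x \<in> range f" for c x
    using that bounded_clinear_scale[OF f, symmetric] by auto
qed

text \<open>
  The open mapping theorem for the addition map on the product of the two closed subspaces.
\<close>

lemma bounded_decomposition_if_complemented: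
  fixes M :: "'a::complex_banach set"
  assumes "complemented M"
  obtains L K where "csubspace L" "M \<inter> L = {0}" "K > 0"
    "\<And>x. \<exists>m\<in>M. x - m \<in> L \<and> norm m \<le> K * norm x"
proof -
  obtain L where M: "csubspace M" "closed M" and L: "csubspace L" "closed L" "M \<inter> L = {0}"
    and sum: "{x + y |x y. x \<in> M \<and> y \<in> L} = UNIV"
    using assms unfolding complemented_def by blast
  define f where "f p = fst p + snd p" for p :: "'a \<times> 'a"
  have f: "bounded_linear f" unfolding f_def
    by (intro bounded_linear_add bounded_linear_fst bounded_linear_snd)
  have onto: "f ` (M \<times> L) = UNIV"
  proof -
    have "f ` (M \<times> L) = {x + y |x y. x \<in> M \<and> y \<in> L}" by (force simp: f_def)
    then show ?thesis using sum by simp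
  qed
  have "subspace (M \<times> L)"
    using csubspace_imp_subspace[OF M(1)] csubspace_imp_subspace[OF L(1)] by (rule subspace_Times)
  then obtain K where K: "K > 0" "\<And>p. p \<in> M \<times> L \<Longrightarrow> \<exists>u\<in>M \<times> L. f u = f p \<and> norm u \<le> K * norm (f p)"
    using bounded_preimages_if_closed_image[OF f _ closed_Times[OF M(2) L(2)]] onto by (metis closed_UNIV)
  have "\<exists>m\<in>M. x - m \<in> L \<and> norm m \<le> K * norm x" for x
  proof -
    obtain p where "p \<in> M \<times> L" "f p = x" using onto by (metis UNIV_I imageE)
    then obtain u where u: "u \<in> M \<times> L" "f u = x" "norm u \<le> K * norm x" using K(2) by metis
    have "norm (fst u) \<le> norm u" by (metis norm_fst_le prod.collapse)
    then show ?thesis using u by (intro bexI[of _ "fst u"]) (auto simp: f_def mem_Times_iff)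
  qed
  with that L(1,3) K(1) show thesis by blast
qed

lemma projection_of_bounded_decomposition:
  fixes N M :: "'a::complex_normed_vector set"
  assumes N: "csubspace N" and M: "csubspace M" and NM: "N \<inter> M = {0}"
    and dec: "\<And>x. \<exists>n\<in>N. x - n \<in> M \<and> norm n \<le> C * norm x"
  obtains P where "bounded_clinear P" "\<And>x. P x \<in> N" "\<And>x. x - P x \<in> M" "\<And>x. x \<in> N \<Longrightarrow> P x = x"
    "\<And>S x. bounded_clinear S \<Longrightarrow> S ` N \<subseteq> N \<Longrightarrow> S ` M \<subseteq> M \<Longrightarrow> P (S x) = S (P x)"
proof -
  obtain P where P: "\<And>x. P x \<in> N" "\<And>x. x - P x \<in> M" "\<And>x. norm (P x) \<le> C * norm x"
    using dec by metis
  have uniq: "P x = n" if "n \<in> N" "x - n \<in> M" for x n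
  proof -
    have "P x - n \<in> N" using csubspace_diff[OF N P(1) that(1)] .
    moreover have "(x - n) - (x - P x) \<in> M" using csubspace_diff[OF M that(2) P(2)] .
    then have "P x - n \<in> M" by simp
    ultimately have "P x - n \<in> {0}" unfolding NM[symmetric] by (rule IntI)
    then show ?thesis by simp
  qed
  have add: "P (x + y) = P x + P y" for x y
    by (rule uniq[OF csubspace_add[OF N P(1) P(1)]])
      (use csubspace_add[OF M P(2) P(2), of x y] in \<open>simp add: algebra_simps\<close>)
  have scale: "P (c *\<^sub>C x) = c *\<^sub>C P x" for c x
    by (rule uniq[OF csubspace_scale[OF N P(1)]])
      (use csubspace_scale[OF M P(2), of c x] in \<open>simp add: scaleC_diff_right\<close>)
  have "P (r *\<^sub>R x) = r *\<^sub>R P x" for r x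
    using scale[of "complex_of_real r" x] by (simp add: scaleC_of_real)
  then have "bounded_linear P"
    using add P(3) by (intro bounded_linear_intro[where K = C]) (simp_all add: mult.commute)
  then have "bounded_clinear P" by (simp add: bounded_clinear_def scale)
  moreover have "P x = x" if "x \<in> N" for x
    using uniq[OF that, of x] csubspace_0[OF M] by simp
  moreover have "P (S x) = S (P x)" if "bounded_clinear S" "S ` N \<subseteq> N" "S ` M \<subseteq> M" for S x
  proof (rule uniq)
    show "S (P x) \<in> N" using that(2) P(1) by blast
    have "S (x - P x) \<in> M" using that(3) P(2) by blast
    then show "S x - S (P x) \<in> M" by (simp add: bounded_clinear_diff[OF that(1)])
  qed
  ultimately show thesis using that P(1,2) by blast
qed

lemma funpow_null_stable:
  fixes S :: "'a::zero \<Rightarrow> 'a"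
  assumes "\<And>x. (S ^^ Suc d) x = 0 \<Longrightarrow> (S ^^ d) x = 0"
  shows "(S ^^ (d + k)) x = 0 \<Longrightarrow> (S ^^ d) x = 0"
proof (induction k)
  case (Suc k)
  have "(S ^^ Suc d) ((S ^^ k) x) = (S ^^ (d + Suc k)) x"
    by (simp add: funpow_add[symmetric, unfolded comp_def, THEN fun_cong] del: funpow.simps)
  then have "(S ^^ d) ((S ^^ k) x) = 0" using Suc.prems assms by metis
  then have "(S ^^ (d + k)) x = 0" by (simp add: funpow_add)
  then show ?case by (rule Suc.IH)
qed simp

text \<open>
  The kernel \<open>N\<close> of \<open>S^d\<close> has the invariant complement \<open>L + S L + ... + S^(d-1) L + S^d X\<close>,
  where \<open>L\<close> is a complement of \<open>N + S X\<close>. Decomposing \<open>x = n + l + S u\<close> and then decomposing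
  \<open>u\<close> again shows that the sum is everything. For uniqueness, an element \<open>l + S m\<close> of the
  complement that lies in \<open>N\<close> has \<open>l = 0\<close>, and \<open>m\<close> lies in \<open>N\<close> by the ascent condition.
  By iteration the element lies in the range of \<open>S^d\<close>, which meets \<open>N\<close> trivially. All choices are
  made with norm bounds, and this makes the projection bounded.
\<close>

theorem kato_projection_of_finite_ascent:
  fixes S :: "'a::complex_banach \<Rightarrow> 'a"
  assumes S: "bounded_clinear S"
    and asc: "\<And>x. (S ^^ Suc d) x = 0 \<Longrightarrow> (S ^^ d) x = 0"
    and cl: "closed (range (S ^^ Suc d))"
    and compl: "complemented {x + y | x y. (S ^^ d) x = 0 \<and> y \<in> range S}"
  obtains P C where "bounded_clinear P" "\<And>x. P (S x) = S (P x)" "\<And>x. (S ^^ d) (P x) = 0"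
    "\<And>x. P (P x) = P x" "\<And>x. norm (x - P x) \<le> C * norm (S x)"
proof -
  define N where "N = {x. (S ^^ d) x = 0}"
  define W where "W = {x + y | x y. (S ^^ d) x = 0 \<and> y \<in> range S}"
  have Sd: "bounded_clinear (S ^^ n)" for n by (rule bounded_clinear_funpow[OF S])
  note lin = bounded_clinear_simps[OF S] bounded_clinear_simps[OF Sd]
  have N: "csubspace N" unfolding N_def by (rule csubspace_null[OF Sd])
  obtain L K where L: "csubspace L" "W \<inter> L = {0}" and K: "K > 0"
    and WL: "\<And>x. \<exists>w\<in>W. x - w \<in> L \<and> norm w \<le> K * norm x"
    by (rule bounded_decomposition_if_complemented[OF compl, folded W_def]) (rule that)
  obtain s where s: "s > 0" "\<And>x. norm (S x) \<le> s * norm x"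
    using bounded_linear.pos_bounded[OF bounded_clinear_imp_bounded_linear[OF S]]
    by (metis mult.commute)
  have sn: "norm ((S ^^ n) x) \<le> s ^ n * norm x" for n x
    using norm_funpow_le[OF s(2)] s(1) by simp
  have shift: "(S ^^ n) (S x) = (S ^^ Suc n) x" for n x by (simp add: funpow_swap1)
  obtain C0 where C0: "C0 > 0"
    "\<And>x. \<exists>u. (S ^^ Suc d) u = (S ^^ Suc d) x \<and> norm u \<le> C0 * norm ((S ^^ Suc d) x)"
    using bounded_preimages_if_closed_range[OF bounded_clinear_imp_bounded_linear[OF Sd] cl] by metis
  \<comment> \<open>\<open>M j = L + S L + ... + S^(j-1) L + S^j X\<close>\<close>
  define M where "M j = rec_nat UNIV (\<lambda>_ M. {l + S m | l m. l \<in> L \<and> m \<in> M}) j" for j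
  have M0: "M 0 = UNIV" and MS: "M (Suc j) = {l + S m | l m. l \<in> L \<and> m \<in> M j}" for j
    by (simp_all add: M_def)
  have Mc: "csubspace (M j)" for j
  proof (induction j)
    case (Suc j)
    show ?case unfolding csubspace_def
    proof (intro conjI ballI allI)
      show "0 \<in> M (Suc j)"
        using csubspace_0[OF L(1)] csubspace_0[OF Suc] lin(4) unfolding MS by force
    next
      fix x y assume "x \<in> M (Suc j)" "y \<in> M (Suc j)"
      then obtain l m l' m' where "l \<in> L" "m \<in> M j" "x = l + S m" "l' \<in> L" "m' \<in> M j" "y = l' + S m'"
        unfolding MS by blast
      then show "x + y \<in> M (Suc j)"
        unfolding MS using csubspace_add[OF L(1), of l l'] csubspace_add[OF Suc, of m m']
        by (intro CollectI exI[of _ "l + l'"] exI[of _ "m + m'"]) (simp add: lin)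
    next
      fix c x assume "x \<in> M (Suc j)"
      then obtain l m where "l \<in> L" "m \<in> M j" "x = l + S m" unfolding MS by blast
      then show "c *\<^sub>C x \<in> M (Suc j)"
        unfolding MS using csubspace_scale[OF L(1), of l c] csubspace_scale[OF Suc, of m c]
        by (intro CollectI exI[of _ "c *\<^sub>C l"] exI[of _ "c *\<^sub>C m"]) (simp add: lin scaleC_add_right)
    qed
  qed (simp add: M0 csubspace_def)
  have M_dec: "M (Suc j) \<subseteq> M j" for j
  proof (induction j)
    case (Suc j)
    then show ?case unfolding MS[of "Suc j"] MS[of j] by blast
  qed (simp add: M0)
  have SM: "S ` M d \<subseteq> M d"
  proof
    fix y assume "y \<in> S ` M d"
    then obtain m where "m \<in> M d" "y = 0 + S m" by auto
    then have "y \<in> M (Suc d)" unfolding MS using csubspace_0[OF L(1)] by blast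
    then show "y \<in> M d" using M_dec by blast
  qed
  have pre: "\<exists>u. x = (S ^^ j) u" if "x \<in> M j" "(S ^^ d) x = 0" for j x
    using that
  proof (induction j arbitrary: x)
    case (Suc j)
    then obtain l m where lm: "l \<in> L" "m \<in> M j" "x = l + S m" unfolding MS by blast
    have "l = x + S (- m)" using lm(3) by (simp add: lin)
    then have "l \<in> W" unfolding W_def using Suc.prems(2) by blast
    then have l: "l = 0" using lm(1) L(2) by blast
    then have "(S ^^ Suc d) m = 0" using lm(3) Suc.prems(2) by (simp add: shift)
    then have "(S ^^ d) m = 0" by (rule asc)
    then obtain u where "m = (S ^^ j) u" using Suc.IH lm(2) by blast
    then show ?case using lm(3) l by auto
  qed simp
  have NM: "N \<inter> M d = {0}"
  proof -
    have "x = 0" if x: "x \<in> N" "x \<in> M d" for x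
    proof -
      obtain u where u: "x = (S ^^ d) u" using pre x by (auto simp: N_def)
      then have "(S ^^ (d + d)) u = 0" using x(1) by (simp add: N_def funpow_add)
      then show ?thesis using funpow_null_stable[OF asc] u by blast
    qed
    then show ?thesis using csubspace_0[OF N] csubspace_0[OF Mc] by blast
  qed
  have step: "\<exists>n l u. x = n + l + S u \<and> n \<in> N \<and> l \<in> L \<and> norm u \<le> C0 * (s ^ d * K) * norm x \<and>
      norm n \<le> (K + s * (C0 * (s ^ d * K))) * norm x" for x
  proof -
    obtain w where w: "w \<in> W" "x - w \<in> L" "norm w \<le> K * norm x" using WL by blast
    then obtain n y where ny: "(S ^^ d) n = 0" "w = n + S y" unfolding W_def by blast
    have wy: "(S ^^ d) w = (S ^^ Suc d) y" using ny by (simp add: lin shift)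
    obtain u where u: "(S ^^ Suc d) u = (S ^^ d) w" "norm u \<le> C0 * norm ((S ^^ d) w)"
      using C0(2)[of y] wy by metis
    have "norm u \<le> C0 * (s ^ d * (K * norm x))"
      using u(2) sn[of d w] w(3) C0(1) s(1)
      by (meson less_imp_le mult_left_mono order_trans zero_le_power)
    then have un: "norm u \<le> C0 * (s ^ d * K) * norm x" by (simp add: mult.assoc)
    have "x = (w - S u) + (x - w) + S u" by simp
    moreover have "w - S u \<in> N" using u(1) by (simp add: N_def lin shift)
    moreover have "norm (w - S u) \<le> (K + s * (C0 * (s ^ d * K))) * norm x"
    proof -
      have "norm (w - S u) \<le> norm w + norm (S u)" by (rule norm_triangle_ineq4)
      also have "\<dots> \<le> K * norm x + s * (C0 * (s ^ d * K) * norm x)"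
        using w(3) order_trans[OF s(2) mult_left_mono[OF un, of s]] s(1) by (intro add_mono) auto
      finally show ?thesis by (simp add: algebra_simps)
    qed
    ultimately show ?thesis using un w(2) by blast
  qed
  have "\<exists>C\<ge>0. \<forall>x. \<exists>n\<in>N. x - n \<in> M j \<and> norm n \<le> C * norm x" for j
  proof (induction j)
    case 0
    show ?case by (intro exI[of _ 0]) (use csubspace_0[OF N] in \<open>auto simp: M0 intro!: bexI[of _ 0]\<close>)
  next
    case (Suc j)
    then obtain C where C: "C \<ge> 0" "\<And>x. \<exists>n\<in>N. x - n \<in> M j \<and> norm n \<le> C * norm x" by blast
    define D where "D = C0 * (s ^ d * K)"
    have D: "D \<ge> 0" using C0(1) s(1) K by (simp add: D_def)
    have "\<exists>n\<in>N. x - n \<in> M (Suc j) \<and> norm n \<le> ((K + s * D) + s * (C * D)) * norm x" for x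
    proof -
      obtain n l u where nlu: "x = n + l + S u" "n \<in> N" "l \<in> L" "norm u \<le> D * norm x"
        "norm n \<le> (K + s * D) * norm x" using step[of x] unfolding D_def by blast
      obtain n' where n': "n' \<in> N" "u - n' \<in> M j" "norm n' \<le> C * norm u" using C(2) by blast
      have "x - (n + S n') = l + S (u - n')" by (simp add: nlu(1) lin)
      then have "x - (n + S n') \<in> M (Suc j)" unfolding MS using nlu(3) n'(2) by blast
      moreover have "S n' \<in> N" using n'(1) by (simp add: N_def shift lin)
      then have "n + S n' \<in> N" by (rule csubspace_add[OF N nlu(2)])
      moreover have "norm (n + S n') \<le> ((K + s * D) + s * (C * D)) * norm x"
      proof -
        have "norm n' \<le> C * (D * norm x)"
          using order_trans[OF n'(3) mult_left_mono[OF nlu(4) C(1)]] .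
        then have "norm (S n') \<le> s * (C * (D * norm x))"
          using order_trans[OF s(2) mult_left_mono[of "norm n'" _ s]] s(1) by simp
        then have "norm (n + S n') \<le> (K + s * D) * norm x + s * (C * (D * norm x))"
          by (intro order_trans[OF norm_triangle_ineq] add_mono nlu(5))
        then show ?thesis by (simp add: algebra_simps)
      qed
      ultimately show ?thesis by blast
    qed
    moreover have "(K + s * D) + s * (C * D) \<ge> 0" using K s(1) D C(1) by simp
    ultimately show ?case by blast
  qed
  then obtain C where C: "\<And>x. \<exists>n\<in>N. x - n \<in> M d \<and> norm n \<le> C * norm x" by metis
  obtain P where P: "bounded_clinear P" "\<And>x. P x \<in> N" "\<And>x. x - P x \<in> M d" "\<And>x. x \<in> N \<Longrightarrow> P x = x"
    "\<And>S x. bounded_clinear S \<Longrightarrow> S ` N \<subseteq> N \<Longrightarrow> S ` M d \<subseteq> M d \<Longrightarrow> P (S x) = S (P x)"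
    by (rule projection_of_bounded_decomposition[OF N Mc NM C]) (rule that)
  obtain p where p: "p > 0" "\<And>x. norm (P x) \<le> p * norm x"
    using bounded_linear.pos_bounded[OF bounded_clinear_imp_bounded_linear[OF P(1)]]
    by (metis mult.commute)
  have SN: "S ` N \<subseteq> N" by (auto simp: N_def shift lin)
  \<comment> \<open>Modulo the kernel of \<open>S^d\<close>, which \<open>P\<close> fixes, \<open>x\<close> is a vector \<open>u\<close> controlled by \<open>S x\<close>.\<close>
  have lower: "norm (x - P x) \<le> (1 + p) * (C0 * s ^ d) * norm (S x)" for x
  proof -
    obtain u where u: "(S ^^ Suc d) u = (S ^^ Suc d) x" "norm u \<le> C0 * norm ((S ^^ Suc d) x)"
      using C0(2) by blast
    have "norm ((S ^^ Suc d) x) \<le> s ^ d * norm (S x)" using sn[of d "S x"] by (simp add: shift)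
    then have un: "norm u \<le> C0 * s ^ d * norm (S x)"
      using order_trans[OF u(2) mult_left_mono[of _ _ C0]] C0(1) by (simp add: mult.assoc)
    have "(S ^^ Suc d) (x - u) = 0" using u(1) by (simp only: lin) simp
    then have "x - u \<in> N" unfolding N_def using asc by blast
    then have "x - P x = u - P u" using P(4)[of "x - u"] bounded_clinear_diff[OF P(1)] by (simp add: algebra_simps)
    then have "norm (x - P x) \<le> norm u + norm (P u)" by (simp add: norm_triangle_ineq4)
    also have "\<dots> \<le> (1 + p) * norm u" using p(2)[of u] by (simp add: algebra_simps)
    also have "\<dots> \<le> (1 + p) * (C0 * s ^ d * norm (S x))" using un p(1) by (intro mult_left_mono) auto
    finally show ?thesis by (simp add: mult.assoc)
  qed
  show thesis
  proof (rule that[OF P(1) _ _ _ lower])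
    show "P (S x) = S (P x)" for x using P(5)[OF S SN SM] .
    show "(S ^^ d) (P x) = 0" for x using P(2) by (simp add: N_def)
    show "P (P x) = P x" for x by (rule P(4)[OF P(2)])
  qed
qed

text \<open>
  Dually, the closed range \<open>R\<close> of \<open>S^d\<close>, on which \<open>S\<close> is surjective, has the invariant complement
  of all \<open>y\<close> with \<open>S^d y = 0\<close> and \<open>S^i y \<in> L\<close> for \<open>i < d\<close>, where \<open>L\<close> is a complement of
  \<open>K0 = N(S) \<inter> R\<close>. To move \<open>x\<close> into it by an element of \<open>R\<close>, first correct \<open>S x\<close>, lift the
  correction to \<open>R\<close>, and then remove the component of the result in \<open>K0\<close>.
\<close>

theorem kato_projection_of_finite_descent:
  fixes S :: "'a::complex_banach \<Rightarrow> 'a"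
  assumes S: "bounded_clinear S"
    and dsc: "range (S ^^ d) = range (S ^^ Suc d)"
    and cl: "closed (range (S ^^ d))"
    and compl: "complemented ({x. S x = 0} \<inter> range (S ^^ d))"
  obtains Q C where "bounded_clinear Q" "\<And>x. Q (S x) = S (Q x)" "\<And>x. (S ^^ d) (Q x) = 0"
    "\<And>x. Q (Q x) = Q x" "\<And>x. \<exists>u. S u = x - Q x \<and> norm u \<le> C * norm x"
proof -
  define R where "R = range (S ^^ d)"
  define K0 where "K0 = {x. S x = 0} \<inter> R"
  have Sd: "bounded_clinear (S ^^ n)" for n by (rule bounded_clinear_funpow[OF S])
  note lin = bounded_clinear_simps[OF S] bounded_clinear_simps[OF Sd]
  have R: "csubspace R" unfolding R_def by (rule csubspace_range[OF Sd])
  have SR: "S ` R = R"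
  proof -
    have "S ` R = range (S ^^ Suc d)" by (simp add: R_def image_comp comp_def)
    then show ?thesis using dsc by (simp add: R_def)
  qed
  obtain s where s: "s > 0" "\<And>x. norm (S x) \<le> s * norm x"
    using bounded_linear.pos_bounded[OF bounded_clinear_imp_bounded_linear[OF S]]
    by (metis mult.commute)
  obtain C1 where C1: "C1 > 0" "\<And>x. x \<in> R \<Longrightarrow> \<exists>u\<in>R. S u = S x \<and> norm u \<le> C1 * norm (S x)"
    using bounded_preimages_if_closed_image[OF bounded_clinear_imp_bounded_linear[OF S]
        csubspace_imp_subspace[OF R], unfolded SR] cl unfolding R_def[symmetric] by metis
  have preR: "\<exists>u\<in>R. S u = r \<and> norm u \<le> C1 * norm r" if "r \<in> R" for r
    using that SR C1(2) by (metis imageE)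
  obtain L K where L: "csubspace L" "K0 \<inter> L = {0}" and K: "K > 0"
    and KL: "\<And>x. \<exists>k\<in>K0. x - k \<in> L \<and> norm k \<le> K * norm x"
    using bounded_decomposition_if_complemented[OF compl] unfolding K0_def R_def by blast
  \<comment> \<open>\<open>H j\<close> consists of all \<open>y\<close> with \<open>S^j y = 0\<close> and \<open>S^i y \<in> L\<close> for \<open>i < j\<close>.\<close>
  define H where "H j = rec_nat {0} (\<lambda>_ H. {y \<in> L. S y \<in> H}) j" for j
  have H0: "H 0 = {0}" and HS: "H (Suc j) = {y \<in> L. S y \<in> H j}" for j
    by (simp_all add: H_def)
  have Hc: "csubspace (H j)" for j
  proof (induction j)
    case (Suc j)
    then show ?case using L(1) unfolding HS csubspace_def by (simp add: lin)
  qed (simp add: H0 csubspace_def)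
  have H_inc: "H j \<subseteq> H (Suc j)" for j
  proof (induction j)
    case 0
    then show ?case using csubspace_0[OF L(1)] by (simp add: HS H0 lin)
  next
    case (Suc j)
    then show ?case unfolding HS[of "Suc j"] HS[of j] by blast
  qed
  have SH: "S ` H d \<subseteq> H d" using H_inc[of d] by (auto simp: HS)
  have HR: "y = 0" if "y \<in> H j" "y \<in> R" for j y
    using that
  proof (induction j arbitrary: y)
    case (Suc j)
    have "S y \<in> R" using Suc.prems(2) SR by blast
    then have "S y = 0" using Suc.IH Suc.prems(1) by (simp add: HS)
    then have "y \<in> K0 \<inter> L" using Suc.prems by (simp add: K0_def HS)
    then show ?case using L(2) by blast
  qed (simp add: H0)
  have HR0: "H d \<inter> R = {0}" using HR csubspace_0[OF R] csubspace_0[OF Hc] by blast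
  have SjH: "(S ^^ j) y = 0" if "y \<in> H j" for j y
    using that
  proof (induction j arbitrary: y)
    case (Suc j)
    then have "(S ^^ j) (S y) = 0" by (simp add: HS)
    then show ?case by (simp add: funpow_swap1)
  qed (simp add: H0)
  have "\<exists>C\<ge>0. \<forall>x. (S ^^ j) x \<in> R \<longrightarrow> (\<exists>r\<in>R. x - r \<in> H j \<and> norm r \<le> C * norm x)" for j
  proof (induction j)
    case 0
    show ?case by (intro exI[of _ 1]) (auto simp: H0)
  next
    case (Suc j)
    then obtain C where C: "C \<ge> 0"
      "\<And>x. (S ^^ j) x \<in> R \<Longrightarrow> \<exists>r\<in>R. x - r \<in> H j \<and> norm r \<le> C * norm x" by blast
    define D where "D = C1 * (C * s)"
    have D: "D \<ge> 0" using C1(1) C(1) s(1) by (simp add: D_def)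
    have "\<exists>r\<in>R. x - r \<in> H (Suc j) \<and> norm r \<le> (D + K * (1 + D)) * norm x" if x: "(S ^^ Suc j) x \<in> R" for x
    proof -
      have "(S ^^ j) (S x) \<in> R" using x by (simp add: funpow_swap1)
      then obtain r1 where r1: "r1 \<in> R" "S x - r1 \<in> H j" "norm r1 \<le> C * norm (S x)" using C(2) by blast
      obtain r2 where r2: "r2 \<in> R" "S r2 = r1" "norm r2 \<le> C1 * norm r1" using preR[OF r1(1)] by blast
      have "norm r1 \<le> C * (s * norm x)" using order_trans[OF r1(3) mult_left_mono[OF s(2) C(1)]] .
      then have "norm r2 \<le> C1 * (C * (s * norm x))"
        using order_trans[OF r2(3) mult_left_mono[of _ _ C1]] C1(1) by simp
      then have n2: "norm r2 \<le> D * norm x" by (simp add: D_def mult.assoc)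
      obtain k where k: "k \<in> K0" "(x - r2) - k \<in> L" "norm k \<le> K * norm (x - r2)" using KL by blast
      have "S ((x - r2) - k) = S x - r1" using k(1) by (simp add: lin r2(2) K0_def)
      then have "x - (r2 + k) \<in> H (Suc j)" using k(2) r1(2) by (simp add: HS diff_diff_eq)
      moreover have "r2 + k \<in> R" using csubspace_add[OF R r2(1)] k(1) by (simp add: K0_def)
      moreover have "norm (r2 + k) \<le> (D + K * (1 + D)) * norm x"
      proof -
        have "norm (x - r2) \<le> (1 + D) * norm x"
          using norm_triangle_ineq4[of x r2] n2 by (simp add: algebra_simps)
        then have "norm k \<le> K * ((1 + D) * norm x)"
          using order_trans[OF k(3) mult_left_mono[of _ _ K]] K by simp
        then show ?thesis using norm_triangle_ineq[of r2 k] n2 by (simp add: algebra_simps)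
      qed
      ultimately show ?thesis by blast
    qed
    moreover have "D + K * (1 + D) \<ge> 0" using K D by simp
    ultimately show ?case by blast
  qed
  then obtain C where C: "\<And>x. (S ^^ d) x \<in> R \<Longrightarrow> \<exists>r\<in>R. x - r \<in> H d \<and> norm r \<le> C * norm x" by metis
  have "\<exists>n\<in>H d. x - n \<in> R \<and> norm n \<le> (1 + C) * norm x" for x
  proof -
    have "(S ^^ d) x \<in> R" by (simp add: R_def)
    then obtain r where r: "r \<in> R" "x - r \<in> H d" "norm r \<le> C * norm x" using C by blast
    then have "norm (x - r) \<le> (1 + C) * norm x"
      using norm_triangle_ineq4[of x r] by (simp add: algebra_simps)
    then show ?thesis using r by (intro bexI[of _ "x - r"]) auto
  qed
  then obtain Q where Q: "bounded_clinear Q" "\<And>x. Q x \<in> H d" "\<And>x. x - Q x \<in> R" "\<And>x. x \<in> H d \<Longrightarrow> Q x = x"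
    "\<And>S x. bounded_clinear S \<Longrightarrow> S ` H d \<subseteq> H d \<Longrightarrow> S ` R \<subseteq> R \<Longrightarrow> Q (S x) = S (Q x)"
    using projection_of_bounded_decomposition[OF Hc R HR0] by metis
  obtain p where p: "p > 0" "\<And>x. norm (Q x) \<le> p * norm x"
    using bounded_linear.pos_bounded[OF bounded_clinear_imp_bounded_linear[OF Q(1)]]
    by (metis mult.commute)
  have pre: "\<exists>u. S u = x - Q x \<and> norm u \<le> (C1 * (1 + p)) * norm x" for x
  proof -
    obtain u where u: "S u = x - Q x" "norm u \<le> C1 * norm (x - Q x)" using preR[OF Q(3)] by blast
    have "norm (x - Q x) \<le> (1 + p) * norm x"
      using norm_triangle_ineq4[of x "Q x"] p(2)[of x] by (simp add: algebra_simps)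
    then have "norm u \<le> C1 * ((1 + p) * norm x)"
      using order_trans[OF u(2) mult_left_mono[of _ _ C1]] C1(1) by simp
    then show ?thesis using u(1) by (auto simp: mult.assoc)
  qed
  show thesis
  proof (rule that[OF Q(1) _ _ _ pre])
    show "Q (S x) = S (Q x)" for x using Q(5)[OF S SH] SR by simp
    show "(S ^^ d) (Q x) = 0" for x by (rule SjH[OF Q(2)])
    show "Q (Q x) = Q x" for x by (rule Q(4)[OF Q(2)])
  qed
qed

section \<open>The approximate point spectrum of a derivation and its left poles\<close>

lemmas cblinfun_rep = cblinfun_compose.rep_eq plus_cblinfun.rep_eq minus_cblinfun.rep_eq
  uminus_cblinfun.rep_eq scaleC_cblinfun.rep_eq zero_cblinfun.rep_eq cblinfun_id.rep_eq

lemmas cblinfun_lin = bounded_clinear_simps[OF bounded_clinear_cblinfun_apply]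

lemma bounded_below_iff_norm_le:
  fixes T :: "'a::complex_banach \<Rightarrow>\<^sub>C\<^sub>L 'b::complex_banach"
  shows "bounded_below T \<longleftrightarrow> (\<exists>C>0. \<forall>x. norm x \<le> C * norm (cblinfun_apply T x))"
proof
  assume "bounded_below T"
  then have null: "null_space T = {0}" and cl: "closed (range (cblinfun_apply T))"
    by (auto simp: bounded_below_def range_space_def)
  obtain C where C: "C > 0"
    "\<And>x. \<exists>u. cblinfun_apply T u = cblinfun_apply T x \<and> norm u \<le> C * norm (cblinfun_apply T x)"
    using bounded_preimages_if_closed_range[OF bounded_linear_cblinfun_apply cl] by metis
  have "norm x \<le> C * norm (cblinfun_apply T x)" for x
  proof -
    obtain u where u: "cblinfun_apply T u = cblinfun_apply T x" "norm u \<le> C * norm (cblinfun_apply T x)"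
      using C(2) by blast
    then have "u - x \<in> null_space T" by (simp add: null_space_def cblinfun_lin)
    then show ?thesis using u(2) null by simp
  qed
  then show "\<exists>C>0. \<forall>x. norm x \<le> C * norm (cblinfun_apply T x)" using C(1) by blast
next
  assume "\<exists>C>0. \<forall>x. norm x \<le> C * norm (cblinfun_apply T x)"
  then obtain C where C: "\<And>x. norm x \<le> C * norm (cblinfun_apply T x)" by blast
  have "x = 0" if "cblinfun_apply T x = 0" for x using C[of x] that by simp
  then have "null_space T = {0}" by (auto simp: null_space_def cblinfun_lin)
  moreover have "closed (range_space T)"
    unfolding range_space_def
    using closed_image_if_bounded_below[OF bounded_linear_cblinfun_apply subspace_UNIV closed_UNIV C] .
  ultimately show "bounded_below T" by (simp add: bounded_below_def)
qed

lemma norm_cblinfun_compose: "norm (S o\<^sub>C\<^sub>L T) \<le> norm S * norm T"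
proof (rule norm_cblinfun_bound)
  fix x
  show "norm (cblinfun_apply (S o\<^sub>C\<^sub>L T) x) \<le> norm S * norm T * norm x"
    using order_trans[OF norm_cblinfun mult_left_mono[OF norm_cblinfun]]
    by (simp add: cblinfun_rep mult.assoc)
qed simp

text \<open>
  For \<open>P = 0\<close>: left multiplication by an operator that is bounded below is bounded below. The
  general form is for the projections of \<open>kato_projection_of_finite_ascent\<close>.
\<close>

lemma norm_le_compose_left:
  assumes C: "C \<ge> 0" and le: "\<And>x. norm (x - cblinfun_apply P x) \<le> C * norm (cblinfun_apply S x)"
  shows "norm (X - P o\<^sub>C\<^sub>L X) \<le> C * norm (S o\<^sub>C\<^sub>L X)"
proof (rule norm_cblinfun_bound)
  fix y
  have "norm (cblinfun_apply (X - P o\<^sub>C\<^sub>L X) y) \<le> C * norm (cblinfun_apply (S o\<^sub>C\<^sub>L X) y)"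
    using le by (simp add: cblinfun_rep)
  also have "\<dots> \<le> C * (norm (S o\<^sub>C\<^sub>L X) * norm y)" using C by (intro mult_left_mono norm_cblinfun)
  finally show "norm (cblinfun_apply (X - P o\<^sub>C\<^sub>L X) y) \<le> C * norm (S o\<^sub>C\<^sub>L X) * norm y"
    by (simp add: mult.assoc)
qed (use C in simp)

text \<open>
  For \<open>Q = 0\<close>: right multiplication by a surjective operator is bounded below. The
  general form is for the projections of \<open>kato_projection_of_finite_descent\<close>.
\<close>

lemma norm_le_compose_right:
  assumes C: "C \<ge> 0" and pre: "\<And>y. \<exists>u. cblinfun_apply S u = y - cblinfun_apply Q y \<and> norm u \<le> C * norm y"
  shows "norm (X - X o\<^sub>C\<^sub>L Q) \<le> C * norm (X o\<^sub>C\<^sub>L S)"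
proof (rule norm_cblinfun_bound)
  fix y
  obtain u where u: "cblinfun_apply S u = y - cblinfun_apply Q y" "norm u \<le> C * norm y" using pre by blast
  have "cblinfun_apply (X - X o\<^sub>C\<^sub>L Q) y = cblinfun_apply (X o\<^sub>C\<^sub>L S) u"
    by (simp add: cblinfun_rep u(1) cblinfun_lin)
  then have "norm (cblinfun_apply (X - X o\<^sub>C\<^sub>L Q) y) \<le> norm (X o\<^sub>C\<^sub>L S) * norm u"
    using norm_cblinfun by metis
  also have "\<dots> \<le> norm (X o\<^sub>C\<^sub>L S) * (C * norm y)" using u(2) by (intro mult_left_mono) auto
  finally show "norm (cblinfun_apply (X - X o\<^sub>C\<^sub>L Q) y) \<le> C * norm (X o\<^sub>C\<^sub>L S) * norm y"
    by (simp add: mult_ac)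
qed (use C in simp)

lemma bounded_preimages_if_surj:
  fixes T :: "'a::complex_banach \<Rightarrow>\<^sub>C\<^sub>L 'b::complex_banach"
  assumes "surj (cblinfun_apply T)"
  obtains C where "C > 0" "\<And>y. \<exists>u. cblinfun_apply T u = y \<and> norm u \<le> C * norm y"
  using bounded_preimages_if_closed_range[OF bounded_linear_cblinfun_apply, of T] assms
  by (metis closed_UNIV surjD)

lemma shifted_derivation_apply:
  "cblinfun_apply (generalized_derivation A B - \<kappa> *\<^sub>C cblinfun_id) X = A o\<^sub>C\<^sub>L X - X o\<^sub>C\<^sub>L B - \<kappa> *\<^sub>C X"
  by (simp add: cblinfun_rep generalized_derivation_apply)

text \<open>
  Rank one operators built from an approximate eigenvector \<open>x\<close> of \<open>A\<close> and a functional \<open>f\<close> that is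
  nearly annihilated by the adjoint of \<open>B - \<nu>\<close> are approximate eigenvectors of the derivation. The
  order of choices matters: \<open>f\<close> comes first, and \<open>x\<close> is then chosen according to the norm bound
  \<open>M\<close> of \<open>f\<close>.
\<close>

lemma sigma_a_minus_sigma_s_subset:
  fixes A :: "'x::complex_banach \<Rightarrow>\<^sub>C\<^sub>L 'x" and B :: "'y::complex_banach \<Rightarrow>\<^sub>C\<^sub>L 'y"
  assumes \<mu>: "\<mu> \<in> sigma_a A" and \<nu>: "\<nu> \<in> sigma_s B"
  shows "\<mu> - \<nu> \<in> sigma_a (generalized_derivation A B)"
proof (rule ccontr)
  define D where "D = generalized_derivation A B - (\<mu> - \<nu>) *\<^sub>C cblinfun_id"
  define S where "S = A - \<mu> *\<^sub>C cblinfun_id"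
  define T where "T = B - \<nu> *\<^sub>C cblinfun_id"
  assume "\<mu> - \<nu> \<notin> sigma_a (generalized_derivation A B)"
  then have "bounded_below D" by (simp add: sigma_a_def D_def)
  then obtain C where C: "C > 0" "\<And>X. norm X \<le> C * norm (cblinfun_apply D X)"
    unfolding bounded_below_iff_norm_le by blast
  have "\<not> surj (cblinfun_apply T)" using \<nu> by (simp add: sigma_s_def T_def)
  then obtain f M y where f: "\<And>u v. f (u + v) = f u + f v" "\<And>c u. f (c *\<^sub>C u) = (c::complex) * f u"
    "M > 0" "\<And>z. cmod (f z) \<le> M * norm z" "\<And>w. cmod (f (cblinfun_apply T w)) \<le> norm w"
    "2 * C * norm y < cmod (f y)"
    using functional_small_on_range_if_not_surj[OF bounded_clinear_cblinfun_apply, of T "2 * C"] by metis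
  have "\<not> bounded_below S" using \<mu> by (simp add: sigma_a_def S_def)
  then obtain x where x: "M * norm (cblinfun_apply S x) < norm x"
    unfolding bounded_below_iff_norm_le using f(3) by (meson not_le)
  have x0: "norm x > 0"
    using le_less_trans[OF mult_nonneg_nonneg[OF less_imp_le[OF f(3)] norm_ge_zero] x] .
  have f_diff: "f (u - v) = f u - f v" for u v
    using f(1)[of "u - v" v] by simp
  have "bounded_linear (\<lambda>z. f z *\<^sub>C x)"
  proof (rule bounded_linear_intro[where K = "M * norm x"])
    show "f (u + v) *\<^sub>C x = f u *\<^sub>C x + f v *\<^sub>C x" for u v by (simp add: f(1) scaleC_add_left)
    show "f (r *\<^sub>R u) *\<^sub>C x = r *\<^sub>R f u *\<^sub>C x" for r u
      using f(2)[of "complex_of_real r" u] by (simp only: scaleC_scaleC[symmetric] scaleC_of_real)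
    show "norm (f u *\<^sub>C x) \<le> norm u * (M * norm x)" for u
      using mult_right_mono[OF f(4)[of u] norm_ge_zero[of x]] by (simp add: norm_scaleC mult_ac)
  qed
  then have "bounded_clinear (\<lambda>z. f z *\<^sub>C x)"
    by (simp add: bounded_clinear_def f(2) scaleC_scaleC)
  then obtain X where X: "cblinfun_apply X = (\<lambda>z. f z *\<^sub>C x)"
    using CBlinfun_inverse by blast
  have "norm (cblinfun_apply D X) \<le> 2 * norm x"
  proof (rule norm_cblinfun_bound)
    fix z
    have "cblinfun_apply D X = A o\<^sub>C\<^sub>L X - X o\<^sub>C\<^sub>L B - (\<mu> - \<nu>) *\<^sub>C X"
      unfolding D_def by (rule shifted_derivation_apply)
    then have "cblinfun_apply (cblinfun_apply D X) z = f z *\<^sub>C cblinfun_apply S x - f (cblinfun_apply T z) *\<^sub>C x"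
      by (simp add: S_def T_def cblinfun_rep X cblinfun_lin f_diff f(2)
          scaleC_diff_right complex_vector.scale_left_diff_distrib scaleC_scaleC left_diff_distrib mult.commute)
    then have "norm (cblinfun_apply (cblinfun_apply D X) z) \<le>
        cmod (f z) * norm (cblinfun_apply S x) + cmod (f (cblinfun_apply T z)) * norm x"
      by (metis norm_triangle_ineq4 norm_scaleC)
    also have "\<dots> \<le> (M * norm z) * norm (cblinfun_apply S x) + norm z * norm x"
      by (intro add_mono mult_right_mono f) auto
    also have "\<dots> = norm z * (M * norm (cblinfun_apply S x)) + norm z * norm x" by (simp add: mult_ac)
    also have "\<dots> \<le> norm z * norm x + norm z * norm x"
      using x by (intro add_mono mult_left_mono) auto
    finally show "norm (cblinfun_apply (cblinfun_apply D X) z) \<le> 2 * norm x * norm z" by (simp add: mult_ac)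
  qed simp
  then have "norm X \<le> C * (2 * norm x)" using order_trans[OF C(2) mult_left_mono] C(1) by simp
  have "cmod (f y) * norm x = norm (cblinfun_apply X y)" by (simp add: X norm_scaleC)
  also have "\<dots> \<le> C * (2 * norm x) * norm y"
    using \<open>norm X \<le> C * (2 * norm x)\<close> by (intro order_trans[OF norm_cblinfun] mult_right_mono) auto
  finally have "cmod (f y) * norm x \<le> 2 * C * norm y * norm x" by (simp add: mult_ac)
  then show False using f(6) x0 by simp
qed

lemma asc_eq_Least:
  assumes "null_space (cblinfun_power T n) = null_space (cblinfun_power T (n + 1))"
  shows "asc T = enat (LEAST n. null_space (cblinfun_power T n) = null_space (cblinfun_power T (n + 1)))"
  unfolding asc_def
proof (rule antisym)
  let ?P = "\<lambda>n. null_space (cblinfun_power T n) = null_space (cblinfun_power T (n + 1))"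
  show "Inf {enat n |n. ?P n} \<le> enat (LEAST n. ?P n)"
    using LeastI[of ?P, OF assms] by (intro Inf_lower) blast
  show "enat (LEAST n. ?P n) \<le> Inf {enat n |n. ?P n}"
    by (rule Inf_greatest) (auto intro: Least_le)
qed

lemma null_space_eq_if_asc:
  assumes "asc T = enat d"
  shows "null_space (cblinfun_power T d) = null_space (cblinfun_power T (d + 1))"
proof -
  let ?P = "\<lambda>n. null_space (cblinfun_power T n) = null_space (cblinfun_power T (n + 1))"
  have "{enat n |n. ?P n} \<noteq> {}"
  proof
    assume "{enat n |n. ?P n} = {}"
    then have "asc T = \<infinity>" unfolding asc_def Inf_enat_def by (simp only: if_True simp_thms)
    then show False using assms by simp
  qed
  then obtain n where "?P n" by blast
  then show ?thesis using asc_eq_Least[of T n] LeastI[of ?P n] assms by simp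
qed

lemma range_space_eq_if_dsc:
  assumes "dsc T = enat d"
  shows "range_space (cblinfun_power T d) = range_space (cblinfun_power T (d + 1))"
proof -
  let ?P = "\<lambda>n. range_space (cblinfun_power T n) = range_space (cblinfun_power T (n + 1))"
  let ?X = "{enat n |n. ?P n}"
  have "?X \<noteq> {}"
  proof
    assume "?X = {}"
    then have "dsc T = \<infinity>" unfolding dsc_def Inf_enat_def by (simp only: if_True simp_thms)
    then show False using assms by simp
  qed
  then have "Inf ?X \<in> ?X"
    unfolding Inf_enat_def using LeastI_ex[of "\<lambda>x. x \<in> ?X"] by auto
  then show ?thesis using assms unfolding dsc_def by auto
qed

text \<open>
  \<open>E\<close> projects onto a subspace where \<open>D\<close> is nilpotent, and \<open>D\<close> is bounded below on the kernel
  \<open>V\<close> of \<open>E\<close>. Hence the null spaces of the powers of \<open>D\<close> stop growing after at most \<open>n\<close> steps,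
  and at the ascent \<open>d\<close> the power \<open>D^d\<close> already vanishes on the range of \<open>E\<close>. So the range of
  \<open>D^(d+1)\<close> is the image of \<open>V\<close> under a map that is bounded below.
\<close>

lemma finite_ascent_closed_range_if_nilpotent_part:
  fixes D :: "'z::complex_banach \<Rightarrow>\<^sub>C\<^sub>L 'z"
  assumes E: "bounded_clinear E" and idem: "\<And>z. E (E z) = E z"
    and comm: "\<And>z. E (cblinfun_apply D z) = cblinfun_apply D (E z)"
    and nil: "\<And>z. (cblinfun_apply D ^^ n) (E z) = 0"
    and lower: "\<And>z. norm z \<le> L * (norm (cblinfun_apply D z) + norm (E z))"
  obtains d where "asc D = enat d" "closed (range_space (cblinfun_power D (d + 1)))"
proof -
  define T where "T = cblinfun_apply D"
  have T: "bounded_clinear T" unfolding T_def by (rule bounded_clinear_cblinfun_apply)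
  have Tn: "bounded_clinear (T ^^ k)" for k by (rule bounded_clinear_funpow[OF T])
  note lin = bounded_clinear_simps[OF Tn] bounded_clinear_simps[OF E]
  have null: "null_space (cblinfun_power D k) = {z. (T ^^ k) z = 0}" for k
    by (simp add: null_space_def cblinfun_power_apply T_def)
  have ETn: "E ((T ^^ k) z) = (T ^^ k) (E z)" for k z
    by (induction k) (simp_all add: T_def comm)
  have lowerV: "norm z \<le> \<bar>L\<bar> ^ k * norm ((T ^^ k) z)" if "E z = 0" for k z
  proof (induction k)
    case (Suc k)
    have "E ((T ^^ k) z) = 0" using that by (simp add: ETn lin)
    then have "norm ((T ^^ k) z) \<le> L * norm ((T ^^ Suc k) z)"
      using lower[of "(T ^^ k) z"] by (simp add: T_def)
    also have "\<dots> \<le> \<bar>L\<bar> * norm ((T ^^ Suc k) z)" by (intro mult_right_mono) auto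
    finally have "\<bar>L\<bar> ^ k * norm ((T ^^ k) z) \<le> \<bar>L\<bar> ^ k * (\<bar>L\<bar> * norm ((T ^^ Suc k) z))"
      by (intro mult_left_mono) auto
    with Suc show ?case by (simp add: mult_ac)
  qed simp
  have zE: "E (z - E z) = 0" for z by (simp add: lin idem)
  have null_eq: "z = E z" if "(T ^^ k) z = 0" "n \<le> k" for k z
  proof -
    have "(T ^^ k) (E z) = (T ^^ (k - n)) ((T ^^ n) (E z))"
      using that(2) by (simp add: funpow_add[symmetric, unfolded comp_def, THEN fun_cong])
    then have "(T ^^ k) (E z) = 0" using nil[of z] by (simp add: T_def[symmetric] lin)
    then have "(T ^^ k) (z - E z) = 0" using that(1) by (simp add: lin)
    then show ?thesis using lowerV[OF zE, of z k] by simp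
  qed
  let ?P = "\<lambda>k. null_space (cblinfun_power D k) = null_space (cblinfun_power D (k + 1))"
  have "?P n"
  proof -
    have "(T ^^ n) z = 0" if "(T ^^ (n + 1)) z = 0" for z
      using null_eq[OF that] nil[of z] by (simp add: T_def)
    moreover have "(T ^^ (n + 1)) z = 0" if "(T ^^ n) z = 0" for z
      using that bounded_clinear_zero_eq[OF T] by simp
    ultimately show ?thesis unfolding null by blast
  qed
  then obtain d where d: "asc D = enat d" using asc_eq_Least by blast
  have stable: "(T ^^ Suc d) z = 0 \<Longrightarrow> (T ^^ d) z = 0" for z
    using null_space_eq_if_asc[OF d] unfolding null by auto
  have dE: "(T ^^ d) (E z) = 0" for z
  proof -
    have "(T ^^ (d + n)) (E z) = 0" using nil[of z] by (simp add: funpow_add T_def[symmetric] lin)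
    then show ?thesis using funpow_null_stable[of d T, OF stable] by blast
  qed
  define V where "V = {z. E z = 0}"
  have "range (T ^^ Suc d) = (T ^^ Suc d) ` V"
  proof
    show "range (T ^^ Suc d) \<subseteq> (T ^^ Suc d) ` V"
    proof
      fix y assume "y \<in> range (T ^^ Suc d)"
      then obtain z where "y = (T ^^ Suc d) z" by blast
      moreover have "(T ^^ Suc d) (E z) = 0" using dE bounded_clinear_zero_eq[OF T] by simp
      ultimately have "y = (T ^^ Suc d) (z - E z)" by (simp only: lin) simp
      moreover have "z - E z \<in> V" using zE by (simp add: V_def)
      ultimately show "y \<in> (T ^^ Suc d) ` V" by blast
    qed
  qed blast
  moreover have "closed ((T ^^ Suc d) ` V)"
  proof (rule closed_image_if_bounded_below[OF bounded_clinear_imp_bounded_linear[OF Tn]])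
    show "subspace V" unfolding V_def by (rule csubspace_imp_subspace[OF csubspace_null[OF E]])
    have "V = E -` {0}" by (auto simp: V_def)
    moreover have "isCont E z" for z
      using bounded_linear.isCont[OF bounded_clinear_imp_bounded_linear[OF E] continuous_ident] by simp
    ultimately show "closed V"
      by (simp add: continuous_at_imp_continuous_on closed_vimage)
    show "norm z \<le> \<bar>L\<bar> ^ Suc d * norm ((T ^^ Suc d) z)" if "z \<in> V" for z
      using lowerV[of z "Suc d"] that by (simp only: V_def mem_Collect_eq)
  qed
  ultimately have "closed (range_space (cblinfun_power D (d + 1)))"
    unfolding range_space_def cblinfun_power_apply T_def by simp
  with d that show thesis by blast
qed

section \<open>Generalized derivations of left and right polaroid operators\<close>

lemma cblinfun_apply_sum: "cblinfun_apply (\<Sum>i\<in>I. X i) y = (\<Sum>i\<in>I. cblinfun_apply (X i) y)"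
  by (induction I rule: infinite_finite_induct) (simp_all add: cblinfun_rep)

lemma cblinfun_sum: "cblinfun_apply T (\<Sum>i\<in>I. f i) = (\<Sum>i\<in>I. cblinfun_apply T (f i))"
  by (rule linear_sum[OF bounded_linear.linear[OF bounded_linear_cblinfun_apply]])

lemma bounded_clinear_sum:
  "(\<And>i. i \<in> I \<Longrightarrow> bounded_clinear (f i)) \<Longrightarrow> bounded_clinear (\<lambda>x. \<Sum>i\<in>I. f i x)"
  by (induction I rule: infinite_finite_induct)
    (simp_all add: bounded_clinear_zero bounded_clinear_add)

lemma bounded_clinear_sandwich: "bounded_clinear (\<lambda>X. P o\<^sub>C\<^sub>L X o\<^sub>C\<^sub>L Q)"
proof -
  have scale: "P o\<^sub>C\<^sub>L (c *\<^sub>C X) o\<^sub>C\<^sub>L Q = c *\<^sub>C (P o\<^sub>C\<^sub>L X o\<^sub>C\<^sub>L Q)" for c X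
    by (rule cblinfun_eqI) (simp add: cblinfun_rep cblinfun_lin)
  have "bounded_linear (\<lambda>X. P o\<^sub>C\<^sub>L X o\<^sub>C\<^sub>L Q)"
  proof (rule bounded_linear_intro[where K = "norm P * norm Q"])
    show "P o\<^sub>C\<^sub>L (X + Y) o\<^sub>C\<^sub>L Q = P o\<^sub>C\<^sub>L X o\<^sub>C\<^sub>L Q + P o\<^sub>C\<^sub>L Y o\<^sub>C\<^sub>L Q" for X Y
      by (rule cblinfun_eqI) (simp add: cblinfun_rep cblinfun_lin)
    show "P o\<^sub>C\<^sub>L (r *\<^sub>R X) o\<^sub>C\<^sub>L Q = r *\<^sub>R (P o\<^sub>C\<^sub>L X o\<^sub>C\<^sub>L Q)" for r X
      using scale[of "complex_of_real r" X] by (simp add: scaleC_of_real)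
    show "norm (P o\<^sub>C\<^sub>L X o\<^sub>C\<^sub>L Q) \<le> norm X * (norm P * norm Q)" for X
      using order_trans[OF norm_cblinfun_compose mult_right_mono[OF norm_cblinfun_compose]]
      by (simp add: mult_ac)
  qed
  then show ?thesis by (simp add: bounded_clinear_def scale)
qed

text \<open>
  The polynomials \<open>(z - \<mu>)^a\<close> and \<open>(z - \<nu>)^b\<close> are coprime.
\<close>

lemma common_null_vector_of_distinct_shifts:
  fixes A :: "'a::complex_normed_vector \<Rightarrow> 'a"
  assumes A: "bounded_clinear A" and ne: "\<mu> \<noteq> \<nu>"
    and U: "((\<lambda>x. A x - \<mu> *\<^sub>C x) ^^ a) w = 0" and V: "((\<lambda>x. A x - \<nu> *\<^sub>C x) ^^ b) w = 0"
  shows "w = 0"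
proof -
  define U V where "U x = A x - \<mu> *\<^sub>C x" and "V x = A x - \<nu> *\<^sub>C x" for x
  have UV: "U (V x) = V (U x)" for x
    by (simp add: U_def V_def bounded_clinear_simps[OF A] scaleC_diff_right scaleC_scaleC mult.commute)
  have U0: "U 0 = 0" "V 0 = 0" by (simp_all add: U_def V_def bounded_clinear_simps[OF A])
  have UnV: "(U ^^ n) (V x) = V ((U ^^ n) x)" and VnU: "(V ^^ n) (U x) = U ((V ^^ n) x)" for n x
    by (induction n) (simp_all add: UV)
  have "w = 0" if "a + b \<le> n" "(U ^^ a) w = 0" "(V ^^ b) w = 0" for n a b w
    using that
  proof (induction n arbitrary: a b w)
    case (Suc n)
    show ?case
    proof (cases "a = 0 \<or> b = 0")
      case False
      then obtain a' b' where ab: "a = Suc a'" "b = Suc b'" by (metis not0_implies_Suc)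
      have "V w = 0"
        by (rule Suc.IH[of a b']) (use Suc.prems ab U0 in \<open>simp_all add: UnV funpow_swap1 del: funpow.simps\<close>, simp_all add: funpow_swap1[symmetric])
      moreover have "U w = 0"
        by (rule Suc.IH[of a' b]) (use Suc.prems ab U0 in \<open>simp_all add: VnU funpow_swap1 del: funpow.simps\<close>, simp_all add: funpow_swap1[symmetric])
      ultimately have "(\<nu> - \<mu>) *\<^sub>C w = 0"
        by (simp add: U_def V_def complex_vector.scale_left_diff_distrib)
      then show ?thesis using ne by simp
    qed (use Suc.prems in auto)
  qed simp
  from this[OF order_refl] U V show ?thesis unfolding U_def V_def by blast
qed

text \<open>
  The binomial formula for \<open>(U - V)^(a+b)\<close>, applied to a vector, by induction.
\<close>

lemma nilpotent_diff:
  assumes D: "bounded_clinear D" and eq: "\<And>z. D z = U z - V z"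
    and UV: "\<And>z. U (V z) = V (U z)" and U0: "U 0 = 0" "V 0 = 0"
  shows "(U ^^ a) z = 0 \<Longrightarrow> (V ^^ b) z = 0 \<Longrightarrow> (D ^^ (a + b)) z = 0"
proof (induction "a + b" arbitrary: a b z)
  case 0
  then show ?case by simp
next
  case (Suc n)
  have UnV: "(U ^^ n) (V x) = V ((U ^^ n) x)" and VnU: "(V ^^ n) (U x) = U ((V ^^ n) x)" for n x
    by (induction n) (simp_all add: UV)
  have Dn: "bounded_clinear (D ^^ k)" for k by (rule bounded_clinear_funpow[OF D])
  show ?case
  proof (cases "a = 0 \<or> b = 0")
    case True
    then have "z = 0" using Suc.prems by auto
    then show ?thesis by (simp add: bounded_clinear_zero_eq[OF Dn])
  next
    case False
    then obtain a' b' where ab: "a = Suc a'" "b = Suc b'" by (metis not0_implies_Suc)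
    have "(D ^^ (a' + b)) (U z) = 0"
    proof (rule Suc.hyps(1))
      show "n = a' + b" using Suc.hyps(2) ab by simp
      show "(U ^^ a') (U z) = 0" using Suc.prems(1) ab by (simp add: funpow_swap1)
      show "(V ^^ b) (U z) = 0" by (simp add: VnU Suc.prems(2) U0)
    qed
    moreover have "(D ^^ (a + b')) (V z) = 0"
    proof (rule Suc.hyps(1))
      show "n = a + b'" using Suc.hyps(2) ab by simp
      show "(V ^^ b') (V z) = 0" using Suc.prems(2) ab by (simp add: funpow_swap1)
      show "(U ^^ a) (V z) = 0" by (simp add: UnV Suc.prems(1) U0)
    qed
    moreover have "(D ^^ (a + b)) z = (D ^^ (a' + b)) (D z)"
      using ab by (simp add: funpow_swap1)
    moreover have "a + b' = a' + b" using ab by simp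
    ultimately show ?thesis by (simp add: eq bounded_clinear_diff[OF Dn])
  qed
qed

text \<open>
  With \<open>E X = \<Sum>\<mu>\<in>F. P \<mu> X Q \<mu>\<close> the operator \<open>D\<close> satisfies the hypotheses of
  \<open>finite_ascent_closed_range_if_nilpotent_part\<close>. It is nilpotent on the range of \<open>E\<close> since on
  \<open>P \<mu> X Q \<mu>\<close> it is the difference of left multiplication by \<open>S \<mu>\<close> and right multiplication by
  \<open>T \<mu>\<close>, which commute and are nilpotent there. The lower bound modulo \<open>g\<close> comes from
  \<open>dominated_by_seminorm\<close> for left multiplication by \<open>A\<close>: since \<open>S \<mu> X - X T \<mu> = D X\<close>, a
  small \<open>S \<mu> X\<close> also makes \<open>X T \<mu>\<close> small modulo \<open>g\<close>, and for every \<open>\<mu>\<close> this controls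
  \<open>X\<close> or, for \<open>\<mu> \<in> F\<close>, all of \<open>X\<close> except \<open>P \<mu> X Q \<mu>\<close>, which \<open>E X\<close> controls.
\<close>

theorem left_pole_of_derivation_if_spectral_projections:
  fixes A :: "'x::complex_banach \<Rightarrow>\<^sub>C\<^sub>L 'x" and B :: "'y::complex_banach \<Rightarrow>\<^sub>C\<^sub>L 'y"
    and P :: "complex \<Rightarrow> 'x \<Rightarrow>\<^sub>C\<^sub>L 'x" and Q :: "complex \<Rightarrow> 'y \<Rightarrow>\<^sub>C\<^sub>L 'y"
    and \<kappa> :: complex
  defines "S \<equiv> \<lambda>\<mu>. A - \<mu> *\<^sub>C cblinfun_id" and "T \<equiv> \<lambda>\<mu>. B - (\<mu> - \<kappa>) *\<^sub>C cblinfun_id"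
  assumes fin: "finite F"
    and off: "\<And>\<mu>. \<mu> \<notin> F \<Longrightarrow> bounded_below (S \<mu>) \<or> surj (cblinfun_apply (T \<mu>))"
    and P: "\<And>\<mu>. \<mu> \<in> F \<Longrightarrow> P \<mu> o\<^sub>C\<^sub>L S \<mu> = S \<mu> o\<^sub>C\<^sub>L P \<mu>" "\<And>\<mu>. \<mu> \<in> F \<Longrightarrow> P \<mu> o\<^sub>C\<^sub>L P \<mu> = P \<mu>"
      "\<And>\<mu> x. \<mu> \<in> F \<Longrightarrow> (cblinfun_apply (S \<mu>) ^^ d \<mu>) (cblinfun_apply (P \<mu>) x) = 0"
      "\<And>\<mu> x. \<mu> \<in> F \<Longrightarrow> norm (x - cblinfun_apply (P \<mu>) x) \<le> CP \<mu> * norm (cblinfun_apply (S \<mu>) x)"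
    and Q: "\<And>\<mu>. \<mu> \<in> F \<Longrightarrow> Q \<mu> o\<^sub>C\<^sub>L T \<mu> = T \<mu> o\<^sub>C\<^sub>L Q \<mu>" "\<And>\<mu>. \<mu> \<in> F \<Longrightarrow> Q \<mu> o\<^sub>C\<^sub>L Q \<mu> = Q \<mu>"
      "\<And>\<mu> y. \<mu> \<in> F \<Longrightarrow> (cblinfun_apply (T \<mu>) ^^ e \<mu>) (cblinfun_apply (Q \<mu>) y) = 0"
      "\<And>\<mu> y. \<mu> \<in> F \<Longrightarrow> \<exists>u. cblinfun_apply (T \<mu>) u = y - cblinfun_apply (Q \<mu>) y \<and> norm u \<le> CQ \<mu> * norm y"
  defines "D \<equiv> generalized_derivation A B - \<kappa> *\<^sub>C cblinfun_id"
  obtains n where "asc D = enat n" "closed (range_space (cblinfun_power D (n + 1)))"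
proof -
  have PA: "cblinfun_apply (P \<mu>) (cblinfun_apply A x) = cblinfun_apply A (cblinfun_apply (P \<mu>) x)" if "\<mu> \<in> F" for \<mu> x
    using arg_cong[OF P(1)[OF that], of "\<lambda>X. cblinfun_apply X x"]
    by (simp add: S_def cblinfun_rep cblinfun_lin)
  have QB: "cblinfun_apply (Q \<mu>) (cblinfun_apply B y) = cblinfun_apply B (cblinfun_apply (Q \<mu>) y)" if "\<mu> \<in> F" for \<mu> y
    using arg_cong[OF Q(1)[OF that], of "\<lambda>X. cblinfun_apply X y"]
    by (simp add: T_def cblinfun_rep cblinfun_lin)
  have PP: "cblinfun_apply (P \<mu>) (cblinfun_apply (P \<mu>) x) = cblinfun_apply (P \<mu>) x" if "\<mu> \<in> F" for \<mu> x
    using arg_cong[OF P(2)[OF that], of "\<lambda>X. cblinfun_apply X x"] by (simp add: cblinfun_rep)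
  have QQ: "cblinfun_apply (Q \<mu>) (cblinfun_apply (Q \<mu>) y) = cblinfun_apply (Q \<mu>) y" if "\<mu> \<in> F" for \<mu> y
    using arg_cong[OF Q(2)[OF that], of "\<lambda>X. cblinfun_apply X y"] by (simp add: cblinfun_rep)
  have S_fun: "cblinfun_apply (S \<mu>) = (\<lambda>x. cblinfun_apply A x - \<mu> *\<^sub>C x)" for \<mu>
    by (simp add: S_def cblinfun_rep fun_eq_iff)
  have D_apply: "cblinfun_apply D X = A o\<^sub>C\<^sub>L X - X o\<^sub>C\<^sub>L B - \<kappa> *\<^sub>C X" for X
    unfolding D_def by (rule shifted_derivation_apply)
  \<comment> \<open>The projections for different \<open>\<mu>\<close> need not come from one common decomposition, but the range
    of \<open>P \<nu>\<close> is annihilated by a power of \<open>S \<nu>\<close>, and \<open>P \<mu>\<close> preserves this property.\<close>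
  have ortho: "cblinfun_apply (P \<mu>) (cblinfun_apply (P \<nu>) x) = 0" if "\<mu> \<in> F" "\<nu> \<in> F" "\<mu> \<noteq> \<nu>" for \<mu> \<nu> x
  proof (rule common_null_vector_of_distinct_shifts[OF bounded_clinear_cblinfun_apply that(3)])
    show "((\<lambda>x. cblinfun_apply A x - \<mu> *\<^sub>C x) ^^ d \<mu>) (cblinfun_apply (P \<mu>) (cblinfun_apply (P \<nu>) x)) = 0"
      using P(3)[OF that(1)] unfolding S_fun by blast
    have "((\<lambda>x. cblinfun_apply A x - \<nu> *\<^sub>C x) ^^ k) (cblinfun_apply (P \<mu>) v)
        = cblinfun_apply (P \<mu>) (((\<lambda>x. cblinfun_apply A x - \<nu> *\<^sub>C x) ^^ k) v)" for k v
      by (induction k) (simp_all add: PA[OF that(1)] cblinfun_lin)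
    then show "((\<lambda>x. cblinfun_apply A x - \<nu> *\<^sub>C x) ^^ d \<nu>) (cblinfun_apply (P \<mu>) (cblinfun_apply (P \<nu>) x)) = 0"
      using P(3)[OF that(2), of x] by (simp add: S_fun cblinfun_lin)
  qed
  define E where "E X = (\<Sum>\<mu>\<in>F. P \<mu> o\<^sub>C\<^sub>L X o\<^sub>C\<^sub>L Q \<mu>)" for X
  have E: "bounded_clinear E" unfolding E_def by (intro bounded_clinear_sum bounded_clinear_sandwich)
  have E_apply: "cblinfun_apply (E X) y = (\<Sum>\<mu>\<in>F. cblinfun_apply (P \<mu>) (cblinfun_apply X (cblinfun_apply (Q \<mu>) y)))" for X y
    by (simp add: E_def cblinfun_apply_sum cblinfun_rep)
  have corner: "P \<mu> o\<^sub>C\<^sub>L E X o\<^sub>C\<^sub>L Q \<mu> = P \<mu> o\<^sub>C\<^sub>L X o\<^sub>C\<^sub>L Q \<mu>" if "\<mu> \<in> F" for \<mu> X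
  proof (rule cblinfun_eqI)
    fix y
    have "cblinfun_apply (P \<mu> o\<^sub>C\<^sub>L E X o\<^sub>C\<^sub>L Q \<mu>) y =
        (\<Sum>\<nu>\<in>F. cblinfun_apply (P \<mu>) (cblinfun_apply (P \<nu>) (cblinfun_apply X (cblinfun_apply (Q \<nu>) (cblinfun_apply (Q \<mu>) y)))))"
      by (simp add: cblinfun_rep E_apply cblinfun_sum)
    also have "\<dots> = (\<Sum>\<nu>\<in>F. if \<nu> = \<mu> then cblinfun_apply (P \<mu> o\<^sub>C\<^sub>L X o\<^sub>C\<^sub>L Q \<mu>) y else 0)"
      by (rule sum.cong[OF refl]) (use that in \<open>simp add: ortho PP QQ cblinfun_rep\<close>)
    also have "\<dots> = cblinfun_apply (P \<mu> o\<^sub>C\<^sub>L X o\<^sub>C\<^sub>L Q \<mu>) y" using that fin by simp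
    finally show "cblinfun_apply (P \<mu> o\<^sub>C\<^sub>L E X o\<^sub>C\<^sub>L Q \<mu>) y = cblinfun_apply (P \<mu> o\<^sub>C\<^sub>L X o\<^sub>C\<^sub>L Q \<mu>) y" .
  qed
  have idem: "E (E X) = E X" for X
  proof -
    have "E (E X) = (\<Sum>\<mu>\<in>F. P \<mu> o\<^sub>C\<^sub>L E X o\<^sub>C\<^sub>L Q \<mu>)" by (rule E_def)
    also have "\<dots> = (\<Sum>\<mu>\<in>F. P \<mu> o\<^sub>C\<^sub>L X o\<^sub>C\<^sub>L Q \<mu>)" by (rule sum.cong[OF refl corner])
    finally show ?thesis by (simp only: E_def[of X])
  qed
  have EA: "E (A o\<^sub>C\<^sub>L X) = A o\<^sub>C\<^sub>L E X" and EB: "E (X o\<^sub>C\<^sub>L B) = E X o\<^sub>C\<^sub>L B" for X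
    by (auto intro!: cblinfun_eqI sum.cong simp: E_apply cblinfun_rep cblinfun_sum PA QB)
  have ED: "E (cblinfun_apply D X) = cblinfun_apply D (E X)" for X
    by (simp add: D_apply bounded_clinear_simps[OF E] EA EB)
  have Dn: "bounded_clinear (cblinfun_apply D ^^ k)" for k
    by (rule bounded_clinear_funpow[OF bounded_clinear_cblinfun_apply])
  have nil1: "(cblinfun_apply D ^^ (d \<mu> + e \<mu>)) (P \<mu> o\<^sub>C\<^sub>L X o\<^sub>C\<^sub>L Q \<mu>) = 0" if "\<mu> \<in> F" for \<mu> X
  proof (rule nilpotent_diff[OF bounded_clinear_cblinfun_apply, where U = "\<lambda>Z. S \<mu> o\<^sub>C\<^sub>L Z" and V = "\<lambda>Z. Z o\<^sub>C\<^sub>L T \<mu>"])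
    show "cblinfun_apply D Z = S \<mu> o\<^sub>C\<^sub>L Z - Z o\<^sub>C\<^sub>L T \<mu>" for Z
      by (rule cblinfun_eqI)
        (simp add: D_apply S_def T_def cblinfun_rep cblinfun_lin complex_vector.scale_left_diff_distrib)
    show "S \<mu> o\<^sub>C\<^sub>L (Z o\<^sub>C\<^sub>L T \<mu>) = S \<mu> o\<^sub>C\<^sub>L Z o\<^sub>C\<^sub>L T \<mu>" "S \<mu> o\<^sub>C\<^sub>L 0 = 0" "0 o\<^sub>C\<^sub>L T \<mu> = 0" for Z
      by (rule cblinfun_eqI, simp add: cblinfun_rep cblinfun_lin)+
    have U: "cblinfun_apply (((\<lambda>Z. S \<mu> o\<^sub>C\<^sub>L Z) ^^ k) Z) y = (cblinfun_apply (S \<mu>) ^^ k) (cblinfun_apply Z y)" for k Z y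
      by (induction k) (simp_all add: cblinfun_rep)
    show "((\<lambda>Z. S \<mu> o\<^sub>C\<^sub>L Z) ^^ d \<mu>) (P \<mu> o\<^sub>C\<^sub>L X o\<^sub>C\<^sub>L Q \<mu>) = 0"
      by (intro cblinfun_eqI) (simp add: U cblinfun_rep P(3)[OF that])
    have V: "cblinfun_apply (((\<lambda>Z. Z o\<^sub>C\<^sub>L T \<mu>) ^^ k) Z) y = cblinfun_apply Z ((cblinfun_apply (T \<mu>) ^^ k) y)" for k Z y
      by (induction k arbitrary: y) (simp_all add: cblinfun_rep funpow_swap1)
    have QT: "cblinfun_apply (Q \<mu>) ((cblinfun_apply (T \<mu>) ^^ k) y) = (cblinfun_apply (T \<mu>) ^^ k) (cblinfun_apply (Q \<mu>) y)" for k y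
    proof (induction k)
      case (Suc k)
      then show ?case
        using arg_cong[OF Q(1)[OF that], of "\<lambda>X. cblinfun_apply X ((cblinfun_apply (T \<mu>) ^^ k) y)"]
        by (simp add: cblinfun_rep)
    qed simp
    show "((\<lambda>Z. Z o\<^sub>C\<^sub>L T \<mu>) ^^ e \<mu>) (P \<mu> o\<^sub>C\<^sub>L X o\<^sub>C\<^sub>L Q \<mu>) = 0"
      by (intro cblinfun_eqI) (simp add: V QT Q(3)[OF that] cblinfun_rep cblinfun_lin)
  qed
  define n where "n = (\<Sum>\<mu>\<in>F. d \<mu> + e \<mu>)"
  have nil: "(cblinfun_apply D ^^ n) (E X) = 0" for X
  proof -
    have "(cblinfun_apply D ^^ n) (P \<mu> o\<^sub>C\<^sub>L X o\<^sub>C\<^sub>L Q \<mu>) = 0" if "\<mu> \<in> F" for \<mu>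
    proof -
      have "d \<mu> + e \<mu> \<le> n" unfolding n_def using fin that by (intro member_le_sum) auto
      then have "(cblinfun_apply D ^^ n) Z = (cblinfun_apply D ^^ (n - (d \<mu> + e \<mu>))) ((cblinfun_apply D ^^ (d \<mu> + e \<mu>)) Z)" for Z
        by (metis comp_apply funpow_add le_add_diff_inverse2)
      then show ?thesis using nil1[OF that] by (simp add: bounded_clinear_simps[OF Dn])
    qed
    moreover have "(cblinfun_apply D ^^ n) (E X) = (\<Sum>\<mu>\<in>F. (cblinfun_apply D ^^ n) (P \<mu> o\<^sub>C\<^sub>L X o\<^sub>C\<^sub>L Q \<mu>))"
      unfolding E_def
      by (rule linear_sum[OF bounded_linear.linear[OF bounded_clinear_imp_bounded_linear[OF Dn]]])
    ultimately show ?thesis by simp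
  qed
  define g where "g X = norm (cblinfun_apply D X) + norm (E X)" for X
  interpret operator_with_seminorm "\<lambda>X :: 'y \<Rightarrow>\<^sub>C\<^sub>L 'x. A o\<^sub>C\<^sub>L X" g "norm A"
  proof
    have "A o\<^sub>C\<^sub>L X o\<^sub>C\<^sub>L cblinfun_id = A o\<^sub>C\<^sub>L X" for X :: "'y \<Rightarrow>\<^sub>C\<^sub>L 'x"
      by (rule cblinfun_eqI) (simp add: cblinfun_rep)
    then show "bounded_clinear (\<lambda>X :: 'y \<Rightarrow>\<^sub>C\<^sub>L 'x. A o\<^sub>C\<^sub>L X)"
      using bounded_clinear_sandwich[of A "cblinfun_id :: 'y \<Rightarrow>\<^sub>C\<^sub>L 'y"] by simp
    show "g (X + Y) \<le> g X + g Y" for X Y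
      using norm_triangle_ineq[of "cblinfun_apply D X" "cblinfun_apply D Y"] norm_triangle_ineq[of "E X" "E Y"]
      by (simp add: g_def cblinfun_lin bounded_clinear_simps[OF E])
    show "g (c *\<^sub>C X) = cmod c * g X" for c X
      by (simp add: g_def cblinfun_lin bounded_clinear_simps[OF E] norm_scaleC distrib_left)
    have "cblinfun_apply D (A o\<^sub>C\<^sub>L X) = A o\<^sub>C\<^sub>L cblinfun_apply D X" for X
      by (rule cblinfun_eqI) (simp add: D_apply cblinfun_rep cblinfun_lin)
    then show "g (A o\<^sub>C\<^sub>L X) \<le> norm A * g X" for X
      using norm_cblinfun_compose[of A "cblinfun_apply D X"] norm_cblinfun_compose[of A "E X"]
      by (simp add: g_def EA distrib_left)
  qed simp
  have shift: "A o\<^sub>C\<^sub>L X - \<mu> *\<^sub>C X = S \<mu> o\<^sub>C\<^sub>L X" for X :: "'y \<Rightarrow>\<^sub>C\<^sub>L 'x" and \<mu>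
    by (rule cblinfun_eqI) (simp add: S_def cblinfun_rep)
  have XT: "norm (X o\<^sub>C\<^sub>L T \<mu>) \<le> norm (S \<mu> o\<^sub>C\<^sub>L X) + g X" for X \<mu>
  proof -
    have eq: "X o\<^sub>C\<^sub>L T \<mu> = S \<mu> o\<^sub>C\<^sub>L X - cblinfun_apply D X"
      by (rule cblinfun_eqI)
        (simp add: D_apply S_def T_def cblinfun_rep cblinfun_lin complex_vector.scale_left_diff_distrib)
    show ?thesis
      using norm_triangle_ineq4[of "S \<mu> o\<^sub>C\<^sub>L X" "cblinfun_apply D X"] norm_ge_zero[of "E X"]
      unfolding g_def eq by linarith
  qed
  have "\<exists>K>0. \<exists>L. \<forall>X. norm X \<le> K * norm (S \<mu> o\<^sub>C\<^sub>L X) + L * g X" for \<mu>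
  proof (cases "\<mu> \<in> F")
    case False
    from off[OF this] show ?thesis
    proof
      assume "bounded_below (S \<mu>)"
      then obtain C where C: "C > 0" "\<And>x. norm x \<le> C * norm (cblinfun_apply (S \<mu>) x)"
        unfolding bounded_below_iff_norm_le by blast
      have "norm X \<le> C * norm (S \<mu> o\<^sub>C\<^sub>L X) + 0 * g X" for X
      proof -
        have "(0::'x \<Rightarrow>\<^sub>C\<^sub>L 'x) o\<^sub>C\<^sub>L X = 0" by (rule cblinfun_eqI) (simp add: cblinfun_rep)
        then show ?thesis using norm_le_compose_left[of C 0 "S \<mu>" X] C by (simp add: cblinfun_rep)
      qed
      then show ?thesis using C(1) by blast
    next
      assume "surj (cblinfun_apply (T \<mu>))"
      then obtain C where C: "C > 0" "\<And>y. \<exists>u. cblinfun_apply (T \<mu>) u = y \<and> norm u \<le> C * norm y"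
        using bounded_preimages_if_surj by blast
      have "norm X \<le> C * norm (S \<mu> o\<^sub>C\<^sub>L X) + C * g X" for X
      proof -
        have "X o\<^sub>C\<^sub>L (0::'y \<Rightarrow>\<^sub>C\<^sub>L 'y) = 0" by (rule cblinfun_eqI) (simp add: cblinfun_rep cblinfun_lin)
        then have "norm X \<le> C * norm (X o\<^sub>C\<^sub>L T \<mu>)"
          using norm_le_compose_right[of C "T \<mu>" 0 X] C by (simp add: cblinfun_rep)
        also have "\<dots> \<le> C * (norm (S \<mu> o\<^sub>C\<^sub>L X) + g X)" using XT C(1) by (intro mult_left_mono) auto
        finally show ?thesis by (simp add: distrib_left)
      qed
      then show ?thesis using C(1) by blast
    qed
  next
    case True
    define p q where "p = norm (P \<mu>)" and "q = norm (Q \<mu>)"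
    define a b where "a = \<bar>CP \<mu>\<bar>" and "b = \<bar>CQ \<mu>\<bar>"
    have nn: "p \<ge> 0" "q \<ge> 0" "a \<ge> 0" "b \<ge> 0" by (simp_all add: p_def q_def a_def b_def)
    have "norm X \<le> (a + p * b + 1) * norm (S \<mu> o\<^sub>C\<^sub>L X) + (p * b + p * q) * g X" for X
    proof -
      have "norm (x - cblinfun_apply (P \<mu>) x) \<le> a * norm (cblinfun_apply (S \<mu>) x)" for x
        using order_trans[OF P(4)[OF True, of x] mult_right_mono[of "CP \<mu>" a]] by (simp add: a_def)
      then have 1: "norm (X - P \<mu> o\<^sub>C\<^sub>L X) \<le> a * norm (S \<mu> o\<^sub>C\<^sub>L X)" by (rule norm_le_compose_left[OF nn(3)])
      have "\<exists>u. cblinfun_apply (T \<mu>) u = y - cblinfun_apply (Q \<mu>) y \<and> norm u \<le> b * norm y" for y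
      proof -
        obtain u where "cblinfun_apply (T \<mu>) u = y - cblinfun_apply (Q \<mu>) y" "norm u \<le> CQ \<mu> * norm y"
          using Q(4)[OF True] by blast
        then show ?thesis using order_trans[OF _ mult_right_mono[of "CQ \<mu>" b "norm y"]] by (auto simp: b_def)
      qed
      then have "norm (X - X o\<^sub>C\<^sub>L Q \<mu>) \<le> b * norm (X o\<^sub>C\<^sub>L T \<mu>)" by (rule norm_le_compose_right[OF nn(4)])
      also have "\<dots> \<le> b * (norm (S \<mu> o\<^sub>C\<^sub>L X) + g X)" using XT nn by (intro mult_left_mono) auto
      finally have "p * norm (X - X o\<^sub>C\<^sub>L Q \<mu>) \<le> p * (b * (norm (S \<mu> o\<^sub>C\<^sub>L X) + g X))"
        using nn by (intro mult_left_mono) auto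
      then have 2: "norm (P \<mu> o\<^sub>C\<^sub>L (X - X o\<^sub>C\<^sub>L Q \<mu>)) \<le> p * (b * (norm (S \<mu> o\<^sub>C\<^sub>L X) + g X))"
        using norm_cblinfun_compose[of "P \<mu>" "X - X o\<^sub>C\<^sub>L Q \<mu>"] by (simp add: p_def)
      have "norm (P \<mu> o\<^sub>C\<^sub>L E X o\<^sub>C\<^sub>L Q \<mu>) \<le> (p * norm (E X)) * q"
        unfolding p_def q_def
        by (rule order_trans[OF norm_cblinfun_compose mult_right_mono[OF norm_cblinfun_compose]]) simp
      also have "\<dots> \<le> (p * g X) * q"
        using nn by (intro mult_right_mono mult_left_mono) (auto simp: g_def)
      finally have 3: "norm (P \<mu> o\<^sub>C\<^sub>L X o\<^sub>C\<^sub>L Q \<mu>) \<le> (p * g X) * q" by (simp add: corner[OF True])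
      have "X = (X - P \<mu> o\<^sub>C\<^sub>L X) + (P \<mu> o\<^sub>C\<^sub>L (X - X o\<^sub>C\<^sub>L Q \<mu>) + P \<mu> o\<^sub>C\<^sub>L X o\<^sub>C\<^sub>L Q \<mu>)"
        by (rule cblinfun_eqI) (simp add: cblinfun_rep cblinfun_lin)
      then have "norm X \<le> norm (X - P \<mu> o\<^sub>C\<^sub>L X) + (norm (P \<mu> o\<^sub>C\<^sub>L (X - X o\<^sub>C\<^sub>L Q \<mu>)) + norm (P \<mu> o\<^sub>C\<^sub>L X o\<^sub>C\<^sub>L Q \<mu>))"
        using norm_triangle_ineq order_trans[OF norm_triangle_ineq add_left_mono[OF norm_triangle_ineq]] by metis
      moreover have "(a + p * b + 1) * norm (S \<mu> o\<^sub>C\<^sub>L X) + (p * b + p * q) * g X =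
          a * norm (S \<mu> o\<^sub>C\<^sub>L X) + p * (b * (norm (S \<mu> o\<^sub>C\<^sub>L X) + g X)) + (p * g X) * q
            + norm (S \<mu> o\<^sub>C\<^sub>L X)"
        by (simp add: algebra_simps)
      ultimately show ?thesis using 1 2 3 norm_ge_zero[of "S \<mu> o\<^sub>C\<^sub>L X"] by linarith
    qed
    moreover have "a + p * b + 1 > 0" using nn by (simp add: add_nonneg_pos)
    ultimately show ?thesis by blast
  qed
  note K = this
  have "\<exists>c>0. \<exists>L. \<forall>X. c * norm X \<le> norm (A o\<^sub>C\<^sub>L X - \<mu> *\<^sub>C X) + L * g X" for \<mu>
  proof -
    obtain K L where KL: "K > 0" "\<And>X. norm X \<le> K * norm (S \<mu> o\<^sub>C\<^sub>L X) + L * g X" using K by blast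
    have "1 / K * norm X \<le> norm (A o\<^sub>C\<^sub>L X - \<mu> *\<^sub>C X) + L / K * g X" for X
      using KL(2)[of X] KL(1) by (simp add: shift field_simps)
    moreover have "1 / K > 0" using KL(1) by simp
    ultimately show ?thesis by blast
  qed
  from dominated_by_seminorm[OF this] obtain L where
    "\<And>X. norm X \<le> L * (norm (cblinfun_apply D X) + norm (E X))" unfolding g_def by blast
  from finite_ascent_closed_range_if_nilpotent_part[OF E idem ED nil this] that show thesis by metis
qed

lemma left_pole_projection:
  fixes A :: "'x::complex_banach \<Rightarrow>\<^sub>C\<^sub>L 'x"
  defines "S \<equiv> \<lambda>\<mu>. A - \<mu> *\<^sub>C cblinfun_id"
  assumes pole: "left_pole_of_order A \<mu> d"
    and compl: "complemented {x + y | x y. x \<in> null_space (cblinfun_power (S \<mu>) d) \<and> y \<in> range_space (S \<mu>)}"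
  shows "\<exists>P C. P o\<^sub>C\<^sub>L S \<mu> = S \<mu> o\<^sub>C\<^sub>L P \<and> P o\<^sub>C\<^sub>L P = P \<and>
    (\<forall>x. (cblinfun_apply (S \<mu>) ^^ d) (cblinfun_apply P x) = 0) \<and>
    (\<forall>x. norm (x - cblinfun_apply P x) \<le> C * norm (cblinfun_apply (S \<mu>) x))"
proof -
  have asc: "asc (S \<mu>) = enat d" and cl: "closed (range_space (cblinfun_power (S \<mu>) (d + 1)))"
    using pole by (simp_all add: left_pole_of_order_def S_def)
  have asc': "(cblinfun_apply (S \<mu>) ^^ Suc d) x = 0 \<Longrightarrow> (cblinfun_apply (S \<mu>) ^^ d) x = 0" for x
    using null_space_eq_if_asc[OF asc] unfolding null_space_def cblinfun_power_apply by auto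
  have cl': "closed (range (cblinfun_apply (S \<mu>) ^^ Suc d))"
    using cl unfolding range_space_def cblinfun_power_apply by simp
  have compl': "complemented {x + y | x y. (cblinfun_apply (S \<mu>) ^^ d) x = 0 \<and> y \<in> range (cblinfun_apply (S \<mu>))}"
    using compl unfolding range_space_def null_space_def cblinfun_power_apply by simp
  obtain p C where p: "bounded_clinear p" "\<And>x. p (cblinfun_apply (S \<mu>) x) = cblinfun_apply (S \<mu>) (p x)"
    "\<And>x. (cblinfun_apply (S \<mu>) ^^ d) (p x) = 0" "\<And>x. p (p x) = p x"
    "\<And>x. norm (x - p x) \<le> C * norm (cblinfun_apply (S \<mu>) x)"
    by (rule kato_projection_of_finite_ascent[OF bounded_clinear_cblinfun_apply asc' cl' compl']) (assumption | rule that)+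
  obtain P where P: "cblinfun_apply P = p" using CBlinfun_inverse p(1) by blast
  show ?thesis
    by (intro exI[of _ P] exI[of _ C]) (auto intro!: cblinfun_eqI simp: P cblinfun_rep p)
qed

lemma right_pole_projection:
  fixes B :: "'y::complex_banach \<Rightarrow>\<^sub>C\<^sub>L 'y"
  defines "T \<equiv> \<lambda>\<nu>. B - \<nu> *\<^sub>C cblinfun_id"
  assumes pole: "right_pole_of_order B \<nu> d"
    and compl: "complemented (null_space (T \<nu>) \<inter> range_space (cblinfun_power (T \<nu>) d))"
  shows "\<exists>Q C. Q o\<^sub>C\<^sub>L T \<nu> = T \<nu> o\<^sub>C\<^sub>L Q \<and> Q o\<^sub>C\<^sub>L Q = Q \<and>
    (\<forall>y. (cblinfun_apply (T \<nu>) ^^ d) (cblinfun_apply Q y) = 0) \<and>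
    (\<forall>y. \<exists>u. cblinfun_apply (T \<nu>) u = y - cblinfun_apply Q y \<and> norm u \<le> C * norm y)"
proof -
  have dsc: "dsc (T \<nu>) = enat d" and cl: "closed (range_space (cblinfun_power (T \<nu>) d))"
    using pole by (simp_all add: right_pole_of_order_def T_def)
  have dsc': "range (cblinfun_apply (T \<nu>) ^^ d) = range (cblinfun_apply (T \<nu>) ^^ Suc d)"
    using range_space_eq_if_dsc[OF dsc] unfolding range_space_def cblinfun_power_apply by simp
  have cl': "closed (range (cblinfun_apply (T \<nu>) ^^ d))"
    using cl unfolding range_space_def cblinfun_power_apply .
  have compl': "complemented ({x. cblinfun_apply (T \<nu>) x = 0} \<inter> range (cblinfun_apply (T \<nu>) ^^ d))"
    using compl unfolding range_space_def null_space_def cblinfun_power_apply .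
  obtain q C where q: "bounded_clinear q" "\<And>x. q (cblinfun_apply (T \<nu>) x) = cblinfun_apply (T \<nu>) (q x)"
    "\<And>x. (cblinfun_apply (T \<nu>) ^^ d) (q x) = 0" "\<And>x. q (q x) = q x"
    "\<And>x. \<exists>u. cblinfun_apply (T \<nu>) u = x - q x \<and> norm u \<le> C * norm x"
    by (rule kato_projection_of_finite_descent[OF bounded_clinear_cblinfun_apply dsc' cl' compl']) (rule that)
  obtain Q where Q: "cblinfun_apply Q = q" using CBlinfun_inverse q(1) by blast
  show ?thesis
    by (intro exI[of _ Q] exI[of _ C]) (auto intro!: cblinfun_eqI simp: Q cblinfun_rep q)
qed

lemma sigma_a_bounded:
  fixes A :: "'x::complex_banach \<Rightarrow>\<^sub>C\<^sub>L 'x"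
  assumes "\<mu> \<in> sigma_a A"
  shows "cmod \<mu> \<le> norm A"
proof (rule ccontr)
  assume less: "\<not> cmod \<mu> \<le> norm A"
  have "norm x \<le> 1 / (cmod \<mu> - norm A) * norm (cblinfun_apply (A - \<mu> *\<^sub>C cblinfun_id) x)" for x
  proof -
    have "cmod \<mu> * norm x - norm (cblinfun_apply A x) \<le> norm (cblinfun_apply A x - \<mu> *\<^sub>C x)"
      using norm_triangle_ineq2[of "\<mu> *\<^sub>C x" "cblinfun_apply A x"] by (simp add: norm_scaleC norm_minus_commute)
    then have "(cmod \<mu> - norm A) * norm x \<le> norm (cblinfun_apply A x - \<mu> *\<^sub>C x)"
      using norm_cblinfun[of A x] by (simp add: left_diff_distrib)
    then show ?thesis using less by (simp add: cblinfun_rep field_simps)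
  qed
  moreover have "1 / (cmod \<mu> - norm A) > 0" using less by simp
  ultimately have "bounded_below (A - \<mu> *\<^sub>C cblinfun_id)" unfolding bounded_below_iff_norm_le by blast
  then show False using assms by (simp add: sigma_a_def)
qed

lemma finite_if_bounded_separated:
  fixes F :: "'a::heine_borel set"
  assumes "bounded F" "e > 0" and sep: "\<And>x y. x \<in> F \<Longrightarrow> y \<in> F \<Longrightarrow> dist x y < e \<Longrightarrow> x = y"
  shows "finite F"
proof (rule ccontr)
  assume "infinite F"
  then obtain l where "l islimpt F" using bounded_infinite_imp_islimpt[of F F] assms(1) by blast
  then have inf: "infinite (F \<inter> ball l (e / 2))" using assms(2) by (simp add: islimpt_eq_infinite_ball)
  then obtain x where x: "x \<in> F \<inter> ball l (e / 2)" by (metis finite.emptyI ex_in_conv)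
  have "y = x" if "y \<in> F \<inter> ball l (e / 2)" for y
  proof -
    have "dist y x < e" using dist_triangle_half_r[of l y e x] that x by simp
    then show ?thesis using sep that x by blast
  qed
  then have "F \<inter> ball l (e / 2) \<subseteq> {x}" by blast
  then show False using inf finite_subset by blast
qed

text \<open>
  An isolated point \<open>\<kappa>\<close> of \<open>sigma_a\<close> of the derivation can be written as a difference of points of
  \<open>sigma_a A\<close> and \<open>sigma_s B\<close> in only finitely many ways: moving one of the two points of such a pair
  by a small amount within its spectrum moves the difference by the same amount within \<open>sigma_a\<close> of
  the derivation. The same remark shows that both points of a pair are isolated, hence poles.
\<close>

theorem theorem3p4:
  fixes A :: "'x::complex_banach \<Rightarrow>\<^sub>C\<^sub>L 'x"
    and B :: "'y::complex_banach \<Rightarrow>\<^sub>C\<^sub>L 'y"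
  assumes "left_polaroid A"
    and "right_polaroid B"
    and "property_Pl A"
    and "property_Pr B"
  shows "left_polaroid (generalized_derivation A B)"
  unfolding left_polaroid_def
proof
  let ?\<delta> = "generalized_derivation A B"
  fix \<kappa> assume "\<kappa> \<in> iso (sigma_a ?\<delta>)"
  then obtain \<epsilon> where \<kappa>: "\<kappa> \<in> sigma_a ?\<delta>" and \<epsilon>: "\<epsilon> > 0"
    "\<And>z. z \<in> sigma_a ?\<delta> \<Longrightarrow> dist \<kappa> z < \<epsilon> \<Longrightarrow> z = \<kappa>"
    unfolding iso_def isolated_in_dist_Ex_iff mem_Collect_eq by blast
  define F where "F = {\<mu> \<in> sigma_a A. \<mu> - \<kappa> \<in> sigma_s B}"
  have sepA: "\<mu>' = \<mu>" if "\<mu> \<in> F" "\<mu>' \<in> sigma_a A" "dist \<mu> \<mu>' < \<epsilon>" for \<mu> \<mu>'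
  proof -
    have "\<mu>' - (\<mu> - \<kappa>) \<in> sigma_a ?\<delta>"
      using that by (intro sigma_a_minus_sigma_s_subset) (auto simp: F_def)
    moreover have "dist \<kappa> (\<mu>' - (\<mu> - \<kappa>)) < \<epsilon>" using that(3) by (simp add: dist_norm)
    ultimately have "\<mu>' - (\<mu> - \<kappa>) = \<kappa>" by (rule \<epsilon>(2))
    then show ?thesis by (simp add: algebra_simps)
  qed
  have sepB: "\<nu> = \<mu> - \<kappa>" if "\<mu> \<in> F" "\<nu> \<in> sigma_s B" "dist (\<mu> - \<kappa>) \<nu> < \<epsilon>" for \<mu> \<nu>
  proof -
    have "\<mu> - \<nu> \<in> sigma_a ?\<delta>"
      using that by (intro sigma_a_minus_sigma_s_subset) (auto simp: F_def)
    moreover have "dist \<kappa> (\<mu> - \<nu>) < \<epsilon>"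
    proof -
      have "\<kappa> - (\<mu> - \<nu>) = - (\<mu> - \<kappa> - \<nu>)" by simp
      then show ?thesis using that(3) unfolding dist_norm by (metis norm_minus_cancel)
    qed
    ultimately have "\<mu> - \<nu> = \<kappa>" by (rule \<epsilon>(2))
    then show ?thesis by (simp add: algebra_simps)
  qed
  have isoA: "\<mu> \<in> iso (sigma_a A)" if "\<mu> \<in> F" for \<mu>
    unfolding iso_def isolated_in_dist_Ex_iff mem_Collect_eq
    using that sepA[OF that] \<epsilon>(1) by (auto simp: F_def)
  have isoB: "\<mu> - \<kappa> \<in> iso (sigma_s B)" if "\<mu> \<in> F" for \<mu>
    unfolding iso_def isolated_in_dist_Ex_iff mem_Collect_eq
    using that sepB[OF that] \<epsilon>(1) by (auto simp: F_def)
  have fin: "finite F"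
  proof (rule finite_if_bounded_separated[OF _ \<epsilon>(1)])
    show "bounded F" unfolding bounded_iff using sigma_a_bounded by (auto simp: F_def)
    show "x = y" if "x \<in> F" "y \<in> F" "dist x y < \<epsilon>" for x y
      using sepA[OF that(1) _ that(3)] that(2) by (simp add: F_def)
  qed
  define S where "S \<mu> = A - \<mu> *\<^sub>C cblinfun_id" for \<mu>
  define T where "T \<mu> = B - (\<mu> - \<kappa>) *\<^sub>C cblinfun_id" for \<mu>
  have "\<exists>d P C. P o\<^sub>C\<^sub>L S \<mu> = S \<mu> o\<^sub>C\<^sub>L P \<and> P o\<^sub>C\<^sub>L P = P \<and>
    (\<forall>x. (cblinfun_apply (S \<mu>) ^^ d) (cblinfun_apply P x) = 0) \<and>
    (\<forall>x. norm (x - cblinfun_apply P x) \<le> C * norm (cblinfun_apply (S \<mu>) x))" if F: "\<mu> \<in> F" for \<mu>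
  proof -
    obtain d where d: "left_pole_of_order A \<mu> d"
      using isoA[OF F] assms(1) unfolding left_polaroid_def by blast
    then show ?thesis
      using left_pole_projection[OF d] isoA[OF F] assms(3) unfolding property_Pl_def S_def by blast
  qed
  then obtain d P CP where P: "\<And>\<mu>. \<mu> \<in> F \<Longrightarrow> P \<mu> o\<^sub>C\<^sub>L S \<mu> = S \<mu> o\<^sub>C\<^sub>L P \<mu>" "\<And>\<mu>. \<mu> \<in> F \<Longrightarrow> P \<mu> o\<^sub>C\<^sub>L P \<mu> = P \<mu>"
      "\<And>\<mu> x. \<mu> \<in> F \<Longrightarrow> (cblinfun_apply (S \<mu>) ^^ d \<mu>) (cblinfun_apply (P \<mu>) x) = 0"
      "\<And>\<mu> x. \<mu> \<in> F \<Longrightarrow> norm (x - cblinfun_apply (P \<mu>) x) \<le> CP \<mu> * norm (cblinfun_apply (S \<mu>) x)"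
    by metis
  have "\<exists>e Q C. Q o\<^sub>C\<^sub>L T \<mu> = T \<mu> o\<^sub>C\<^sub>L Q \<and> Q o\<^sub>C\<^sub>L Q = Q \<and>
    (\<forall>y. (cblinfun_apply (T \<mu>) ^^ e) (cblinfun_apply Q y) = 0) \<and>
    (\<forall>y. \<exists>u. cblinfun_apply (T \<mu>) u = y - cblinfun_apply Q y \<and> norm u \<le> C * norm y)" if F: "\<mu> \<in> F" for \<mu>
  proof -
    obtain e where e: "right_pole_of_order B (\<mu> - \<kappa>) e"
      using isoB[OF F] assms(2) unfolding right_polaroid_def by blast
    then show ?thesis
      using right_pole_projection[OF e] isoB[OF F] assms(4) unfolding property_Pr_def T_def by blast
  qed
  then obtain e Q CQ where Q: "\<And>\<mu>. \<mu> \<in> F \<Longrightarrow> Q \<mu> o\<^sub>C\<^sub>L T \<mu> = T \<mu> o\<^sub>C\<^sub>L Q \<mu>" "\<And>\<mu>. \<mu> \<in> F \<Longrightarrow> Q \<mu> o\<^sub>C\<^sub>L Q \<mu> = Q \<mu>"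
      "\<And>\<mu> y. \<mu> \<in> F \<Longrightarrow> (cblinfun_apply (T \<mu>) ^^ e \<mu>) (cblinfun_apply (Q \<mu>) y) = 0"
      "\<And>\<mu> y. \<mu> \<in> F \<Longrightarrow> \<exists>u. cblinfun_apply (T \<mu>) u = y - cblinfun_apply (Q \<mu>) y \<and> norm u \<le> CQ \<mu> * norm y"
    by metis
  have off: "bounded_below (S \<mu>) \<or> surj (cblinfun_apply (T \<mu>))" if "\<mu> \<notin> F" for \<mu>
    using that by (auto simp: F_def sigma_a_def sigma_s_def S_def T_def)
  obtain n where "asc (?\<delta> - \<kappa> *\<^sub>C cblinfun_id) = enat n"
    "closed (range_space (cblinfun_power (?\<delta> - \<kappa> *\<^sub>C cblinfun_id) (n + 1)))"
    using left_pole_of_derivation_if_spectral_projections[where A = A and B = B and \<kappa> = \<kappa>,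
        folded S_def T_def, OF fin off P Q] by blast
  then show "\<exists>d. left_pole_of_order ?\<delta> \<kappa> d"
    using \<kappa> unfolding left_pole_of_order_def by blast
qed

end
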